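(* Let $(\lambda,\rho)$ be a degree distribution pair and let $G$ be chosen uniformly at random from LDPC$(n,\Lambda,\Gamma)$, used to transmit a uniformly chosen codeword $X$ over BEC$(\epsilon)$ with output $Y$. Let $x\in[0,1]$ be the largest solution of $x=\epsilon\lambda(1-\rho(1-x))$ and $y=1-\rho(1-x)$. Let $\Xi_\epsilon=(\Lambda_\epsilon,\Gamma_\epsilon)$ with $$\Lambda_\epsilon(z)=\epsilon\Lambda(zy),\qquad \Gamma_\epsilon(z)=\Gamma(1-x+zx)-\Gamma(1-x)-zx\Gamma'(1-x).$$ Assume that $\epsilon$ is non-exceptional and that $u\mapsto\Psi_{\Xi_\epsilon}(u)$ achieves its global maximum over $u\in[0,\infty)$ at $u=1$, with $\Psi''_{\Xi_\epsilon}(1)<0$. Then $$\lim_{n\to\infty}\frac1n\mathbb{E}[H_G(X\mid Y)]=P_\epsilon(x,y).$$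
   Context: A degree distribution pair is $(\lambda,\rho)$ with $\lambda(x)=\sum_{j\ge2}\lambda_jx^{j-1}$, $\rho(x)=\sum_{j\ge2}\rho_jx^{j-1}$, nonnegative coefficients, $\lambda(1)=\rho(1)=1$; node perspective $\Lambda(x)=\int_0^x\lambda/\int_0^1\lambda=\sum_i\Lambda_ix^i$, $\Gamma(x)=\int_0^x\rho/\int_0^1\rho=\sum_j\Gamma_jx^j$. LDPC$(n,\Lambda,\Gamma)$ is the standard random ensemble of Tanner graphs with $n$ variable nodes ($n\Lambda_i$ of degree $i$) and $n\Lambda'(1)/\Gamma'(1)$ check nodes (fraction $\Gamma_j$ of degree $j$), sockets matched by a uniformly random permutation; the code is the null space mod 2. BEC$(\epsilon)$ erases each bit independently with probability $\epsilon$. Entropies are in bits. Trial entropy: $P_\epsilon(x,y)=\Lambda'(1)x(1-y)-\frac{\Lambda'(1)}{\Gamma'(1)}[1-\Gamma(1-x)]+\epsilon\Lambda(y)$. $\epsilon$ is non-exceptional if it is a continuity point of the map $\epsilon\mapsto x(\epsilon)$, where $x(\epsilon)$ is the largest solution in $[0,1]$ of $x=\epsilon\lambda(1-\rho(1-x))$. For a pair $\Xi=(\Lambda,\Gamma)$ of polynomials with nonnegative coefficients $\Lambda(z)=\sum_l\Lambda_lz^l$, $\Gamma(z)=\sum_r\Gamma_rz^r$, set $\lambda(z)=\Lambda'(z)/\Lambda'(1)=\sum_l\lambda_lz^{l-1}$ and define for $u\ge0$ $$\Psi_\Xi(u)=-\Lambda'(1)\log_2\Big[\frac{1+uv}{(1+u)(1+v)}\Big]+\sum_l\Lambda_l\log_2\Big[\frac{1+u^l}{2(1+u)^l}\Big]+\frac{\Lambda'(1)}{\Gamma'(1)}\sum_r\Gamma_r\log_2\Big[1+\Big(\frac{1-v}{1+v}\Big)^r\Big],$$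 where $v=v(u)=\Big(\sum_l\frac{\lambda_l}{1+u^l}\Big)^{-1}\Big(\sum_l\frac{\lambda_lu^{l-1}}{1+u^l}\Big)$. *)

theory Defs
  imports "HOL-Analysis.Analysis" "HOL-Computational_Algebra.Polynomial"
          "HOL-Combinatorics.Permutations"
begin

text \<open>Edge-perspective degree distributions lambda, rho are real polynomials
  lambda(x) = sum_{j>=2} lambda_j x^(j-1): coefficient k of the polynomial is lambda_(k+1).\<close>

definition ddp :: "real poly \<Rightarrow> real poly \<Rightarrow> bool" where
  "ddp lam rho \<longleftrightarrow> coeff lam 0 = 0 \<and> coeff rho 0 = 0 \<and>
     (\<forall>k. coeff lam k \<ge> 0) \<and> (\<forall>k. coeff rho k \<ge> 0) \<and>
     poly lam 1 = 1 \<and> poly rho 1 = 1"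

definition antideriv :: "real poly \<Rightarrow> real poly" where
  "antideriv p = Poly (0 # map (\<lambda>k. coeff p k / real (Suc k)) [0..<Suc (degree p)])"

definition nodep :: "real poly \<Rightarrow> real poly" where
  "nodep p = smult (1 / poly (antideriv p) 1) (antideriv p)"

definition dderiv1 :: "real poly \<Rightarrow> real" where
  "dderiv1 P = poly (pderiv P) 1"

definition ncheck :: "real poly \<Rightarrow> real poly \<Rightarrow> nat \<Rightarrow> real" where
  "ncheck Lam Gam n = real n * dderiv1 Lam / dderiv1 Gam"

definition ldpc_adm :: "real poly \<Rightarrow> real poly \<Rightarrow> nat \<Rightarrow> bool" where
  "ldpc_adm Lam Gam n \<longleftrightarrow> (\<forall>i. real n * coeff Lam i \<in> \<nat>) \<and>
     ncheck Lam Gam n \<in> \<nat> \<and> (\<forall>j. ncheck Lam Gam n * coeff Gam j \<in> \<nat>)"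

definition degs :: "real poly \<Rightarrow> real \<Rightarrow> nat list" where
  "degs P N = concat (map (\<lambda>i. replicate (nat \<lfloor>N * coeff P i\<rfloor>) i) [0..<Suc (degree P)])"

text \<open>Sockets 0..<sum ds are laid out consecutively; owner ds s is the node owning socket s.\<close>
definition owner :: "nat list \<Rightarrow> nat \<Rightarrow> nat" where
  "owner ds s = card {v. v < length ds \<and> sum_list (take (Suc v) ds) \<le> s}"

definition vdegs :: "real poly \<Rightarrow> nat \<Rightarrow> nat list" where
  "vdegs Lam n = degs Lam (real n)"

definition cdegs :: "real poly \<Rightarrow> real poly \<Rightarrow> nat \<Rightarrow> nat list" where
  "cdegs Lam Gam n = degs Gam (ncheck Lam Gam n)"

definition nedges :: "real poly \<Rightarrow> nat \<Rightarrow> nat" where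
  "nedges Lam n = sum_list (vdegs Lam n)"

text \<open>The code (null space mod 2) of the Tanner graph in which variable socket s
  is matched to check socket pi s (multi-edges counted with multiplicity).\<close>
definition ldpc_code :: "real poly \<Rightarrow> real poly \<Rightarrow> nat \<Rightarrow> (nat \<Rightarrow> nat) \<Rightarrow> (nat \<Rightarrow> bool) set" where
  "ldpc_code Lam Gam n \<pi> =
     {x \<in> {0..<n} \<rightarrow>\<^sub>E (UNIV :: bool set).
        \<forall>k < length (cdegs Lam Gam n).
          even (card {s \<in> {0..<nedges Lam n}.
                      owner (cdegs Lam Gam n) (\<pi> s) = k \<and> x (owner (vdegs Lam n) s)})}"

text \<open>BEC transition probability; None is the erasure symbol.\<close>
definition bec_W :: "real \<Rightarrow> bool \<Rightarrow> bool option \<Rightarrow> real" where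
  "bec_W eps b yo = (case yo of None \<Rightarrow> eps | Some b' \<Rightarrow> (if b' = b then 1 - eps else 0))"

definition bec_joint :: "real \<Rightarrow> nat \<Rightarrow> (nat \<Rightarrow> bool) set \<Rightarrow> (nat \<Rightarrow> bool) \<Rightarrow> (nat \<Rightarrow> bool option) \<Rightarrow> real" where
  "bec_joint eps n C x y = (1 / real (card C)) * (\<Prod>i<n. bec_W eps (x i) (y i))"

definition bec_out :: "real \<Rightarrow> nat \<Rightarrow> (nat \<Rightarrow> bool) set \<Rightarrow> (nat \<Rightarrow> bool option) \<Rightarrow> real" where
  "bec_out eps n C y = (\<Sum>x\<in>C. bec_joint eps n C x y)"

definition cond_entropy_bec :: "real \<Rightarrow> nat \<Rightarrow> (nat \<Rightarrow> bool) set \<Rightarrow> real" where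
  "cond_entropy_bec eps n C =
     (\<Sum>x\<in>C. \<Sum>y\<in>{0..<n} \<rightarrow>\<^sub>E (UNIV :: bool option set).
        (if bec_joint eps n C x y = 0 then 0
         else - bec_joint eps n C x y * log 2 (bec_joint eps n C x y / bec_out eps n C y)))"

text \<open>E_G[H_G(X|Y)] for G uniform in LDPC(n,Lambda,Gamma) (uniform socket permutation).\<close>
definition ldpc_avg_entropy :: "real poly \<Rightarrow> real poly \<Rightarrow> real \<Rightarrow> nat \<Rightarrow> real" where
  "ldpc_avg_entropy Lam Gam eps n =
     (\<Sum>\<pi> | \<pi> permutes {0..<nedges Lam n}. cond_entropy_bec eps n (ldpc_code Lam Gam n \<pi>))
       / fact (nedges Lam n)"

definition bp_fix :: "real poly \<Rightarrow> real poly \<Rightarrow> real \<Rightarrow> real" where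
  "bp_fix lam rho eps = Sup {x \<in> {0..1}. x = eps * poly lam (1 - poly rho (1 - x))}"

definition non_exceptional :: "real poly \<Rightarrow> real poly \<Rightarrow> real \<Rightarrow> bool" where
  "non_exceptional lam rho eps \<longleftrightarrow> continuous (at eps within {0..1}) (bp_fix lam rho)"

definition trial_entropy :: "real poly \<Rightarrow> real poly \<Rightarrow> real \<Rightarrow> real \<Rightarrow> real \<Rightarrow> real" where
  "trial_entropy Lam Gam eps x y =
     dderiv1 Lam * x * (1 - y) - dderiv1 Lam / dderiv1 Gam * (1 - poly Gam (1 - x))
     + eps * poly Lam y"

definition Psi :: "real poly \<Rightarrow> real poly \<Rightarrow> real \<Rightarrow> real" where
  "Psi Lam Gam u =
    (let lm = (\<lambda>l. coeff (pderiv Lam) (l - 1) / dderiv1 Lam);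
         v = (\<Sum>l\<in>{1..degree Lam}. lm l * u ^ (l - 1) / (1 + u ^ l))
             / (\<Sum>l\<in>{1..degree Lam}. lm l / (1 + u ^ l))
     in - dderiv1 Lam * log 2 ((1 + u * v) / ((1 + u) * (1 + v)))
        + (\<Sum>l\<le>degree Lam. coeff Lam l * log 2 ((1 + u ^ l) / (2 * (1 + u) ^ l)))
        + dderiv1 Lam / dderiv1 Gam *
          (\<Sum>r\<le>degree Gam. coeff Gam r * log 2 (1 + ((1 - v) / (1 + v)) ^ r)))"

definition Lam_eps :: "real poly \<Rightarrow> real poly \<Rightarrow> real \<Rightarrow> real poly" where
  "Lam_eps lam rho eps =
     (let x = bp_fix lam rho eps; y = 1 - poly rho (1 - x)
      in smult eps (nodep lam \<circ>\<^sub>p [:0, y:]))"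

definition Gam_eps :: "real poly \<Rightarrow> real poly \<Rightarrow> real \<Rightarrow> real poly" where
  "Gam_eps lam rho eps =
     (let x = bp_fix lam rho eps; Gam = nodep rho
      in Gam \<circ>\<^sub>p [:1 - x, x:] - [:poly Gam (1 - x):] - [:0, x * poly (pderiv Gam) (1 - x):])"

end

theory Submission
  imports Defs
begin

text \<open>
  For a linear code, \<open>H(X|Y)\<close> is the expectation over the erased set of the dimension of the
  kernel of the parity-check matrix restricted to the erased columns. Peeling (deleting every
  variable next to a check of residual degree one) preserves this kernel, and after each round of
  peeling the residual graph is again a uniform matching given its sockets. In one round the
  residual degree profile is changed by two uniform random subsets of sockets, so by Chebyshev's
  inequality it follows the recursion \<open>x\<^sub>t = \<epsilon> \<lambda>(y\<^sub>t)\<close>, \<open>y\<^sub>t\<^sub>+\<^sub>1 = 1 - \<rho>(1 - x\<^sub>t)\<close>, which decreases to the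
  largest fixed point \<open>(x, y)\<close>. The profile of variables is then \<open>\<epsilon> \<Lambda>(z y)\<close>, and the profile of
  checks of degree at least two is that of \<open>\<Gamma>(1 - x + z x)\<close>.

  Near the limiting profile the kernel has dimension at least (variables) - (checks), which is
  \<open>n P\<^sub>\<epsilon>(x, y)\<close> up to \<open>o(n)\<close>. By Jensen's inequality the expected dimension is at most the logarithm
  of the expected size of the kernel; the words of edge weight \<open>w\<close> contribute at most
  \<open>2 powr (n (P + \<Psi>(u)))\<close> up to subexponential factors, where \<open>u\<close> is the saddle point belonging to \<open>w\<close>, and
  \<open>\<Psi>(u) \<le> \<Psi>(1) = 0\<close>. A number \<open>t\<close> of rounds independent of \<open>n\<close> suffices: the estimate
  is transported backwards from the residual graph after \<open>t\<close> rounds to the original one.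
\<close>

section \<open>Uniform bijections between finite sets\<close>

text \<open>The limits in block length and in peeling rounds are never exchanged. The first-moment
  bound holds on a whole neighbourhood of the limiting profile, for every state there and not only
  for residual graphs that peeling produces; once the profile after some fixed t rounds lies inside
  it, finitely many concentration steps suffice.

  Uniformity survives a round because only the set of variable sockets matched to degree-one checks
  is revealed. The remaining matching is uniform but partial: sockets of deleted variables leave
  check sockets without a partner. Hence two averages alternate, \<open>lent\<close> for perfect
  matchings and \<open>ment\<close> for a uniformly thinned check side, and each round has a
  variable half (peeling) and a check half (thinning).

  The assumptions on \<open>Psi\<close> enter in three ways. Its value 0 at u = 1 turns maximality
  into the upper bound P on the exponent; its value -P at u = 0 gives P \<ge> 0; the negative second
  derivative excludes x = 0, where \<open>Psi\<close> vanishes identically.\<close>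

definition avg :: "'a set \<Rightarrow> ('a \<Rightarrow> real) \<Rightarrow> real" where
  "avg A f = (\<Sum>a\<in>A. f a) / real (card A)"

definition ksubsets :: "'a set \<Rightarrow> nat \<Rightarrow> 'a set set" where
  "ksubsets S k = {A. A \<subseteq> S \<and> card A = k}"

definition bijs :: "'a set \<Rightarrow> 'b set \<Rightarrow> ('a \<Rightarrow> 'b) set" where
  "bijs S T = {\<sigma> \<in> S \<rightarrow>\<^sub>E T. bij_betw \<sigma> S T}"

lemma avg_cong: "(\<And>a. a \<in> A \<Longrightarrow> f a = g a) \<Longrightarrow> avg A f = avg A g"
  by (simp add: avg_def)

lemma finite_ksubsets [simp]: "finite S \<Longrightarrow> finite (ksubsets S k)"
  unfolding ksubsets_def by (rule finite_subset[of _ "Pow S"]) auto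

lemma card_ksubsets: "finite S \<Longrightarrow> card (ksubsets S k) = card S choose k"
  unfolding ksubsets_def by (rule n_subsets)

lemma card_ksubsets_pos: "finite S \<Longrightarrow> k \<le> card S \<Longrightarrow> card (ksubsets S k) > 0"
  by (simp add: card_ksubsets)

lemma finite_bijs [simp]: "finite S \<Longrightarrow> finite T \<Longrightarrow> finite (bijs S T)"
  unfolding bijs_def by (rule finite_subset[OF _ finite_PiE[of S "\<lambda>_. T"]]) auto

text \<open>The ensemble draws a permutation of socket numbers, while the argument uses bijections
  between arbitrary socket sets; this identifies the two uniform laws. With \<open>g\<close> the
  identity it also counts the bijections.\<close>

lemma bijs_bij_betw_permutes:
  assumes g: "bij_betw g S U" and h: "bij_betw h U T"
  shows "bij_betw (\<lambda>p. restrict (h \<circ> p \<circ> g) S) {p. p permutes U} (bijs S T)"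
proof (rule bij_betw_imageI)
  show "inj_on (\<lambda>p. restrict (h \<circ> p \<circ> g) S) {p. p permutes U}"
  proof (rule inj_onI)
    fix p q assume p: "p \<in> {p. p permutes U}" and q: "q \<in> {p. p permutes U}"
      and eq: "restrict (h \<circ> p \<circ> g) S = restrict (h \<circ> q \<circ> g) S"
    have "p x = q x" for x
    proof (cases "x \<in> U")
      case True
      then obtain s where s: "s \<in> S" "x = g s" using g by (auto simp: bij_betw_def)
      have "h (p x) = h (q x)" using fun_cong[OF eq, of s] s by simp
      moreover have "p x \<in> U" "q x \<in> U" using p q True permutes_in_image by fastforce+
      ultimately show ?thesis using h by (auto simp: bij_betw_def inj_on_def)
    next
      case False
      then show ?thesis using p q by (auto simp: permutes_def)
    qed
    then show "p = q" by auto
  qed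
  show "(\<lambda>p. restrict (h \<circ> p \<circ> g) S) ` {p. p permutes U} = bijs S T"
  proof
    show "(\<lambda>p. restrict (h \<circ> p \<circ> g) S) ` {p. p permutes U} \<subseteq> bijs S T"
    proof clarify
      fix p assume p: "p permutes U"
      have "bij_betw (h \<circ> p \<circ> g) S T"
        using g h permutes_imp_bij[OF p] bij_betw_trans by (metis comp_assoc)
      then show "restrict (h \<circ> p \<circ> g) S \<in> bijs S T"
        unfolding bijs_def
        using bij_betw_apply[of "h \<circ> p \<circ> g" S T]
        by (auto simp: bij_betw_cong[of S "restrict (h \<circ> p \<circ> g) S" "h \<circ> p \<circ> g"])
    qed
    show "bijs S T \<subseteq> (\<lambda>p. restrict (h \<circ> p \<circ> g) S) ` {p. p permutes U}"
    proof
      fix \<sigma> assume s: "\<sigma> \<in> bijs S T"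
      define q where "q = inv_into U h \<circ> \<sigma> \<circ> inv_into S g"
      define p where "p x = (if x \<in> U then q x else x)" for x
      have "bij_betw q U U" unfolding q_def
        using s bij_betw_inv_into[OF g] bij_betw_inv_into[OF h]
        by (auto simp: bijs_def intro!: bij_betw_trans)
      then have "bij_betw p U U" using bij_betw_cong[of U p q] by (simp add: p_def)
      then have p: "p permutes U" by (rule bij_imp_permutes) (simp add: p_def)
      have "restrict (h \<circ> p \<circ> g) S x = \<sigma> x" for x
      proof (cases "x \<in> S")
        case True
        then have "g x \<in> U" "inv_into S g (g x) = x" "\<sigma> x \<in> T"
          using g s by (auto simp: bij_betw_def bijs_def)
        then show ?thesis using True h
          by (auto simp: p_def q_def bij_betw_def f_inv_into_f)
      next
        case False
        then show ?thesis using s by (auto simp: bijs_def PiE_def extensional_def)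
      qed
      then have "\<sigma> = restrict (h \<circ> p \<circ> g) S" by auto
      then show "\<sigma> \<in> (\<lambda>p. restrict (h \<circ> p \<circ> g) S) ` {p. p permutes U}" using p by blast
    qed
  qed
qed

lemma card_bijs:
  assumes "finite S" "finite T" "card S = card T"
  shows "card (bijs S T) = fact (card S)"
proof -
  obtain h where "bij_betw h S T" using finite_same_card_bij assms by blast
  from bij_betw_same_card[OF bijs_bij_betw_permutes[OF bij_betw_id this]]
  show ?thesis using card_permutations[OF refl assms(1)] by simp
qed

definition glue :: "'a set \<Rightarrow> ('a \<Rightarrow> 'b) \<Rightarrow> ('a \<Rightarrow> 'b) \<Rightarrow> 'a \<Rightarrow> 'b" where
  "glue A \<sigma> \<tau> = (\<lambda>s. if s \<in> A then \<sigma> s else \<tau> s)"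

text \<open>A bijection that maps \<open>A\<close> onto \<open>B\<close> amounts to two free
  choices, one bijection inside \<open>A\<close> and one outside. Every conditioning of a uniform
  matching below rests on this splitting.\<close>

lemma sum_bijs_fibre:
  fixes f :: "('a \<Rightarrow> 'b) \<Rightarrow> real"
  assumes "A \<subseteq> S" "B \<subseteq> T"
  shows "(\<Sum>\<sigma> | \<sigma> \<in> bijs S T \<and> \<sigma> ` A = B. f \<sigma>) =
         (\<Sum>(\<sigma>,\<tau>)\<in>bijs A B \<times> bijs (S - A) (T - B). f (glue A \<sigma> \<tau>))"
proof (rule sum.reindex_bij_witness[of _ "\<lambda>(\<sigma>,\<tau>). glue A \<sigma> \<tau>" "\<lambda>\<sigma>. (restrict \<sigma> A, restrict \<sigma> (S - A))"])
  fix \<sigma> assume \<sigma>: "\<sigma> \<in> {\<sigma> \<in> bijs S T. \<sigma> ` A = B}"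
  then have bij: "bij_betw \<sigma> S T" and ext: "\<sigma> \<in> S \<rightarrow>\<^sub>E T" and im: "\<sigma> ` A = B"
    by (auto simp: bijs_def)
  show gl: "(case (restrict \<sigma> A, restrict \<sigma> (S - A)) of (\<sigma>, \<tau>) \<Rightarrow> glue A \<sigma> \<tau>) = \<sigma>"
    using ext assms by (auto simp: glue_def fun_eq_iff PiE_def extensional_def)
  have inj: "inj_on \<sigma> S" "\<sigma> ` S = T" using bij by (auto simp: bij_betw_def)
  have im2: "\<sigma> ` (S - A) = T - B"
    using inj im assms inj_on_image_set_diff[OF inj(1), of S A] by auto
  have "bij_betw \<sigma> A B" "bij_betw \<sigma> (S - A) (T - B)"
    using inj im im2 assms by (auto simp: bij_betw_def intro: inj_on_subset)
  then show "(restrict \<sigma> A, restrict \<sigma> (S - A)) \<in> bijs A B \<times> bijs (S - A) (T - B)"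
    using im im2 by (auto simp: bijs_def)
  show "(case (restrict \<sigma> A, restrict \<sigma> (S - A)) of (\<sigma>, \<tau>) \<Rightarrow> f (glue A \<sigma> \<tau>)) = f \<sigma>"
    using gl by simp
next
  fix p assume "p \<in> bijs A B \<times> bijs (S - A) (T - B)"
  then obtain \<sigma> \<tau> where p: "p = (\<sigma>, \<tau>)" "\<sigma> \<in> bijs A B" "\<tau> \<in> bijs (S - A) (T - B)" by auto
  show "(restrict (case p of (\<sigma>, \<tau>) \<Rightarrow> glue A \<sigma> \<tau>) A,
         restrict (case p of (\<sigma>, \<tau>) \<Rightarrow> glue A \<sigma> \<tau>) (S - A)) = p"
    using p by (auto simp: glue_def bijs_def fun_eq_iff PiE_def extensional_def)
  have "bij_betw (glue A \<sigma> \<tau>) A B"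
    using p bij_betw_cong[of A "glue A \<sigma> \<tau>" \<sigma> B] by (simp add: glue_def bijs_def)
  moreover have "bij_betw (glue A \<sigma> \<tau>) (S - A) (T - B)"
    using p bij_betw_cong[of "S - A" "glue A \<sigma> \<tau>" \<tau> "T - B"] by (simp add: glue_def bijs_def)
  ultimately have b: "bij_betw (glue A \<sigma> \<tau>) (A \<union> (S - A)) (B \<union> (T - B)) \<and> glue A \<sigma> \<tau> ` A = B"
    using bij_betw_combine[of "glue A \<sigma> \<tau>" A B "S - A" "T - B"] by (simp add: bij_betw_def)
  moreover have "A \<union> (S - A) = S" "B \<union> (T - B) = T" using assms by auto
  ultimately have "bij_betw (glue A \<sigma> \<tau>) S T" by simp
  moreover have "glue A \<sigma> \<tau> \<in> S \<rightarrow>\<^sub>E T"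
    using p assms by (auto simp: glue_def bijs_def PiE_def extensional_def Pi_def)
  ultimately show "(case p of (\<sigma>, \<tau>) \<Rightarrow> glue A \<sigma> \<tau>) \<in> {\<sigma> \<in> bijs S T. \<sigma> ` A = B}"
    using p b by (auto simp: bijs_def)
qed

lemma fact_ratio_choose:
  assumes "k \<le> n"
  shows "real (fact k) * real (fact (n - k)) * real (n choose k) = fact n"
  using binomial_fact_lemma[OF assms]
  by (metis of_nat_fact of_nat_mult)

lemma sum_div_rescale:
  fixes x :: "'a \<Rightarrow> real"
  assumes "a * b * c = d" "a \<noteq> 0" "b \<noteq> 0" "c \<noteq> 0"
  shows "(\<Sum>i\<in>I. x i / a) / c = (\<Sum>i\<in>I. b * x i) / d"
proof -
  define s where "s = (\<Sum>i\<in>I. x i)"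
  have "(\<Sum>i\<in>I. x i / a) = s / a" "(\<Sum>i\<in>I. b * x i) = b * s"
    by (simp_all add: s_def sum_divide_distrib sum_distrib_left)
  then show ?thesis using assms by (auto simp: field_simps)
qed

text \<open>Each bijection from \<open>A\<close> to \<open>B\<close> has
  \<open>fact (card S - card A)\<close> completions, whatever \<open>B\<close> is. So the
  restriction to \<open>A\<close> is a uniform bijection onto a uniform subset of
  \<open>T\<close>.\<close>

lemma avg_bijs_image:
  assumes fin: "finite S" "finite T" "card S = card T" and A: "A \<subseteq> S"
  shows "avg (bijs S T) (\<lambda>\<sigma>. f (restrict \<sigma> A)) =
         avg (ksubsets T (card A)) (\<lambda>B. avg (bijs A B) f)"
proof -
  have fA: "finite A" using fin A finite_subset by blast
  have cA: "card A \<le> card S" using A fin card_mono by blast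
  have sub: "(\<lambda>\<sigma>. \<sigma> ` A) ` bijs S T \<subseteq> ksubsets T (card A)"
  proof clarify
    fix \<sigma> assume "\<sigma> \<in> bijs S T"
    then have "inj_on \<sigma> S" "\<sigma> ` S = T" by (auto simp: bijs_def bij_betw_def)
    then show "\<sigma> ` A \<in> ksubsets T (card A)"
      using A by (auto simp: ksubsets_def intro!: card_image intro: inj_on_subset)
  qed
  have "(\<Sum>\<sigma>\<in>bijs S T. f (restrict \<sigma> A)) =
        (\<Sum>B\<in>ksubsets T (card A). \<Sum>\<sigma> | \<sigma> \<in> bijs S T \<and> \<sigma> ` A = B. f (restrict \<sigma> A))"
    using fin by (intro sum.group[symmetric] sub) auto
  also have "\<dots> = (\<Sum>B\<in>ksubsets T (card A). fact (card S - card A) * (\<Sum>\<sigma>\<in>bijs A B. f \<sigma>))"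
  proof (rule sum.cong[OF refl])
    fix B assume B: "B \<in> ksubsets T (card A)"
    then have B': "B \<subseteq> T" "card B = card A" "finite B"
      using fin finite_subset by (auto simp: ksubsets_def)
    have eq: "restrict (glue A \<sigma> \<tau>) A = \<sigma>" if "\<sigma> \<in> bijs A B" for \<sigma> \<tau>
      using that by (auto simp: glue_def bijs_def fun_eq_iff PiE_def extensional_def)
    have card: "card (bijs (S - A) (T - B)) = fact (card S - card A)"
      using fin A B' fA by (subst card_bijs) (auto simp: card_Diff_subset)
    have "(\<Sum>\<sigma> | \<sigma> \<in> bijs S T \<and> \<sigma> ` A = B. f (restrict \<sigma> A)) =
          (\<Sum>(\<sigma>,\<tau>)\<in>bijs A B \<times> bijs (S - A) (T - B). f (restrict (glue A \<sigma> \<tau>) A))"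
      by (rule sum_bijs_fibre[OF A B'(1)])
    also have "\<dots> = (\<Sum>(\<sigma>,\<tau>)\<in>bijs A B \<times> bijs (S - A) (T - B). f \<sigma>)"
      by (rule sum.cong) (auto simp: eq)
    also have "\<dots> = fact (card S - card A) * (\<Sum>\<sigma>\<in>bijs A B. f \<sigma>)"
      by (simp add: sum.cartesian_product[symmetric] card sum_distrib_left)
    finally show "(\<Sum>\<sigma> | \<sigma> \<in> bijs S T \<and> \<sigma> ` A = B. f (restrict \<sigma> A)) =
      fact (card S - card A) * (\<Sum>\<sigma>\<in>bijs A B. f \<sigma>)" .
  qed
  finally have s: "(\<Sum>\<sigma>\<in>bijs S T. f (restrict \<sigma> A)) =
    (\<Sum>B\<in>ksubsets T (card A). fact (card S - card A) * (\<Sum>\<sigma>\<in>bijs A B. f \<sigma>))" .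
  have "avg (ksubsets T (card A)) (\<lambda>B. avg (bijs A B) f) =
        (\<Sum>B\<in>ksubsets T (card A). (\<Sum>\<sigma>\<in>bijs A B. f \<sigma>) / fact (card A)) / (card S choose card A)"
    unfolding avg_def
  proof (intro arg_cong2[where f="(/)"] sum.cong refl)
    fix B assume "B \<in> ksubsets T (card A)"
    then have "finite B" "card B = card A" using fin by (auto simp: ksubsets_def dest: finite_subset)
    then show "real (card (bijs A B)) = fact (card A)" using fA by (simp add: card_bijs)
  qed (use fin in \<open>simp add: card_ksubsets\<close>)
  also have "\<dots> = (\<Sum>\<sigma>\<in>bijs S T. f (restrict \<sigma> A)) / fact (card S)"
    unfolding s using fact_ratio_choose[OF cA] cA by (intro sum_div_rescale) auto
  finally show ?thesis using fin by (simp add: avg_def card_bijs)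
qed

text \<open>Deferred decisions: the functional sees only which sockets are matched into
  \<open>B\<close> and the matching of all others. The pairing with \<open>B\<close> itself averages
  out as the factor \<open>fact (card B)\<close>, and what remains is uniform again. With
  \<open>B\<close> the leaf sockets this is one round of peeling.\<close>

lemma avg_bijs_vimage:
  assumes fin: "finite S" "finite T" "card S = card T" and B: "B \<subseteq> T"
  shows "avg (bijs S T) (\<lambda>\<sigma>. f {s\<in>S. \<sigma> s \<in> B} (restrict \<sigma> (S - {s\<in>S. \<sigma> s \<in> B}))) =
         avg (ksubsets S (card B)) (\<lambda>A. avg (bijs (S - A) (T - B)) (f A))"
proof -
  have fB: "finite B" using fin B finite_subset by blast
  have cB: "card B \<le> card S" using B fin card_mono by metis
  have im: "\<sigma> ` {s\<in>S. \<sigma> s \<in> B} = B" if "\<sigma> \<in> bijs S T" for \<sigma>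
    using that B by (auto simp: bijs_def bij_betw_def)
  have sub: "(\<lambda>\<sigma>. {s\<in>S. \<sigma> s \<in> B}) ` bijs S T \<subseteq> ksubsets S (card B)"
  proof clarify
    fix \<sigma> assume \<sigma>: "\<sigma> \<in> bijs S T"
    then have "inj_on \<sigma> {s\<in>S. \<sigma> s \<in> B}"
      by (auto simp: bijs_def bij_betw_def intro: inj_on_subset)
    from card_image[OF this] show "{s\<in>S. \<sigma> s \<in> B} \<in> ksubsets S (card B)"
      using im[OF \<sigma>] by (auto simp: ksubsets_def)
  qed
  let ?g = "\<lambda>\<sigma>. f {s\<in>S. \<sigma> s \<in> B} (restrict \<sigma> (S - {s\<in>S. \<sigma> s \<in> B}))"
  have "(\<Sum>\<sigma>\<in>bijs S T. ?g \<sigma>) =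
        (\<Sum>A\<in>ksubsets S (card B). \<Sum>\<sigma> | \<sigma> \<in> bijs S T \<and> {s\<in>S. \<sigma> s \<in> B} = A. ?g \<sigma>)"
    using fin by (intro sum.group[symmetric] sub) auto
  also have "\<dots> = (\<Sum>A\<in>ksubsets S (card B). fact (card B) * (\<Sum>\<tau>\<in>bijs (S - A) (T - B). f A \<tau>))"
  proof (rule sum.cong[OF refl])
    fix A assume A: "A \<in> ksubsets S (card B)"
    then have A': "A \<subseteq> S" "card A = card B" "finite A"
      using fin finite_subset by (auto simp: ksubsets_def)
    have "{\<sigma> \<in> bijs S T. {s\<in>S. \<sigma> s \<in> B} = A} = {\<sigma> \<in> bijs S T. \<sigma> ` A = B}"
    proof (intro Collect_cong conj_cong refl iffI)
      fix \<sigma> assume \<sigma>: "\<sigma> \<in> bijs S T"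
      show "\<sigma> ` A = B" if "{s\<in>S. \<sigma> s \<in> B} = A" using im[OF \<sigma>] that by auto
      show "{s\<in>S. \<sigma> s \<in> B} = A" if "\<sigma> ` A = B"
        using \<sigma> that A'(1) by (auto simp: bijs_def bij_betw_def dest: inj_onD)
    qed
    note eq = this
    have "(\<Sum>\<sigma> | \<sigma> \<in> bijs S T \<and> {s\<in>S. \<sigma> s \<in> B} = A. ?g \<sigma>) =
          (\<Sum>\<sigma> | \<sigma> \<in> bijs S T \<and> {s\<in>S. \<sigma> s \<in> B} = A. f A (restrict \<sigma> (S - A)))"
      by (rule sum.cong) auto
    also have "\<dots> = (\<Sum>\<sigma> | \<sigma> \<in> bijs S T \<and> \<sigma> ` A = B. f A (restrict \<sigma> (S - A)))"
      unfolding eq ..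
    also have "\<dots> = (\<Sum>(\<sigma>,\<tau>)\<in>bijs A B \<times> bijs (S - A) (T - B). f A (restrict (glue A \<sigma> \<tau>) (S - A)))"
      by (rule sum_bijs_fibre[OF A'(1) B])
    also have "\<dots> = (\<Sum>(\<sigma>,\<tau>)\<in>bijs A B \<times> bijs (S - A) (T - B). f A \<tau>)"
    proof (rule sum.cong[OF refl], clarify)
      fix \<sigma> :: "'a \<Rightarrow> 'b" and \<tau> assume "\<tau> \<in> bijs (S - A) (T - B)"
      then have "restrict (glue A \<sigma> \<tau>) (S - A) = \<tau>"
        by (auto simp: glue_def bijs_def fun_eq_iff PiE_def extensional_def)
      then show "f A (restrict (glue A \<sigma> \<tau>) (S - A)) = f A \<tau>" by simp
    qed
    also have "\<dots> = fact (card B) * (\<Sum>\<tau>\<in>bijs (S - A) (T - B). f A \<tau>)"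
      using A' fB by (simp add: sum.cartesian_product[symmetric] card_bijs sum_distrib_left)
    finally show "(\<Sum>\<sigma> | \<sigma> \<in> bijs S T \<and> {s\<in>S. \<sigma> s \<in> B} = A. ?g \<sigma>) =
      fact (card B) * (\<Sum>\<tau>\<in>bijs (S - A) (T - B). f A \<tau>)" .
  qed
  finally have s: "(\<Sum>\<sigma>\<in>bijs S T. ?g \<sigma>) =
    (\<Sum>A\<in>ksubsets S (card B). fact (card B) * (\<Sum>\<tau>\<in>bijs (S - A) (T - B). f A \<tau>))" .
  have "avg (ksubsets S (card B)) (\<lambda>A. avg (bijs (S - A) (T - B)) (f A)) =
        (\<Sum>A\<in>ksubsets S (card B). (\<Sum>\<tau>\<in>bijs (S - A) (T - B). f A \<tau>) / fact (card S - card B))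
          / (card S choose card B)"
    unfolding avg_def
  proof (intro arg_cong2[where f="(/)"] sum.cong refl)
    fix A assume "A \<in> ksubsets S (card B)"
    then have "finite A" "card A = card B" "A \<subseteq> S"
      using fin by (auto simp: ksubsets_def dest: finite_subset)
    then show "real (card (bijs (S - A) (T - B))) = fact (card S - card B)"
      using fB B fin by (simp add: card_bijs card_Diff_subset)
  qed (use fin in \<open>simp add: card_ksubsets\<close>)
  also have "\<dots> = (\<Sum>\<sigma>\<in>bijs S T. ?g \<sigma>) / fact (card S)"
    unfolding s using fact_ratio_choose[OF cB] cB
    by (intro sum_div_rescale) (auto simp: mult.commute)
  finally show ?thesis using fin by (simp add: avg_def card_bijs)
qed

section \<open>Uniform random subsets\<close>

definition deg :: "('v \<times> 'i) set \<Rightarrow> 'v \<Rightarrow> nat" where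
  "deg S v = card {s\<in>S. fst s = v}"

definition num :: "('v \<times> 'i) set \<Rightarrow> nat \<Rightarrow> nat" where
  "num S l = card {v. deg S v = l}"

section \<open>Binomial and hypergeometric probabilities\<close>

definition binp :: "nat \<Rightarrow> nat \<Rightarrow> real \<Rightarrow> real" where
  "binp d j p = real (d choose j) * p ^ j * (1 - p) ^ (d - j)"

lemma binp_bounds:
  assumes "0 \<le> p" "p \<le> 1"
  shows "0 \<le> binp d j p" "binp d j p \<le> 1"
proof -
  show "0 \<le> binp d j p" using assms by (simp add: binp_def)
  show "binp d j p \<le> 1"
  proof (cases "j \<le> d")
    case True
    have "binp d j p \<le> (\<Sum>i\<le>d. real (d choose i) * p ^ i * (1 - p) ^ (d - i))"
      unfolding binp_def using True assms by (intro member_le_sum) auto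
    also have "\<dots> = (p + (1 - p)) ^ d" by (rule binomial_ring[symmetric])
    finally show ?thesis by simp
  next
    case False
    then show ?thesis by (simp add: binp_def binomial_eq_0)
  qed
qed

text \<open>The probability that a uniform \<open>k\<close>-subset of an \<open>N\<close>-set meets a given \<open>d\<close>-subset
  in a given \<open>j\<close>-subset.\<close>
definition hyp :: "nat \<Rightarrow> nat \<Rightarrow> nat \<Rightarrow> nat \<Rightarrow> real" where
  "hyp N k d j = (if j \<le> k then real ((N - d) choose (k - j)) else 0) / real (N choose k)"

lemma hyp_bounds:
  assumes "k \<le> N" "d \<le> N" "j \<le> d"
  shows "0 \<le> hyp N k d j" "hyp N k d j \<le> 1"
proof -
  show "0 \<le> hyp N k d j" by (simp add: hyp_def)
  have "(N - d) choose (k - j) \<le> N choose k" if "j \<le> k"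
  proof -
    have "(N - d) choose (k - j) \<le> (d choose j) * ((N - d) choose (k - j))"
      using assms by (simp add: Suc_le_eq)
    also have "\<dots> \<le> (\<Sum>i\<le>k. (d choose i) * ((N - d) choose (k - i)))"
      using that by (intro member_le_sum) auto
    also have "\<dots> = N choose k" using assms vandermonde[of d "N - d" k] by simp
    finally show ?thesis .
  qed
  then show "hyp N k d j \<le> 1" using assms by (simp add: hyp_def divide_le_eq)
qed

text \<open>Drawing without replacement: if \<open>j\<close> of \<open>d\<close> inspected elements
  lie in the random subset, the next one does with probability \<open>(k - j) / (N - d)\<close>.
  Together with \<open>hyp_Suc\<close> this allows an inductive comparison with independent
  coins.\<close>

lemma hyp_Suc_Suc:
  assumes "d < N"
  shows "hyp N k (Suc d) (Suc j) = hyp N k d j * ((real k - real j) / (real N - real d))"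
proof (cases "j < k")
  case True
  then have "(k - j) * ((N - d) choose (k - j)) = (N - d) * ((N - d - 1) choose (k - j - 1))"
    by (intro times_binomial_minus1_eq) simp
  then have "real (k - j) * real ((N - d) choose (k - j)) =
      real (N - d) * real ((N - Suc d) choose (k - Suc j))"
    by (metis Suc_eq_plus1 diff_diff_left of_nat_mult)
  then have "real ((N - Suc d) choose (k - Suc j)) =
      (real k - real j) * real ((N - d) choose (k - j)) / (real N - real d)"
    using assms True by (simp add: of_nat_diff nonzero_eq_divide_eq mult.commute)
  then show ?thesis using True by (simp add: hyp_def mult.commute)
next
  case False
  then show ?thesis by (auto simp: hyp_def)
qed

lemma hyp_Suc:
  assumes "d < N" "j \<le> d"
  shows "hyp N k (Suc d) j = hyp N k d j * (1 - (real k - real j) / (real N - real d))"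
proof (cases "j \<le> k")
  case True
  have "real (N - d - (k - j)) * real ((N - d) choose (k - j)) =
      real (N - d) * real ((N - Suc d) choose (k - j))"
    using binomial_absorb_comp[of "N - d" "k - j"]
    by (metis Suc_eq_plus1 diff_diff_left of_nat_mult)
  moreover have "real (N - d - (k - j)) * real ((N - d) choose (k - j)) =
      (real N - real d - (real k - real j)) * real ((N - d) choose (k - j))"
    using assms True by (cases "k - j \<le> N - d") (auto simp: of_nat_diff binomial_eq_0)
  ultimately have "real ((N - Suc d) choose (k - j)) =
      (real N - real d - (real k - real j)) * real ((N - d) choose (k - j)) / (real N - real d)"
    using assms by (simp add: of_nat_diff nonzero_eq_divide_eq mult.commute)
  also have "\<dots> = real ((N - d) choose (k - j)) * (1 - (real k - real j) / (real N - real d))"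
  proof -
    have "(n - z) * C / n = C * (1 - z / n)" if "n \<noteq> 0" for n z C :: real
      using that by (simp add: field_simps)
    from this[of "real N - real d"] show ?thesis using assms by simp
  qed
  finally show ?thesis using True by (simp add: hyp_def)
next
  case False
  then show ?thesis by (auto simp: hyp_def)
qed

lemma ratio_diff_bound:
  assumes "k \<le> N" "j \<le> d" "2 * d \<le> N" "0 < N"
  shows "\<bar>(real k - real j) / (real N - real d) - real k / real N\<bar> \<le> 2 * real d / real N"
proof -
  have dN: "real N - real d \<ge> real N / 2" "real N > 0" using assms by auto
  then have pos: "real N - real d > 0" by linarith
  have "(real k - real j) / (real N - real d) - real k / real N =
        (real k * real d - real j * real N) / (real N * (real N - real d))"
    using dN pos by (simp add: field_simps)
  moreover have "\<bar>real k * real d - real j * real N\<bar> \<le> real d * real N"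
  proof -
    have "real k * real d \<le> real d * real N" "real j * real N \<le> real d * real N"
      using assms mult_left_mono[of "real k" "real N" "real d"] mult_right_mono[of "real j" "real d" "real N"]
      by (auto simp: mult.commute)
    moreover have "real k * real d \<ge> 0" "real j * real N \<ge> 0" by auto
    ultimately show ?thesis by linarith
  qed
  ultimately have "\<bar>(real k - real j) / (real N - real d) - real k / real N\<bar> \<le>
      (real d * real N) / \<bar>real N * (real N - real d)\<bar>"
    by (simp only: abs_divide divide_right_mono abs_ge_zero)
  also have "\<bar>real N * (real N - real d)\<bar> = real N * (real N - real d)" using dN pos by simp
  also have "real d * real N / (real N * (real N - real d)) = real d / (real N - real d)"
    using dN by simp
  also have "\<dots> \<le> real d / (real N / 2)" using dN by (intro divide_left_mono) auto
  finally show ?thesis by (simp add: mult.commute)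
qed

text \<open>Replacing one conditional probability by \<open>k / N\<close> costs at most
  \<open>2 * d / N\<close>. The costs accumulate to \<open>2 * d^2 / N\<close> because
  \<open>2 * d^2 + 2 * d \<le> 2 * (d + 1)^2\<close>.\<close>

lemma hyp_approx_aux:
  assumes "k \<le> N" "0 < N"
  shows "2 * d \<le> N \<Longrightarrow> j \<le> d \<Longrightarrow>
    \<bar>hyp N k d j - (real k / N) ^ j * (1 - real k / N) ^ (d - j)\<bar> \<le> 2 * real d ^ 2 / N"
proof (induction d arbitrary: j)
  case 0
  then show ?case using assms by (simp add: hyp_def)
next
  case (Suc d)
  define p where "p = real k / N"
  have p: "0 \<le> p" "p \<le> 1" using assms by (auto simp: p_def)
  have key: "\<bar>a * b - a' * b'\<bar> \<le> e + f"
    if "\<bar>a - a'\<bar> \<le> e" "\<bar>b - b'\<bar> \<le> f" "0 \<le> a" "a \<le> 1" "0 \<le> b'" "b' \<le> 1" for a b a' b' e f :: real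
  proof -
    have "a * b - a' * b' = a * (b - b') + (a - a') * b'" by (simp add: algebra_simps)
    also have "\<bar>\<dots>\<bar> \<le> a * \<bar>b - b'\<bar> + \<bar>a - a'\<bar> * b'"
      using that by (metis abs_mult abs_of_nonneg abs_triangle_ineq)
    also have "\<dots> \<le> 1 * f + e * 1"
      using that by (intro add_mono mult_mono) auto
    finally show ?thesis by simp
  qed
  have le: "2 * real d ^ 2 / N + 2 * real d / N \<le> 2 * real (Suc d) ^ 2 / N"
    using assms by (simp add: divide_simps power2_eq_square algebra_simps)
  show ?case
  proof (cases "j \<le> d")
    case True
    have "\<bar>hyp N k d j * (1 - (real k - real j) / (real N - real d)) -
        (p ^ j * (1 - p) ^ (d - j)) * (1 - p)\<bar> \<le> 2 * real d ^ 2 / N + 2 * real d / N"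
    proof (rule key)
      show "\<bar>hyp N k d j - p ^ j * (1 - p) ^ (d - j)\<bar> \<le> 2 * real d ^ 2 / N"
        unfolding p_def using Suc True by simp
      have "\<bar>(real k - real j) / (real N - real d) - real k / real N\<bar> \<le> 2 * real d / real N"
        using assms Suc.prems True by (intro ratio_diff_bound) auto
      then show "\<bar>1 - (real k - real j) / (real N - real d) - (1 - p)\<bar> \<le> 2 * real d / real N"
        by (simp add: p_def)
      show "0 \<le> hyp N k d j" "hyp N k d j \<le> 1"
        using hyp_bounds[of k N d j] assms Suc.prems True by auto
    qed (use p in auto)
    also have "hyp N k d j * (1 - (real k - real j) / (real N - real d)) = hyp N k (Suc d) j"
      using hyp_Suc[of d N j k] Suc.prems True assms by simp
    also have "p ^ j * (1 - p) ^ (d - j) * (1 - p) = p ^ j * (1 - p) ^ (Suc d - j)"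
      using True by (simp add: Suc_diff_le)
    finally show ?thesis using le by (simp add: p_def)
  next
    case False
    then have j: "j = Suc d" using Suc.prems by simp
    have "\<bar>hyp N k d d * ((real k - real d) / (real N - real d)) -
        (p ^ d * (1 - p) ^ (d - d)) * p\<bar> \<le> 2 * real d ^ 2 / N + 2 * real d / N"
    proof (rule key)
      show "\<bar>hyp N k d d - p ^ d * (1 - p) ^ (d - d)\<bar> \<le> 2 * real d ^ 2 / N"
        unfolding p_def using Suc.IH[of d] Suc.prems by simp
      show "\<bar>(real k - real d) / (real N - real d) - p\<bar> \<le> 2 * real d / real N"
        unfolding p_def using assms Suc.prems by (intro ratio_diff_bound) auto
      show "0 \<le> hyp N k d d" "hyp N k d d \<le> 1"
        using hyp_bounds[of k N d d] assms Suc.prems by auto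
    qed (use p in auto)
    also have "hyp N k d d * ((real k - real d) / (real N - real d)) = hyp N k (Suc d) j"
      using hyp_Suc_Suc[of d N k d] Suc.prems assms j by simp
    finally show ?thesis using le j by (simp add: p_def mult.commute)
  qed
qed

lemma hyp_approx:
  assumes "k \<le> N" "0 < N" "d \<le> N" "j \<le> d"
  shows "\<bar>hyp N k d j - (real k / N) ^ j * (1 - real k / N) ^ (d - j)\<bar> \<le> 2 * real d ^ 2 / N"
proof (cases "2 * d \<le> N")
  case True
  then show ?thesis using hyp_approx_aux assms by blast
next
  case False
  \<comment> \<open>If the block exceeds half of the set, the claimed bound is at least 1, while
    both probabilities lie in [0, 1].\<close>
  define p where "p = real k / N"
  have p: "0 \<le> p" "p \<le> 1" using assms by (auto simp: p_def)
  have "0 \<le> p ^ j * (1 - p) ^ (d - j)" "p ^ j * (1 - p) ^ (d - j) \<le> 1"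
    using p by (auto intro!: mult_le_one power_le_one)
  then have "\<bar>hyp N k d j - p ^ j * (1 - p) ^ (d - j)\<bar> \<le> 1"
    using hyp_bounds[of k N d j] assms by auto
  also have "1 \<le> 2 * real d ^ 2 / N"
  proof -
    have "N \<le> 2 * d" "1 \<le> d" using False assms by auto
    then have "real N \<le> 2 * real d * real d"
      by (metis (no_types) mult.assoc mult_le_cancel1 mult_le_mono2 nat_mult_1_right of_nat_le_iff of_nat_mult of_nat_numeral order_trans)
    then show ?thesis using assms by (simp add: power2_eq_square)
  qed
  finally show ?thesis by (simp add: p_def)
qed

section \<open>Traces of random subsets and their concentration\<close>

lemma card_ksubsets_inter:
  assumes T: "finite T" and B: "B \<subseteq> T" and J: "J \<subseteq> B" and k: "k \<le> card T"
  shows "real (card {A \<in> ksubsets T k. A \<inter> B = J}) = hyp (card T) k (card B) (card J) * card (ksubsets T k)"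
proof -
  have fin: "finite B" "finite J" using assms by (meson finite_subset)+
  have c: "card (ksubsets T k) > 0" using T k by (rule card_ksubsets_pos)
  have "card {A \<in> ksubsets T k. A \<inter> B = J} = (if card J \<le> k then (card T - card B) choose (k - card J) else 0)"
  proof (cases "card J \<le> k")
    case True
    have "bij_betw (\<lambda>A. A - B) {A \<in> ksubsets T k. A \<inter> B = J} (ksubsets (T - B) (k - card J))"
    proof (rule bij_betw_byWitness[where f' = "\<lambda>A. A \<union> J"])
      show "\<forall>a\<in>{A \<in> ksubsets T k. A \<inter> B = J}. a - B \<union> J = a" by auto
      show "\<forall>a'\<in>ksubsets (T - B) (k - card J). a' \<union> J - B = a'"
        using J by (auto simp: ksubsets_def)
      show "(\<lambda>A. A - B) ` {A \<in> ksubsets T k. A \<inter> B = J} \<subseteq> ksubsets (T - B) (k - card J)"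
        using T by (auto simp: ksubsets_def card_Diff_subset_Int finite_subset)
      show "(\<lambda>A. A \<union> J) ` ksubsets (T - B) (k - card J) \<subseteq> {A \<in> ksubsets T k. A \<inter> B = J}"
      proof clarify
        fix A assume A: "A \<in> ksubsets (T - B) (k - card J)"
        then have "finite A" "A \<inter> J = {}" using T J by (auto simp: ksubsets_def dest: finite_subset)
        then have "card (A \<union> J) = k" using A True fin by (simp add: card_Un_disjoint ksubsets_def)
        then show "A \<union> J \<in> ksubsets T k \<and> (A \<union> J) \<inter> B = J"
          using A J B by (auto simp: ksubsets_def)
      qed
    qed
    from bij_betw_same_card[OF this] show ?thesis
      using True T B fin by (simp add: card_ksubsets card_Diff_subset)
  next
    case False
    have "{A \<in> ksubsets T k. A \<inter> B = J} = {}"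
      using False T by (auto simp: ksubsets_def) (meson card_mono finite_subset inf_le1)
    then show ?thesis using False by (simp del: Collect_empty_eq)
  qed
  then show ?thesis using c T by (simp add: hyp_def card_ksubsets)
qed

text \<open>Once the traces on both blocks are fixed, the two blocks act as one block of the
  combined size. This is the joint law of two node degrees, which the second moment needs.\<close>

lemma card_ksubsets_inter2:
  assumes T: "finite T" and B: "B \<subseteq> T" "B' \<subseteq> T" "B \<inter> B' = {}" and k: "k \<le> card T"
  shows "real (card {A \<in> ksubsets T k. card (A \<inter> B) = j \<and> card (A \<inter> B') = j'}) =
    real (card B choose j) * real (card B' choose j') * hyp (card T) k (card B + card B') (j + j')
      * card (ksubsets T k)"
proof -
  have fin: "finite B" "finite B'" using assms by (meson finite_subset)+
  let ?K = "ksubsets T k" and ?P = "ksubsets B j \<times> ksubsets B' j'"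
  let ?S = "{A \<in> ?K. card (A \<inter> B) = j \<and> card (A \<inter> B') = j'}"
  have "real (card ?S) = (\<Sum>A\<in>?S. 1)" by simp
  also have "\<dots> = (\<Sum>J\<in>?P. \<Sum>A | A \<in> ?S \<and> (A \<inter> B, A \<inter> B') = J. 1)"
    using T fin by (intro sum.group[symmetric]) (auto simp: ksubsets_def intro: finite_subset[of _ "Pow T"])
  also have "\<dots> = (\<Sum>J\<in>?P. hyp (card T) k (card B + card B') (j + j') * card ?K)"
  proof (rule sum.cong[OF refl])
    fix J assume J: "J \<in> ?P"
    then obtain J1 J2 where J12: "J = (J1, J2)" "J1 \<subseteq> B" "J2 \<subseteq> B'" "card J1 = j" "card J2 = j'"
      by (auto simp: ksubsets_def)
    have f: "finite J1" "finite J2" using J12 fin by (meson finite_subset)+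
    have "{A. A \<in> ?S \<and> (A \<inter> B, A \<inter> B') = J} = {A \<in> ?K. A \<inter> (B \<union> B') = J1 \<union> J2}"
    proof -
      have "A \<inter> B = J1 \<and> A \<inter> B' = J2 \<longleftrightarrow> A \<inter> (B \<union> B') = J1 \<union> J2" for A
        using J12 B(3) by blast
      then show ?thesis unfolding J12(1) J12(4,5)[symmetric] by auto metis+
    qed
    then have "(\<Sum>A | A \<in> ?S \<and> (A \<inter> B, A \<inter> B') = J. 1) = real (card {A \<in> ?K. A \<inter> (B \<union> B') = J1 \<union> J2})"
      by simp
    also have "\<dots> = hyp (card T) k (card (B \<union> B')) (card (J1 \<union> J2)) * card ?K"
      using assms J12 by (intro card_ksubsets_inter) auto
    also have "card (B \<union> B') = card B + card B'" using fin B by (simp add: card_Un_disjoint)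
    also have "card (J1 \<union> J2) = j + j'" using f J12 B by (subst card_Un_disjoint) auto
    finally show "(\<Sum>A | A \<in> ?S \<and> (A \<inter> B, A \<inter> B') = J. 1) =
      hyp (card T) k (card B + card B') (j + j') * card ?K" .
  qed
  finally show ?thesis using fin by (simp add: card_cartesian_product card_ksubsets)
qed

text \<open>\<open>b i\<close> is the probability of \<open>E i\<close> only up to \<open>c\<close>,
  so the count is centred at the sum of the \<open>b i\<close> and not at its mean. A diagonal pair
  contributes at most 1; in an off-diagonal pair one error \<open>c\<close> comes from the joint
  probability and two from the marginals.\<close>

lemma second_moment:
  fixes w :: "'a \<Rightarrow> real" and c :: real and E :: "'i \<Rightarrow> 'a \<Rightarrow> bool"
  assumes fin: "finite \<Omega>" "finite I" and w: "\<And>\<omega>. \<omega> \<in> \<Omega> \<Longrightarrow> 0 \<le> w \<omega>" "(\<Sum>\<omega>\<in>\<Omega>. w \<omega>) = 1"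
    and b: "\<And>i. i \<in> I \<Longrightarrow> 0 \<le> b i \<and> b i \<le> 1" and c: "0 \<le> c"
    and P1: "\<And>i. i \<in> I \<Longrightarrow> \<bar>(\<Sum>\<omega>\<in>\<Omega>. w \<omega> * of_bool (E i \<omega>)) - b i\<bar> \<le> c"
    and P2: "\<And>i i'. i \<in> I \<Longrightarrow> i' \<in> I \<Longrightarrow> i \<noteq> i' \<Longrightarrow>
       \<bar>(\<Sum>\<omega>\<in>\<Omega>. w \<omega> * of_bool (E i \<omega> \<and> E i' \<omega>)) - b i * b i'\<bar> \<le> c"
  shows "(\<Sum>\<omega>\<in>\<Omega>. w \<omega> * (real (card {i\<in>I. E i \<omega>}) - (\<Sum>i\<in>I. b i))\<^sup>2)
           \<le> card I + 3 * c * (card I)\<^sup>2"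
proof -
  let ?d = "\<lambda>i \<omega>. of_bool (E i \<omega>) - b i"
  have cardE: "real (card {i\<in>I. E i \<omega>}) - (\<Sum>i\<in>I. b i) = (\<Sum>i\<in>I. ?d i \<omega>)" for \<omega>
    using fin by (simp add: sum_subtractf of_bool_def sum.If_cases Int_def)
  have "(\<Sum>\<omega>\<in>\<Omega>. w \<omega> * (real (card {i\<in>I. E i \<omega>}) - (\<Sum>i\<in>I. b i))\<^sup>2) =
        (\<Sum>\<omega>\<in>\<Omega>. \<Sum>i\<in>I. \<Sum>i'\<in>I. w \<omega> * (?d i \<omega> * ?d i' \<omega>))"
    unfolding cardE power2_eq_square sum_product by (simp add: sum_distrib_left)
  also have "\<dots> = (\<Sum>i\<in>I. \<Sum>i'\<in>I. \<Sum>\<omega>\<in>\<Omega>. w \<omega> * (?d i \<omega> * ?d i' \<omega>))"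
    by (subst sum.swap) (intro sum.cong refl sum.swap)
  also have "\<dots> \<le> (\<Sum>i\<in>I. \<Sum>i'\<in>I. of_bool (i' = i) + 3 * c)"
  proof (intro sum_mono)
    fix i i' assume i: "i \<in> I" "i' \<in> I"
    show "(\<Sum>\<omega>\<in>\<Omega>. w \<omega> * (?d i \<omega> * ?d i' \<omega>)) \<le> of_bool (i' = i) + 3 * c"
    proof (cases "i' = i")
      case True
      have "(\<Sum>\<omega>\<in>\<Omega>. w \<omega> * (?d i \<omega> * ?d i' \<omega>)) \<le> (\<Sum>\<omega>\<in>\<Omega>. w \<omega> * 1)"
      proof (intro sum_mono mult_left_mono)
        fix \<omega>
        have "\<bar>?d i \<omega>\<bar> \<le> 1" using b[OF i(1)] by auto
        then have "(?d i \<omega>)\<^sup>2 \<le> 1" by (simp add: abs_square_le_1)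
        then show "?d i \<omega> * ?d i' \<omega> \<le> 1" by (simp add: True power2_eq_square)
      qed (use w in auto)
      then show ?thesis using w c True by simp
    next
      case False
      define X where "X = (\<Sum>\<omega>\<in>\<Omega>. w \<omega> * of_bool (E i \<omega> \<and> E i' \<omega>))"
      define Y where "Y = (\<lambda>i. \<Sum>\<omega>\<in>\<Omega>. w \<omega> * of_bool (E i \<omega>))"
      have "(\<Sum>\<omega>\<in>\<Omega>. w \<omega> * (?d i \<omega> * ?d i' \<omega>)) =
        (\<Sum>\<omega>\<in>\<Omega>. w \<omega> * of_bool (E i \<omega> \<and> E i' \<omega>) - b i' * (w \<omega> * of_bool (E i \<omega>))
            - b i * (w \<omega> * of_bool (E i' \<omega>)) + b i * b i' * w \<omega>)"
        by (rule sum.cong[OF refl]) (auto simp: of_bool_def algebra_simps)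
      also have "\<dots> = X - b i' * Y i - b i * Y i' + b i * b i'"
        using w by (simp add: X_def Y_def sum.distrib sum_subtractf sum_distrib_left[symmetric])
      also have "\<dots> = (X - b i * b i') + b i' * (b i - Y i) + b i * (b i' - Y i')"
        by (simp add: algebra_simps)
      also have "\<dots> \<le> c + 1 * c + 1 * c"
      proof (intro add_mono)
        show "X - b i * b i' \<le> c" using P2[of i i'] i False by (auto simp: X_def)
        have *: "x * z \<le> 1 * c" if "0 \<le> x" "x \<le> 1" "\<bar>z\<bar> \<le> c" for x z :: real
        proof -
          have "x * z \<le> x * c" using that by (intro mult_left_mono) auto
          also have "\<dots> \<le> 1 * c" using that c by (intro mult_right_mono) auto
          finally show ?thesis .
        qed
        show "b i' * (b i - Y i) \<le> 1 * c" "b i * (b i' - Y i') \<le> 1 * c"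
          using P1[of i] P1[of i'] b i by (auto intro!: *[simplified] simp: Y_def abs_minus_commute)
      qed
      finally show ?thesis using False by simp
    qed
  qed
  also have "\<dots> = card I + 3 * c * (card I)\<^sup>2"
    using fin by (simp add: sum.distrib of_bool_def power2_eq_square algebra_simps)
  finally show ?thesis .
qed

lemma chebyshev_weighted:
  fixes w :: "'a \<Rightarrow> real"
  assumes "finite \<Omega>" "\<And>\<omega>. \<omega> \<in> \<Omega> \<Longrightarrow> 0 \<le> w \<omega>" "0 < \<tau>"
    and "(\<Sum>\<omega>\<in>\<Omega>. w \<omega> * (X \<omega>)\<^sup>2) \<le> V"
  shows "(\<Sum>\<omega> | \<omega> \<in> \<Omega> \<and> \<tau> < \<bar>X \<omega>\<bar>. w \<omega>) \<le> V / \<tau>\<^sup>2"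
proof -
  have "\<tau>\<^sup>2 * (\<Sum>\<omega> | \<omega> \<in> \<Omega> \<and> \<tau> < \<bar>X \<omega>\<bar>. w \<omega>) = (\<Sum>\<omega> | \<omega> \<in> \<Omega> \<and> \<tau> < \<bar>X \<omega>\<bar>. w \<omega> * \<tau>\<^sup>2)"
    by (simp add: sum_distrib_left mult.commute)
  also have "\<dots> \<le> (\<Sum>\<omega> | \<omega> \<in> \<Omega> \<and> \<tau> < \<bar>X \<omega>\<bar>. w \<omega> * (X \<omega>)\<^sup>2)"
    using assms by (intro sum_mono mult_left_mono) (auto simp: abs_le_square_iff[symmetric])
  also have "\<dots> \<le> (\<Sum>\<omega>\<in>\<Omega>. w \<omega> * (X \<omega>)\<^sup>2)"
    using assms by (intro sum_mono2) auto
  also have "\<dots> \<le> V" by fact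
  finally show ?thesis using assms by (simp add: field_simps)
qed


lemma deg_inter: "A \<subseteq> T \<Longrightarrow> deg A v = card (A \<inter> {s\<in>T. fst s = v})"
  unfolding deg_def by (rule arg_cong[where f=card]) auto

lemma deg_pos_iff: "finite S \<Longrightarrow> 0 < deg S v \<longleftrightarrow> v \<in> fst ` S"
  by (force simp: deg_def card_gt_0_iff)

lemma deg_le_card: "finite T \<Longrightarrow> deg T v \<le> card T"
  unfolding deg_def by (intro card_mono) auto

lemma deg_add_le_card:
  assumes "finite T" "v \<noteq> v'"
  shows "deg T v + deg T v' \<le> card T"
proof -
  have "deg T v + deg T v' = card ({s\<in>T. fst s = v} \<union> {s\<in>T. fst s = v'})"
    using assms by (subst card_Un_disjoint) (auto simp: deg_def)
  also have "\<dots> \<le> card T" using assms by (intro card_mono) auto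
  finally show ?thesis .
qed

text \<open>The 1 is the diagonal part of \<open>second_moment\<close>, and 24 is its factor 3 times
  8: two binomial coefficients give \<open>2 ^ D * 2 ^ D\<close>, and \<open>hyp_approx\<close> for
  two nodes of degree at most \<open>D\<close> gives \<open>2 * (2 * D)^2 / N\<close>.\<close>

definition dev_const :: "nat \<Rightarrow> real" where
  "dev_const D = 1 + 24 * 4 ^ D * real D ^ 2"

lemma dev_const_pos: "dev_const D > 0"
  by (simp add: dev_const_def add_pos_nonneg)

lemma avg_sq_dev_ksubsets:
  assumes T: "finite T" "0 < card T" and k: "k \<le> card T" and D: "\<And>v. deg T v \<le> D"
    and I: "I \<subseteq> fst ` T"
  shows "avg (ksubsets T k) (\<lambda>A. (real (card {v\<in>I. deg A v = j}) -
            (\<Sum>v\<in>I. binp (deg T v) j (real k / card T)))\<^sup>2) \<le> dev_const D * card T"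
proof -
  let ?N = "card T" and ?K = "ksubsets T k"
  define p where "p = real k / ?N"
  define w where "w = (\<lambda>A :: ('a \<times> 'b) set. 1 / real (card ?K))"
  define c where "c = 8 * 4 ^ D * real D ^ 2 / ?N"
  have p: "0 \<le> p" "p \<le> 1" using k T by (auto simp: p_def)
  have K: "finite ?K" "card ?K > 0" using T k card_ksubsets_pos by auto
  have fI: "finite I" using I T finite_subset by blast
  have cI: "card I \<le> ?N" using I T by (meson card_image_le card_mono finite_imageI le_trans)
  have c0: "0 \<le> c" by (simp add: c_def)
  have pow2: "real (d choose j) \<le> 2 ^ D" if "d \<le> D" for d j
  proof -
    have "d choose j \<le> 2 ^ d" by (rule binomial_le_pow2)
    also have "\<dots> \<le> 2 ^ D" using that by simp
    finally have "real (d choose j) \<le> real (2 ^ D)" by (rule of_nat_mono)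
    then show ?thesis by simp
  qed
  \<comment> \<open>One estimate serves both moments: \<open>B\<close> is the socket set of a second
    node for joint events, and empty with \<open>j' = 0\<close> for single events.\<close>
  have P: "\<bar>(\<Sum>A\<in>?K. w A * of_bool (deg A v = j \<and> card (A \<inter> B) = j')) -
        binp (deg T v) j p * binp (card B) j' p\<bar> \<le> c"
    if B: "B \<subseteq> T" "{s\<in>T. fst s = v} \<inter> B = {}" "card B \<le> D" "deg T v + card B \<le> ?N" for v B j'
  proof -
    let ?d = "deg T v" and ?d' = "card B"
    have "(\<Sum>A\<in>?K. w A * of_bool (deg A v = j \<and> card (A \<inter> B) = j')) =
          real (card {A \<in> ?K. deg A v = j \<and> card (A \<inter> B) = j'}) / card ?K"
      using K by (simp add: w_def sum_divide_distrib[symmetric] of_bool_def sum.If_cases Int_def)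
    also have "{A \<in> ?K. deg A v = j \<and> card (A \<inter> B) = j'} =
       {A \<in> ?K. card (A \<inter> {s\<in>T. fst s = v}) = j \<and> card (A \<inter> B) = j'}"
      by (auto simp: ksubsets_def deg_inter)
    also have "real (card \<dots>) / card ?K =
        real (?d choose j) * real (?d' choose j') * hyp ?N k (?d + ?d') (j + j')"
      using T K B k by (subst card_ksubsets_inter2) (auto simp: deg_def)
    finally have eq: "(\<Sum>A\<in>?K. w A * of_bool (deg A v = j \<and> card (A \<inter> B) = j')) =
        real (?d choose j) * real (?d' choose j') * hyp ?N k (?d + ?d') (j + j')" .
    show ?thesis
    proof (cases "j \<le> ?d \<and> j' \<le> ?d'")
      case False
      then have "(?d choose j) = 0 \<or> (?d' choose j') = 0" by (auto simp: binomial_eq_0)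
      then show ?thesis using c0 unfolding eq binp_def by (auto simp: binomial_eq_0)
    next
      case True
      have b: "binp ?d j p * binp ?d' j' p = real (?d choose j) * real (?d' choose j') *
          (p ^ (j + j') * (1 - p) ^ (?d + ?d' - (j + j')))"
      proof -
        have "?d + ?d' - (j + j') = (?d - j) + (?d' - j')" using True by simp
        then show ?thesis by (simp add: binp_def power_add)
      qed
      have "\<bar>hyp ?N k (?d + ?d') (j + j') - p ^ (j + j') * (1 - p) ^ (?d + ?d' - (j + j'))\<bar>
          \<le> 2 * real (?d + ?d') ^ 2 / ?N"
        unfolding p_def using True T k B by (intro hyp_approx) auto
      also have "\<dots> \<le> 2 * real (2 * D) ^ 2 / ?N"
      proof (intro divide_right_mono mult_left_mono power_mono)
        show "real (?d + ?d') \<le> real (2 * D)" using D[of v] B by linarith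
      qed auto
      finally have h: "\<bar>hyp ?N k (?d + ?d') (j + j') - p ^ (j + j') * (1 - p) ^ (?d + ?d' - (j + j'))\<bar>
          \<le> 2 * real (2 * D) ^ 2 / ?N" .
      have "\<bar>real (?d choose j) * real (?d' choose j') * hyp ?N k (?d + ?d') (j + j')
           - binp ?d j p * binp ?d' j' p\<bar> = real (?d choose j) * real (?d' choose j') *
          \<bar>hyp ?N k (?d + ?d') (j + j') - p ^ (j + j') * (1 - p) ^ (?d + ?d' - (j + j'))\<bar>"
        unfolding b right_diff_distrib[symmetric] abs_mult by simp
      also have "\<dots> \<le> (2 ^ D * 2 ^ D) * (2 * real (2 * D) ^ 2 / ?N)"
        using h D[of v] B by (intro mult_mono pow2) auto
      also have "\<dots> = c"
        by (simp add: c_def power2_eq_square power_mult_distrib[symmetric])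
      finally show ?thesis unfolding eq .
    qed
  qed
  have "(\<Sum>A\<in>?K. w A * (real (card {v\<in>I. deg A v = j}) - (\<Sum>v\<in>I. binp (deg T v) j p))\<^sup>2)
      \<le> card I + 3 * c * (card I)\<^sup>2"
  proof (rule second_moment[OF K(1) fI])
    show "(\<Sum>A\<in>?K. w A) = 1" using K by (auto simp: w_def)
    show "\<bar>(\<Sum>A\<in>?K. w A * of_bool (deg A v = j)) - binp (deg T v) j p\<bar> \<le> c" for v
      using P[of "{}" v 0] deg_le_card[OF T(1), of v] by (simp add: binp_def)
    show "\<bar>(\<Sum>A\<in>?K. w A * of_bool (deg A v = j \<and> deg A v' = j)) -
       binp (deg T v) j p * binp (deg T v') j p\<bar> \<le> c" if "v \<noteq> v'" for v v'
    proof -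
      have "(\<Sum>A\<in>?K. w A * of_bool (deg A v = j \<and> deg A v' = j)) =
         (\<Sum>A\<in>?K. w A * of_bool (deg A v = j \<and> card (A \<inter> {s\<in>T. fst s = v'}) = j))"
        by (rule sum.cong) (auto simp: ksubsets_def deg_inter)
      then show ?thesis
        using P[of "{s\<in>T. fst s = v'}" v j] D[of v'] deg_add_le_card[OF T(1) that] that
        by (auto simp: deg_def)
    qed
  qed (use binp_bounds[OF p] c0 in \<open>auto simp: w_def\<close>)
  also have "\<dots> \<le> ?N + 3 * c * (?N)\<^sup>2"
    using cI c0 by (intro add_mono mult_left_mono power_mono) auto
  also have "\<dots> = dev_const D * ?N"
    using T by (simp add: c_def dev_const_def power2_eq_square algebra_simps)
  finally show ?thesis
    by (simp add: avg_def w_def p_def sum_divide_distrib)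
qed

lemma card_dev_ksubsets:
  assumes T: "finite T" "0 < card T" and k: "k \<le> card T" and D: "\<And>v. deg T v \<le> D"
    and I: "I \<subseteq> fst ` T" and \<tau>: "0 < \<tau>"
  shows "real (card {A \<in> ksubsets T k. \<tau> < \<bar>real (card {v\<in>I. deg A v = j}) -
            (\<Sum>v\<in>I. binp (deg T v) j (real k / card T))\<bar>})
         \<le> dev_const D * card T / \<tau>\<^sup>2 * card (ksubsets T k)"
proof -
  let ?K = "ksubsets T k"
  define X where "X A = real (card {v\<in>I. deg A v = j}) - (\<Sum>v\<in>I. binp (deg T v) j (real k / card T))" for A :: "('a \<times> 'b) set"
  have K: "finite ?K" "card ?K > 0" using T k card_ksubsets_pos by auto
  have "(\<Sum>A | A \<in> ?K \<and> \<tau> < \<bar>X A\<bar>. 1 / real (card ?K)) \<le> dev_const D * card T / \<tau>\<^sup>2"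
    using avg_sq_dev_ksubsets[OF T k D I, of j] \<tau> K
    by (intro chebyshev_weighted) (auto simp: X_def avg_def sum_divide_distrib)
  then show ?thesis using K by (simp add: X_def[symmetric] divide_le_eq)
qed

section \<open>Kernels and peeling\<close>

lemma sum_by_deg:
  fixes h :: "nat \<Rightarrow> real"
  assumes "finite S" "\<And>v. deg S v \<le> D"
  shows "(\<Sum>v\<in>fst ` S. h (deg S v)) = (\<Sum>l=1..D. real (num S l) * h l)"
proof -
  have "(\<Sum>v\<in>fst ` S. h (deg S v)) = (\<Sum>l=1..D. \<Sum>v | v \<in> fst ` S \<and> deg S v = l. h (deg S v))"
    using assms by (intro sum.group[symmetric]) (auto simp: Suc_le_eq deg_pos_iff simp del: fst_conv)
  also have "\<dots> = (\<Sum>l=1..D. real (num S l) * h l)"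
  proof (rule sum.cong[OF refl])
    fix l assume "l \<in> {1..D}"
    then have "{v. v \<in> fst ` S \<and> deg S v = l} = {v. deg S v = l}"
      by (auto simp: Suc_le_eq deg_pos_iff[OF assms(1)])
    then show "(\<Sum>v | v \<in> fst ` S \<and> deg S v = l. h (deg S v)) = real (num S l) * h l"
      by (simp add: num_def)
  qed
  finally show ?thesis .
qed

lemma card_eq_sum_deg:
  assumes "finite S"
  shows "card S = (\<Sum>v\<in>fst ` S. deg S v)"
  using sum.group[OF assms _ subset_refl[of "fst ` S"], of "\<lambda>_. 1::nat"] assms
  by (simp add: deg_def)

lemma card_eq_sum_num:
  assumes "finite S" "\<And>v. deg S v \<le> D"
  shows "real (card S) = (\<Sum>l=1..D. real (num S l) * real l)"
  using sum_by_deg[OF assms, of real] card_eq_sum_deg[OF assms(1)] by simp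

lemma card_nodes_eq_sum_num:
  assumes "finite S" "\<And>v. deg S v \<le> D"
  shows "real (card (fst ` S)) = (\<Sum>l=1..D. real (num S l))"
  using sum_by_deg[OF assms, of "\<lambda>_. 1"] by simp

lemma deg_mono: "finite T \<Longrightarrow> S \<subseteq> T \<Longrightarrow> deg S v \<le> deg T v"
  unfolding deg_def by (intro card_mono) auto

lemma even_card_sym_diff:
  assumes "finite A" "finite B"
  shows "even (card (sym_diff A B)) \<longleftrightarrow> (even (card A) \<longleftrightarrow> even (card B))"
proof -
  have "card (sym_diff A B) = card (A - B) + card (B - A)"
    using assms by (intro card_Un_disjoint) auto
  moreover have "card A = card (A - B) + card (A \<inter> B)" "card B = card (B - A) + card (A \<inter> B)"
    using assms by (metis Un_Diff_Int card_Int_Diff add.commute, metis Int_commute card_Int_Diff add.commute)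
  ultimately show ?thesis by auto
qed

text \<open>A word is represented by its support, so that addition mod 2 becomes
  \<open>sym_diff\<close>. The parity counts sockets, so parallel edges cancel in pairs.\<close>

definition kern :: "('v \<times> 'i) set \<Rightarrow> ('v \<times> 'i \<Rightarrow> 'c \<times> 'j) \<Rightarrow> 'v set set" where
  "kern S \<sigma> = {X. X \<subseteq> fst ` S \<and> (\<forall>c. even (card {s\<in>S. fst (\<sigma> s) = c \<and> fst s \<in> X}))}"

lemma finite_kern [simp]: "finite S \<Longrightarrow> finite (kern S \<sigma>)"
  unfolding kern_def by (rule finite_subset[of _ "Pow (fst ` S)"]) auto

lemma empty_in_kern: "{} \<in> kern S \<sigma>"
  by (simp add: kern_def)

lemma card_kern_pos: "finite S \<Longrightarrow> 0 < card (kern S \<sigma>)"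
  using empty_in_kern by (metis card_gt_0_iff empty_iff finite_kern)

lemma card_kern_le: "finite S \<Longrightarrow> card (kern S \<sigma>) \<le> 2 ^ card (fst ` S)"
  by (simp add: card_Pow[symmetric] kern_def) (intro card_mono, auto)

lemma kern_cong: "(\<And>s. s \<in> S \<Longrightarrow> \<sigma> s = \<tau> s) \<Longrightarrow> kern S \<sigma> = kern S \<tau>"
  unfolding kern_def by (intro Collect_cong conj_cong refl all_cong1 arg_cong[where f="\<lambda>A. even (card A)"]) auto

text \<open>Rank-nullity by counting: two words with the same syndrome differ by a kernel element,
  so every fibre of the syndrome map embeds into the kernel, and there are at most as many syndromes
  as sets of checks.\<close>

lemma card_kern_ge:
  assumes S: "finite S" "finite T" and \<sigma>: "\<sigma> \<in> bijs S T"
  shows "2 ^ card (fst ` S) \<le> card (kern S \<sigma>) * 2 ^ card (fst ` T)"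
proof -
  define syn where "syn X = {c. odd (card {s\<in>S. fst (\<sigma> s) = c \<and> fst s \<in> X})}" for X
  have synT: "syn X \<subseteq> fst ` T" for X
  proof
    fix c assume "c \<in> syn X"
    then have "{s\<in>S. fst (\<sigma> s) = c \<and> fst s \<in> X} \<noteq> {}"
      unfolding syn_def by (metis (mono_tags, lifting) card.empty even_zero mem_Collect_eq)
    then show "c \<in> fst ` T" using \<sigma> by (auto simp: bijs_def)
  qed
  have diff: "sym_diff X Y \<in> kern S \<sigma>" if "X \<subseteq> fst ` S" "Y \<subseteq> fst ` S" "syn X = syn Y" for X Y
  proof -
    have "even (card {s\<in>S. fst (\<sigma> s) = c \<and> fst s \<in> sym_diff X Y})" for c
    proof -
      have "{s\<in>S. fst (\<sigma> s) = c \<and> fst s \<in> sym_diff X Y} =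
        sym_diff {s\<in>S. fst (\<sigma> s) = c \<and> fst s \<in> X} {s\<in>S. fst (\<sigma> s) = c \<and> fst s \<in> Y}" by auto
      moreover have "even (card {s\<in>S. fst (\<sigma> s) = c \<and> fst s \<in> X}) \<longleftrightarrow>
          even (card {s\<in>S. fst (\<sigma> s) = c \<and> fst s \<in> Y})"
        using that(3) by (auto simp: syn_def set_eq_iff)
      ultimately show ?thesis
        using S even_card_sym_diff[of "{s\<in>S. fst (\<sigma> s) = c \<and> fst s \<in> X}" "{s\<in>S. fst (\<sigma> s) = c \<and> fst s \<in> Y}"]
        by (simp only:) simp
    qed
    then show ?thesis using that by (auto simp: kern_def)
  qed
  have fibre: "card {X. X \<in> Pow (fst ` S) \<and> syn X = C} \<le> card (kern S \<sigma>)" for C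
  proof (cases "{X. X \<in> Pow (fst ` S) \<and> syn X = C} = {}")
    case False
    then obtain Y where Y: "Y \<subseteq> fst ` S" "syn Y = C" by auto
    show ?thesis
    proof (rule card_inj_on_le[where f = "\<lambda>X. sym_diff X Y"])
      show "inj_on (\<lambda>X. sym_diff X Y) {X. X \<in> Pow (fst ` S) \<and> syn X = C}"
        by (rule inj_onI) blast
      show "(\<lambda>X. sym_diff X Y) ` {X. X \<in> Pow (fst ` S) \<and> syn X = C} \<subseteq> kern S \<sigma>"
        using Y diff by auto
    qed (use S in simp)
  qed (use S in \<open>simp del: Collect_empty_eq\<close>)
  have "2 ^ card (fst ` S) = (\<Sum>X\<in>Pow (fst ` S). 1::nat)"
    using S by (simp add: card_Pow)
  also have "\<dots> = (\<Sum>C\<in>Pow (fst ` T). \<Sum>X | X \<in> Pow (fst ` S) \<and> syn X = C. 1)"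
    using S synT by (intro sum.group[symmetric]) auto
  also have "\<dots> \<le> (\<Sum>C\<in>Pow (fst ` T). card (kern S \<sigma>))"
    using fibre by (intro sum_mono) simp
  also have "\<dots> = card (kern S \<sigma>) * 2 ^ card (fst ` T)"
    using S by (simp add: card_Pow)
  finally show ?thesis .
qed

section \<open>Peeling and the average log kernel size\<close>

definition leaves :: "('c \<times> 'j) set \<Rightarrow> ('c \<times> 'j) set" where
  "leaves T = {t\<in>T. deg T (fst t) = 1}"

definition peel :: "('v \<times> 'i) set \<Rightarrow> ('v \<times> 'i) set \<Rightarrow> ('v \<times> 'i) set" where
  "peel S A = {s\<in>S. fst s \<notin> fst ` A}"

text \<open>A check of degree one is a parity equation in a single variable and forces that variable
  to zero. Deleting all sockets of zero variables changes no parity.\<close>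

lemma kern_peel:
  assumes S: "finite S" "finite T" and \<sigma>: "\<sigma> \<in> bijs S T"
  shows "kern S \<sigma> = kern (peel S {s\<in>S. \<sigma> s \<in> leaves T}) \<sigma>"
proof -
  define A where "A = {s\<in>S. \<sigma> s \<in> leaves T}"
  have inj: "inj_on \<sigma> S" and im: "\<sigma> ` S = T" using \<sigma> by (auto simp: bijs_def bij_betw_def)
  have dis: "fst s \<notin> X" if X: "X \<in> kern S \<sigma>" and s: "s \<in> A" for X s
  proof
    assume sX: "fst s \<in> X"
    have "s \<in> S" and 1: "deg T (fst (\<sigma> s)) = 1" and "\<sigma> s \<in> T"
      using s im by (auto simp: A_def leaves_def)
    from 1 obtain t where t: "{t\<in>T. fst t = fst (\<sigma> s)} = {t}"
      unfolding deg_def by (auto simp: card_1_singleton_iff)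
    have "s' = s" if "s' \<in> S" "fst (\<sigma> s') = fst (\<sigma> s)" for s'
    proof -
      have "\<sigma> s' = \<sigma> s" using t that im \<open>\<sigma> s \<in> T\<close> by (metis (mono_tags, lifting) imageI mem_Collect_eq singletonD)
      then show ?thesis using inj that \<open>s \<in> S\<close> by (auto dest: inj_onD)
    qed
    then have "{s'\<in>S. fst (\<sigma> s') = fst (\<sigma> s) \<and> fst s' \<in> X} = {s}" using \<open>s \<in> S\<close> sX by auto
    moreover have "even (card {s'\<in>S. fst (\<sigma> s') = fst (\<sigma> s) \<and> fst s' \<in> X})"
      using X by (simp add: kern_def)
    ultimately show False by simp
  qed
  have eq: "{s\<in>S. fst (\<sigma> s) = c \<and> fst s \<in> X} = {s\<in>peel S A. fst (\<sigma> s) = c \<and> fst s \<in> X}"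
    if "X \<inter> fst ` A = {}" for X c
    using that by (auto simp: peel_def)
  show ?thesis unfolding A_def[symmetric]
  proof (intro equalityI subsetI)
    fix X assume X: "X \<in> kern S \<sigma>"
    then have "X \<inter> fst ` A = {}" using dis by auto
    moreover have "X \<subseteq> fst ` peel S A"
    proof
      fix v assume v: "v \<in> X"
      then obtain s where "s \<in> S" "fst s = v" using X by (auto simp: kern_def)
      moreover have "v \<notin> fst ` A" using v \<open>X \<inter> fst ` A = {}\<close> by blast
      ultimately have "s \<in> peel S A" by (simp add: peel_def)
      then show "v \<in> fst ` peel S A" using \<open>fst s = v\<close> by blast
    qed
    ultimately show "X \<in> kern (peel S A) \<sigma>"
      using X eq[of X] by (simp add: kern_def)
  next
    fix X assume X: "X \<in> kern (peel S A) \<sigma>"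
    then have "X \<subseteq> fst ` peel S A" by (simp add: kern_def)
    moreover have "fst ` peel S A \<inter> fst ` A = {}" by (auto simp: peel_def)
    ultimately have "X \<inter> fst ` A = {}" by blast
    moreover have "X \<subseteq> fst ` S"
    proof -
      have "fst ` peel S A \<subseteq> fst ` S" by (auto simp: peel_def)
      then show ?thesis using \<open>X \<subseteq> fst ` peel S A\<close> by blast
    qed
    ultimately show "X \<in> kern S \<sigma>"
      using X eq[of X] by (simp add: kern_def)
  qed
qed

definition lent :: "('v \<times> 'i) set \<Rightarrow> ('c \<times> 'j) set \<Rightarrow> real" where
  "lent S T = avg (bijs S T) (\<lambda>\<sigma>. log 2 (card (kern S \<sigma>)))"

text \<open>Models a partial matching: \<open>T\<close> may have more sockets than \<open>S\<close>,
  and those actually used form a uniform subset of size \<open>card S\<close>.\<close>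

definition ment :: "('v \<times> 'i) set \<Rightarrow> ('c \<times> 'j) set \<Rightarrow> real" where
  "ment S T = avg (ksubsets T (card S)) (lent S)"

text \<open>Erasure and peeling both leave a subset \<open>A\<close> of the variable sockets of a
  larger perfect matching. Only the image of \<open>A\<close>, a uniform subset of the check
  sockets, still matters.\<close>

lemma ment_eq:
  assumes "finite S" "finite T" "card S = card T" "A \<subseteq> S"
  shows "avg (bijs S T) (\<lambda>\<sigma>. log 2 (card (kern A \<sigma>))) = ment A T"
proof -
  have "avg (bijs S T) (\<lambda>\<sigma>. log 2 (card (kern A \<sigma>))) =
        avg (bijs S T) (\<lambda>\<sigma>. log 2 (card (kern A (restrict \<sigma> A))))"
  proof (rule avg_cong)
    fix \<sigma>
    have "kern A \<sigma> = kern A (restrict \<sigma> A)" by (rule kern_cong) simp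
    then show "log 2 (card (kern A \<sigma>)) = log 2 (card (kern A (restrict \<sigma> A)))" by simp
  qed
  also have "\<dots> = ment A T"
    unfolding ment_def lent_def[abs_def] by (rule avg_bijs_image[OF assms])
  finally show ?thesis .
qed

text \<open>\<open>A\<close> is the revealed set of sockets matched to leaves.
  \<open>peel S A\<close> drops further sockets of the same variables, whose partners stay unknown,
  so the perfect matching on the left becomes a partial one on the right. The identity is exact; all
  approximation lies in the profile of \<open>peel S A\<close>.\<close>

lemma lent_peel:
  assumes "finite S" "finite T" "card S = card T"
  shows "lent S T = avg (ksubsets S (card (leaves T))) (\<lambda>A. ment (peel S A) (T - leaves T))"
proof -
  have fB: "finite (leaves T)" "leaves T \<subseteq> T" using assms by (auto simp: leaves_def)
  define f where "f A \<sigma> = log 2 (card (kern (peel S A) \<sigma>))" for A and \<sigma> :: "'a \<times> 'b \<Rightarrow> 'c \<times> 'd"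
  have "lent S T = avg (bijs S T) (\<lambda>\<sigma>. f {s\<in>S. \<sigma> s \<in> leaves T} (restrict \<sigma> (S - {s\<in>S. \<sigma> s \<in> leaves T})))"
    unfolding lent_def
  proof (rule avg_cong)
    fix \<sigma> assume \<sigma>: "\<sigma> \<in> bijs S T"
    let ?A = "{s\<in>S. \<sigma> s \<in> leaves T}"
    have "kern (peel S ?A) \<sigma> = kern (peel S ?A) (restrict \<sigma> (S - ?A))"
      by (rule kern_cong) (auto simp: peel_def)
    then show "log 2 (card (kern S \<sigma>)) = f ?A (restrict \<sigma> (S - ?A))"
      using kern_peel[OF assms(1,2) \<sigma>] by (simp add: f_def)
  qed
  also have "\<dots> = avg (ksubsets S (card (leaves T))) (\<lambda>A. avg (bijs (S - A) (T - leaves T)) (f A))"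
    by (rule avg_bijs_vimage[OF assms fB(2)])
  also have "\<dots> = avg (ksubsets S (card (leaves T))) (\<lambda>A. ment (peel S A) (T - leaves T))"
  proof (rule avg_cong)
    fix A assume A: "A \<in> ksubsets S (card (leaves T))"
    then have "finite A" using assms by (auto simp: ksubsets_def dest: finite_subset)
    then show "avg (bijs (S - A) (T - leaves T)) (f A) = ment (peel S A) (T - leaves T)"
      unfolding f_def using assms fB A
      by (intro ment_eq) (auto simp: card_Diff_subset ksubsets_def peel_def rev_image_eqI)
  qed
  finally show ?thesis .
qed

lemma avg_bounds:
  assumes "\<And>a. a \<in> A \<Longrightarrow> 0 \<le> f a \<and> f a \<le> B" "0 \<le> B"
  shows "0 \<le> avg A f \<and> avg A f \<le> B"
proof -
  have "(\<Sum>a\<in>A. f a) \<le> (\<Sum>a\<in>A. B)" using assms by (intro sum_mono) auto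
  moreover have "0 \<le> (\<Sum>a\<in>A. f a)" using assms by (intro sum_nonneg) auto
  \<comment> \<open>When \<open>card A = 0\<close>, \<open>avg\<close> is 0 by the convention for
    division by zero; this case is the reason for assuming \<open>0 \<le> B\<close>.\<close>
  ultimately show ?thesis using assms(2)
    by (cases "card A = 0") (auto simp: avg_def divide_le_eq mult.commute)
qed

lemma log2_card_kern_bounds:
  assumes "finite S"
  shows "0 \<le> log 2 (card (kern S \<sigma>)) \<and> log 2 (card (kern S \<sigma>)) \<le> card (fst ` S)"
proof -
  have "1 \<le> card (kern S \<sigma>)" using card_kern_pos[OF assms, of \<sigma>] by linarith
  then have 1: "1 \<le> real (card (kern S \<sigma>))" by linarith
  have "real (card (kern S \<sigma>)) \<le> real (2 ^ card (fst ` S))"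
    using card_kern_le[OF assms] by (rule of_nat_mono)
  then have "real (card (kern S \<sigma>)) \<le> 2 powr (real (card (fst ` S)))" by (simp add: powr_realpow)
  then have "log 2 (card (kern S \<sigma>)) \<le> card (fst ` S)" using 1 by (subst log_le_iff) auto
  then show ?thesis using 1 by simp
qed

lemma lent_bounds:
  assumes "finite S"
  shows "0 \<le> lent S T \<and> lent S T \<le> card (fst ` S)"
  unfolding lent_def using assms log2_card_kern_bounds by (intro avg_bounds) auto

lemma ment_bounds:
  assumes "finite S"
  shows "0 \<le> ment S T \<and> ment S T \<le> card (fst ` S)"
  unfolding ment_def using assms lent_bounds by (intro avg_bounds) auto

section \<open>States near a degree profile\<close>

text \<open>A socket is a pair of its node and an index. A state consists of the block length, the
  variable sockets and the check sockets. Checks of degree one are left out of the index set \<open>J\<close>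
  below whenever their number is determined by the other degrees.\<close>
type_synonym sockets = "(nat \<times> nat) set"
type_synonym state = "nat \<times> sockets \<times> sockets"

abbreviation "sn (st :: state) \<equiv> real (fst st)"
abbreviation "sv (st :: state) \<equiv> fst (snd st)"
abbreviation "sc (st :: state) \<equiv> snd (snd st)"

text \<open>\<open>R\<close> is \<open>(=)\<close> for a perfect matching and \<open>(\<le>)\<close>
  when check sockets may stay unmatched. The clause \<open>1 \<le> e * sn st\<close> lets a single
  tolerance control the size as well: shrinking \<open>e\<close> forces the block length to
  infinity, so one filter carries both limits.\<close>

definition near :: "(nat \<Rightarrow> nat \<Rightarrow> bool) \<Rightarrow> nat \<Rightarrow> nat set \<Rightarrow> (nat \<Rightarrow> real) \<Rightarrow> (nat \<Rightarrow> real) \<Rightarrow> real \<Rightarrow> state \<Rightarrow> bool" where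
  "near R D J a c e st \<longleftrightarrow> finite (sv st) \<and> finite (sc st) \<and> R (card (sv st)) (card (sc st)) \<and>
     (\<forall>v. deg (sv st) v \<le> D) \<and> (\<forall>v. deg (sc st) v \<le> D) \<and> 1 \<le> e * sn st \<and>
     (\<forall>l\<in>{1..D}. \<bar>real (num (sv st) l) / sn st - a l\<bar> \<le> e) \<and>
     (\<forall>j\<in>J. \<bar>real (num (sc st) j) / sn st - c j\<bar> \<le> e)"

definition nearF :: "(nat \<Rightarrow> nat \<Rightarrow> bool) \<Rightarrow> nat \<Rightarrow> nat set \<Rightarrow> (nat \<Rightarrow> real) \<Rightarrow> (nat \<Rightarrow> real) \<Rightarrow> state filter" where
  "nearF R D J a c = (INF e\<in>{0<..}. principal {st. near R D J a c e st})"

lemma near_mono: "near R D J a c e st \<Longrightarrow> e \<le> e' \<Longrightarrow> near R D J a c e' st"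
proof -
  assume st: "near R D J a c e st" and e: "e \<le> e'"
  have "e * sn st \<le> e' * sn st" using e by (intro mult_right_mono) auto
  then show ?thesis using st e unfolding near_def by force
qed

lemma eventually_nearF:
  "eventually P (nearF R D J a c) \<longleftrightarrow> (\<exists>e>0. \<forall>st. near R D J a c e st \<longrightarrow> P st)"
proof -
  have "eventually P (nearF R D J a c) \<longleftrightarrow>
      (\<exists>e\<in>{0<..}. eventually P (principal {st. near R D J a c e st}))"
    unfolding nearF_def
  proof (rule eventually_INF_base)
    fix e e' :: real assume "e \<in> {0<..}" "e' \<in> {0<..}"
    then show "\<exists>x\<in>{0<..}. principal {st. near R D J a c x st} \<le>
        inf (principal {st. near R D J a c e st}) (principal {st. near R D J a c e' st})"
      by (intro bexI[of _ "min e e'"]) (auto intro: near_mono[of _ _ _ _ _ "min e e'"])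
  qed auto
  then show ?thesis by (auto simp: eventually_principal)
qed

lemma eventually_near: "0 < e \<Longrightarrow> eventually (near R D J a c e) (nearF R D J a c)"
  by (auto simp: eventually_nearF)

lemma tendsto_nearF:
  assumes "\<And>e st. 0 < e \<Longrightarrow> near R D J a c e st \<Longrightarrow> \<bar>f st - L\<bar> \<le> e"
  shows "(f \<longlongrightarrow> L) (nearF R D J a c)"
proof (rule tendstoI)
  fix e :: real assume e: "0 < e"
  show "eventually (\<lambda>st. dist (f st) L < e) (nearF R D J a c)"
  proof (rule eventually_mono)
    show "eventually (near R D J a c (e/2)) (nearF R D J a c)" using e by (intro eventually_near) simp
    fix st assume "near R D J a c (e/2) st"
    then have "\<bar>f st - L\<bar> \<le> e/2" using e by (intro assms) auto
    then show "dist (f st) L < e" using e by (simp add: dist_real_def)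
  qed
qed

lemma tendsto_num_var: "l \<in> {1..D} \<Longrightarrow> ((\<lambda>st. real (num (sv st) l) / sn st) \<longlongrightarrow> a l) (nearF R D J a c)"
  by (rule tendsto_nearF) (auto simp: near_def)

lemma tendsto_num_chk: "j \<in> J \<Longrightarrow> ((\<lambda>st. real (num (sc st) j) / sn st) \<longlongrightarrow> c j) (nearF R D J a c)"
  by (rule tendsto_nearF) (auto simp: near_def)

lemma tendsto_inverse_size: "((\<lambda>st. 1 / sn st) \<longlongrightarrow> 0) (nearF R D J a c)"
proof (rule tendsto_nearF)
  fix e :: real and st assume "0 < e" "near R D J a c e st"
  then have "1 \<le> e * sn st" by (simp add: near_def)
  moreover from this \<open>0 < e\<close> have "0 < sn st" by (metis less_le_trans zero_less_mult_pos zero_less_one)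
  ultimately show "\<bar>1 / sn st - 0\<bar> \<le> e" by (simp add: divide_le_eq)
qed

lemma eventually_nearF_valid:
  "eventually (\<lambda>st. finite (sv st) \<and> finite (sc st) \<and> R (card (sv st)) (card (sc st)) \<and>
     (\<forall>v. deg (sv st) v \<le> D) \<and> (\<forall>v. deg (sc st) v \<le> D) \<and> 0 < sn st) (nearF R D J a c)"
  by (rule eventually_mono[OF eventually_near[of 1]]) (auto simp: near_def)

lemma tendsto_card_var:
  "((\<lambda>st. real (card (sv st)) / sn st) \<longlongrightarrow> (\<Sum>l=1..D. a l * real l)) (nearF R D J a c)"
proof -
  have "((\<lambda>st. \<Sum>l=1..D. real (num (sv st) l) / sn st * real l) \<longlongrightarrow> (\<Sum>l=1..D. a l * real l)) (nearF R D J a c)"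
    by (intro tendsto_sum tendsto_mult tendsto_num_var tendsto_const)
  moreover have "eventually (\<lambda>st. (\<Sum>l=1..D. real (num (sv st) l) / sn st * real l) = real (card (sv st)) / sn st) (nearF R D J a c)"
    using eventually_nearF_valid
    by (rule eventually_mono) (subst card_eq_sum_num[of _ D]; auto simp: sum_divide_distrib)
  ultimately show ?thesis by (rule Lim_transform_eventually)
qed

lemma tendsto_card_chk:
  "((\<lambda>st. real (card (sc st)) / sn st) \<longlongrightarrow> (\<Sum>l=1..D. c l * real l)) (nearF R D {1..D} a c)"
proof -
  have "((\<lambda>st. \<Sum>l=1..D. real (num (sc st) l) / sn st * real l) \<longlongrightarrow> (\<Sum>l=1..D. c l * real l)) (nearF R D {1..D} a c)"
    by (intro tendsto_sum tendsto_mult tendsto_num_chk tendsto_const)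
  moreover have "eventually (\<lambda>st. (\<Sum>l=1..D. real (num (sc st) l) / sn st * real l) = real (card (sc st)) / sn st) (nearF R D {1..D} a c)"
    using eventually_nearF_valid
    by (rule eventually_mono) (subst card_eq_sum_num[of _ D]; auto simp: sum_divide_distrib)
  ultimately show ?thesis by (rule Lim_transform_eventually)
qed

section \<open>Averages in which bad outcomes are rare\<close>

lemma weighted_close:
  fixes w f :: "'a \<Rightarrow> real"
  assumes fin: "finite K" and w: "\<And>x. x \<in> K \<Longrightarrow> 0 \<le> w x" "(\<Sum>x\<in>K. w x) = 1"
    and B: "\<And>x. x \<in> K \<Longrightarrow> \<bar>f x - P\<bar> \<le> B"
    and d: "\<And>x. x \<in> K \<Longrightarrow> x \<notin> Bad \<Longrightarrow> \<bar>f x - P\<bar> \<le> d" "0 \<le> d" "0 \<le> B"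
    and bad: "(\<Sum>x\<in>K \<inter> Bad. w x) \<le> g"
  shows "\<bar>(\<Sum>x\<in>K. w x * f x) - P\<bar> \<le> d + g * B"
proof -
  have "(\<Sum>x\<in>K. w x * f x) - P = (\<Sum>x\<in>K. w x * (f x - P))"
    using w by (simp add: right_diff_distrib sum_subtractf sum_distrib_right[symmetric])
  also have "\<bar>\<dots>\<bar> \<le> (\<Sum>x\<in>K. w x * \<bar>f x - P\<bar>)"
    by (rule order_trans[OF sum_abs]) (use w in \<open>auto intro!: sum_mono simp: abs_mult\<close>)
  also have "\<dots> \<le> (\<Sum>x\<in>K. w x * d + (if x \<in> Bad then w x * B else 0))"
  proof (rule sum_mono)
    fix x assume x: "x \<in> K"
    show "w x * \<bar>f x - P\<bar> \<le> w x * d + (if x \<in> Bad then w x * B else 0)"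
    proof (cases "x \<in> Bad")
      case True
      have "w x * \<bar>f x - P\<bar> \<le> w x * B" using B[OF x] w(1)[OF x] by (intro mult_left_mono)
      moreover have "0 \<le> w x * d" using w x d by simp
      ultimately show ?thesis using True by simp
    qed (use d x w in \<open>auto intro: mult_left_mono\<close>)
  qed
  also have "\<dots> = d + (\<Sum>x\<in>K \<inter> Bad. w x) * B"
    using w fin by (simp add: sum.distrib sum_distrib_right[symmetric] sum.If_cases)
  also have "\<dots> \<le> d + g * B" using bad d by (intro add_left_mono mult_right_mono)
  finally show ?thesis .
qed

lemma avg_close:
  fixes P B d g :: real
  assumes fin: "finite K" "0 < card K"
    and B: "\<And>x. x \<in> K \<Longrightarrow> \<bar>f x - P\<bar> \<le> B"
    and d: "\<And>x. x \<in> K \<Longrightarrow> x \<notin> Bad \<Longrightarrow> \<bar>f x - P\<bar> \<le> d" "0 \<le> d" "0 \<le> B"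
    and bad: "real (card (K \<inter> Bad)) \<le> g * card K"
  shows "\<bar>avg K f - P\<bar> \<le> d + g * B"
proof -
  have "\<bar>(\<Sum>x\<in>K. 1 / real (card K) * f x) - P\<bar> \<le> d + g * B"
    by (rule weighted_close[OF fin(1), where Bad = Bad]) (use assms in \<open>auto simp: divide_le_eq\<close>)
  then show ?thesis by (simp add: avg_def sum_divide_distrib)
qed

text \<open>Quantifying over all \<open>d' > d\<close> makes the estimate pass unchanged through any number of rounds.\<close>
definition close :: "state filter \<Rightarrow> (sockets \<Rightarrow> sockets \<Rightarrow> real) \<Rightarrow> real \<Rightarrow> real \<Rightarrow> bool" where
  "close F val P d \<longleftrightarrow> (\<forall>d'>d. eventually (\<lambda>st. \<bar>val (sv st) (sc st) / sn st - P\<bar> < d') F)"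

text \<open>Divides the slack between \<open>d\<close> and \<open>d'\<close>: typical outcomes get
  the midpoint, and bad outcomes of weight at most \<open>g\<close> cost at most
  \<open>g * B\<close>.\<close>

lemma slack_exists:
  fixes d d' B :: real
  assumes "d < d'" "0 \<le> B"
  obtains g where "0 < g" "(d + d') / 2 + g * B < d'"
proof
  have "(d' - d) / (4 * (B + 1)) * B \<le> (d' - d) / (4 * (B + 1)) * (B + 1)"
    using assms by (intro mult_left_mono) auto
  also have "\<dots> = (d' - d) / 4" using assms by (simp add: divide_simps)
  finally show "(d + d') / 2 + (d' - d) / (4 * (B + 1)) * B < d'" using assms by argo
qed (use assms in simp)

lemma eventually_ball_close:
  fixes f :: "'i \<Rightarrow> 'a \<Rightarrow> real"
  assumes "finite I" "\<And>i. i \<in> I \<Longrightarrow> (f i \<longlongrightarrow> l i) F" "0 < e"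
  shows "eventually (\<lambda>x. \<forall>i\<in>I. \<bar>f i x - l i\<bar> < e) F"
proof (rule eventually_ball_finite[OF assms(1)], rule ballI)
  fix i assume "i \<in> I"
  from tendstoD[OF assms(2)[OF this] assms(3)] show "eventually (\<lambda>x. \<bar>f i x - l i\<bar> < e) F"
    by (simp add: dist_real_def)
qed

lemma close_to_center:
  fixes x y c e n :: real
  assumes "\<bar>x - y * n\<bar> \<le> e / 2 * n" "\<bar>y - c\<bar> < e / 2" "0 < n"
  shows "\<bar>x / n - c\<bar> \<le> e"
proof -
  have "\<bar>(x - y * n) / n\<bar> \<le> e / 2" using assms by (simp add: abs_divide divide_le_eq)
  then have "\<bar>x / n - y\<bar> \<le> e / 2" using assms by (simp add: diff_divide_distrib)
  then show ?thesis using assms(2) by linarith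
qed

lemma divide_avg: "avg K f / c = avg K (\<lambda>x. f x / c)"
  by (simp add: avg_def sum_divide_distrib mult.commute)

lemma num_restrict: "finite T \<Longrightarrow> A \<subseteq> T \<Longrightarrow> 1 \<le> j \<Longrightarrow> num A j = card {v\<in>fst ` T. deg A v = j}"
proof -
  assume "finite T" and A: "A \<subseteq> T" and j: "1 \<le> j"
  then have "finite A" using finite_subset by blast
  have "v \<in> fst ` T" if "deg A v = j" for v
  proof -
    have "v \<in> fst ` A" using deg_pos_iff[OF \<open>finite A\<close>, of v] that j by simp
    then show ?thesis using A by blast
  qed
  then show ?thesis unfolding num_def by (intro arg_cong[where f=card]) blast
qed

text \<open>In a uniform subset of \<open>card S\<close> check sockets, each socket of a check
  survives with probability close to \<open>card S / card T\<close>, so check degrees are thinned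
  binomially. The estimate travels against the process: known after the thinning, concluded before
  it.\<close>

lemma close_thin:
  fixes a c c' :: "nat \<Rightarrow> real"
  assumes cl: "close (nearF (=) D {2..D} a c') lent P d" and d: "0 \<le> d"
    and Ec: "0 < (\<Sum>i=1..D. c i * real i)"
    and c': "\<And>j. j \<in> {2..D} \<Longrightarrow>
      c' j = (\<Sum>i=1..D. c i * binp i j ((\<Sum>l=1..D. a l * real l) / (\<Sum>i=1..D. c i * real i)))"
  shows "close (nearF (\<le>) D {1..D} a c) ment P d"
  unfolding close_def
proof (intro allI impI)
  fix d' assume d': "d < d'"
  define F where "F = nearF (\<le>) D {1..D} a c"
  define Es where "Es = (\<Sum>l=1..D. a l * real l)"
  \<comment> \<open>\<open>lent\<close> is at most the number of variables and hence of sockets, so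
    \<open>B\<close> bounds the error on bad subsets of large states; \<open>max 0\<close> avoids a
    sign condition on \<open>a\<close>.\<close>
  define B where "B = max 0 (Es + 1) + \<bar>P\<bar>"
  have B0: "0 \<le> B" by (simp add: B_def)
  from slack_exists[OF d' this] obtain g where g0: "0 < g" and dg: "(d + d') / 2 + g * B < d'" .
  from cl d' have "eventually (\<lambda>st. \<bar>lent (sv st) (sc st) / sn st - P\<bar> < (d + d') / 2) (nearF (=) D {2..D} a c')"
    by (intro cl[unfolded close_def, rule_format]) simp
  then obtain e where e: "0 < e" "\<And>st. near (=) D {2..D} a c' e st \<Longrightarrow>
      \<bar>lent (sv st) (sc st) / sn st - P\<bar> < (d + d') / 2"
    unfolding eventually_nearF by blast
  \<comment> \<open>Concentration happens around a centre computed from the actual counts of the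
    state, which only converges to \<open>c' j\<close>. Half of \<open>e\<close> pays for the
    deviation and half for this convergence.\<close>
  define cen where "cen j st = (\<Sum>i=1..D. real (num (sc st) i) / sn st * binp i j (real (card (sv st)) / real (card (sc st))))" for j st
  have ratio: "((\<lambda>st. real (card (sv st)) / real (card (sc st))) \<longlongrightarrow> Es / (\<Sum>i=1..D. c i * real i)) F"
  proof -
    have "((\<lambda>st. (real (card (sv st)) / sn st) / (real (card (sc st)) / sn st)) \<longlongrightarrow> Es / (\<Sum>i=1..D. c i * real i)) F"
      unfolding F_def Es_def using Ec by (intro tendsto_divide tendsto_card_var tendsto_card_chk) auto
    moreover have "eventually (\<lambda>st. (real (card (sv st)) / sn st) / (real (card (sc st)) / sn st) = real (card (sv st)) / real (card (sc st))) F"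
      unfolding F_def by (rule eventually_mono[OF eventually_nearF_valid]) auto
    ultimately show ?thesis by (rule Lim_transform_eventually)
  qed
  have cen: "((\<lambda>st. cen j st) \<longlongrightarrow> c' j) F" if "j \<in> {2..D}" for j
    unfolding cen_def binp_def c'[OF that] Es_def[symmetric]
    by (intro tendsto_sum tendsto_mult tendsto_power tendsto_diff tendsto_const ratio)
       (auto simp: F_def intro!: tendsto_num_chk)
  have ev1: "eventually (\<lambda>st. \<forall>j\<in>{2..D}. \<bar>cen j st - c' j\<bar> < e / 2) F"
    using cen e by (intro eventually_ball_close) auto
  have ev2: "eventually (near (\<le>) D {1..D} a c e) F" unfolding F_def using e by (intro eventually_near)
  \<comment> \<open>Chebyshev for at most \<open>D\<close> degrees with threshold
    \<open>e / 2 * n\<close>: the number of sockets is of order \<open>n\<close>, so the total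
    weight of failures is of order \<open>1 / n\<close>.\<close>
  have ev3: "eventually (\<lambda>st. real D * (dev_const D * (real (card (sc st)) / sn st) * (1 / sn st) * 4 / e\<^sup>2) < g) F"
  proof -
    have "((\<lambda>st. real D * (dev_const D * (real (card (sc st)) / sn st) * (1 / sn st) * 4 / e\<^sup>2)) \<longlongrightarrow>
        real D * (dev_const D * (\<Sum>i=1..D. c i * real i) * 0 * 4 / e\<^sup>2)) F"
      unfolding F_def using e by (intro tendsto_mult tendsto_divide tendsto_const tendsto_card_chk tendsto_inverse_size) auto
    from order_tendstoD(2)[OF this, of g] g0 show ?thesis by simp
  qed
  have ev4: "eventually (\<lambda>st. real (card (sv st)) / sn st < Es + 1) F"
    using order_tendstoD(2)[OF tendsto_card_var[of a D "(\<le>)" "{1..D}" c], of "Es + 1"] by (simp add: F_def Es_def)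
  have ev5: "eventually (\<lambda>st. 0 < real (card (sc st)) / sn st) F"
    using order_tendstoD(1)[OF tendsto_card_chk[of c D "(\<le>)" a], of 0] Ec by (simp add: F_def)
  show "eventually (\<lambda>st. \<bar>ment (sv st) (sc st) / sn st - P\<bar> < d') (nearF (\<le>) D {1..D} a c)"
    unfolding F_def[symmetric] using ev1 ev2 ev3 ev4 ev5
  proof eventually_elim
    case (elim st)
    let ?S = "sv st" and ?T = "sc st" and ?n = "sn st" and ?K = "ksubsets (sc st) (card (sv st))"
    have fin: "finite ?S" "finite ?T" and le: "card ?S \<le> card ?T" and D: "\<And>v. deg ?S v \<le> D" "\<And>v. deg ?T v \<le> D"
      and en: "1 \<le> e * ?n" using elim(2) by (auto simp: near_def)
    have n0: "0 < ?n" using en e by (metis less_le_trans zero_less_mult_pos zero_less_one)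
    have T0: "0 < card ?T" using elim(5) by (simp add: zero_less_divide_iff)
    have K: "finite ?K" "0 < card ?K" using fin le card_ksubsets_pos by auto
    define X where "X j A = real (card {v\<in>fst ` ?T. deg A v = j}) -
            (\<Sum>v\<in>fst ` ?T. binp (deg ?T v) j (real (card ?S) / card ?T))" for j and A :: sockets
    define Bad where "Bad = (\<Union>j\<in>{2..D}. {A\<in>?K. e / 2 * ?n < \<bar>X j A\<bar>})"
    have "\<bar>avg ?K (\<lambda>T'. lent ?S T' / ?n) - P\<bar> \<le> (d + d') / 2 + g * B"
    proof (rule avg_close[OF K, where Bad = Bad])
      fix T' assume T': "T' \<in> ?K"
      have "0 \<le> lent ?S T'" "lent ?S T' \<le> card (fst ` ?S)" using lent_bounds[OF fin(1)] by auto
      moreover have "card (fst ` ?S) \<le> card ?S" using fin by (intro card_image_le)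
      ultimately have "0 \<le> lent ?S T' / ?n" "lent ?S T' / ?n \<le> card ?S / ?n"
        using n0 by (auto intro!: divide_right_mono)
      then show "\<bar>lent ?S T' / ?n - P\<bar> \<le> B" using elim(4) unfolding B_def by linarith
      show "\<bar>lent ?S T' / ?n - P\<bar> \<le> (d + d') / 2" if nb: "T' \<notin> Bad"
      proof -
        have T'T: "T' \<subseteq> ?T" "card T' = card ?S" using T' by (auto simp: ksubsets_def)
        have "near (=) D {2..D} a c' e (fst st, ?S, T')"
          unfolding near_def
        proof (intro conjI ballI allI)
          show "finite (sc (fst st, ?S, T'))" using T'T fin finite_subset by auto
          fix v show "deg (sc (fst st, ?S, T')) v \<le> D"
            using deg_mono[OF fin(2) T'T(1), of v] D(2)[of v] by simp
        next
          fix j assume j: "j \<in> {2..D}"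
          have "\<bar>X j T'\<bar> \<le> e / 2 * ?n" using nb T' j by (auto simp: Bad_def not_less)
          moreover have "X j T' = real (num T' j) - cen j st * ?n"
          proof -
            have "(\<Sum>v\<in>fst ` ?T. binp (deg ?T v) j (real (card ?S) / card ?T)) = cen j st * ?n"
              using sum_by_deg[OF fin(2) D(2), of "\<lambda>i. binp i j (real (card ?S) / card ?T)"] n0
              by (simp add: cen_def sum_distrib_right)
            then show ?thesis using num_restrict[OF fin(2) T'T(1), of j] j by (simp add: X_def)
          qed
          ultimately have "\<bar>real (num T' j) - cen j st * ?n\<bar> \<le> e / 2 * ?n" by simp
          moreover have "\<bar>cen j st - c' j\<bar> < e / 2" using elim(1) j by blast
          ultimately show "\<bar>real (num (sc (fst st, ?S, T')) j) / sn (fst st, ?S, T') - c' j\<bar> \<le> e"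
            unfolding fst_conv snd_conv using n0 by (rule close_to_center)
        qed (use elim(2) T'T fin in \<open>auto simp: near_def\<close>)
        from e(2)[OF this] show ?thesis by simp
      qed
    next
      have "real (card (?K \<inter> Bad)) \<le> real (\<Sum>j\<in>{2..D}. card {A\<in>?K. e / 2 * ?n < \<bar>X j A\<bar>})"
      proof (rule of_nat_mono)
        have "card (?K \<inter> Bad) \<le> card Bad" using K by (intro card_mono) (auto simp: Bad_def)
        also have "\<dots> \<le> (\<Sum>j\<in>{2..D}. card {A\<in>?K. e / 2 * ?n < \<bar>X j A\<bar>})"
          unfolding Bad_def by (rule card_UN_le) simp
        finally show "card (?K \<inter> Bad) \<le> (\<Sum>j\<in>{2..D}. card {A\<in>?K. e / 2 * ?n < \<bar>X j A\<bar>})" .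
      qed
      also have "\<dots> = (\<Sum>j\<in>{2..D}. real (card {A\<in>?K. e / 2 * ?n < \<bar>X j A\<bar>}))" by simp
      also have "\<dots> \<le> (\<Sum>j\<in>{2..D}. dev_const D * card ?T / (e / 2 * ?n)\<^sup>2 * card ?K)"
        unfolding X_def using fin T0 le D e n0 by (intro sum_mono card_dev_ksubsets) auto
      also have "\<dots> = real (card {2..D}) * (dev_const D * card ?T / (e / 2 * ?n)\<^sup>2) * card ?K" by simp
      also have "\<dots> \<le> real D * (dev_const D * card ?T / (e / 2 * ?n)\<^sup>2) * card ?K"
        using dev_const_pos[of D] by (intro mult_right_mono) auto
      also have "dev_const D * card ?T / (e / 2 * ?n)\<^sup>2 = dev_const D * (real (card ?T) / ?n) * (1 / ?n) * 4 / e\<^sup>2"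
        using n0 e by (simp add: power2_eq_square field_simps)
      also have "real D * (dev_const D * (real (card ?T) / ?n) * (1 / ?n) * 4 / e\<^sup>2) * card ?K \<le> g * card ?K"
        using elim(3) by (intro mult_right_mono) auto
      finally show "real (card (?K \<inter> Bad)) \<le> g * card ?K" .
    qed (use B0 d d' in auto)
    then show ?case using dg by (simp add: ment_def divide_avg)
  qed
qed


lemma deg_peel: "deg (peel S A) v = (if v \<in> fst ` A then 0 else deg S v)"
proof (cases "v \<in> fst ` A")
  case True
  then have "{s \<in> peel S A. fst s = v} = {}" by (auto simp: peel_def)
  then show ?thesis using True unfolding deg_def by (simp only: card.empty if_True)
next
  case False
  then have "{s \<in> peel S A. fst s = v} = {s \<in> S. fst s = v}" by (auto simp: peel_def)
  then show ?thesis using False unfolding deg_def by (simp only: if_False)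
qed

lemma num_peel:
  assumes "finite S" "A \<subseteq> S" "1 \<le> l"
  shows "num (peel S A) l = card {v\<in>{v. deg S v = l}. deg A v = 0}"
proof -
  have "finite A" using assms finite_subset by blast
  then have "deg A v = 0 \<longleftrightarrow> v \<notin> fst ` A" for v using deg_pos_iff[of A v] by auto
  then show ?thesis unfolding num_def deg_peel using assms(3)
    by (intro arg_cong[where f=card]) auto
qed

lemma deg_Diff_leaves: "deg (T - leaves T) v = (if deg T v = 1 then 0 else deg T v)"
proof (cases "deg T v = 1")
  case True
  then have "{s \<in> T - leaves T. fst s = v} = {}" by (auto simp: leaves_def)
  then have "deg (T - leaves T) v = 0" unfolding deg_def by (simp only: card.empty)
  then show ?thesis using True by simp
next
  case False
  then have "{s \<in> T - leaves T. fst s = v} = {s \<in> T. fst s = v}" by (auto simp: leaves_def)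
  then show ?thesis using False unfolding deg_def by (simp only: if_False)
qed

lemma num_Diff_leaves: "1 \<le> j \<Longrightarrow> num (T - leaves T) j = (if j = 1 then 0 else num T j)"
proof -
  assume j: "1 \<le> j"
  have "{v. deg (T - leaves T) v = j} = (if j = 1 then {} else {v. deg T v = j})"
    unfolding deg_Diff_leaves using j by auto
  then show ?thesis unfolding num_def by simp
qed

lemma card_Diff_leaves:
  assumes "finite T" "\<And>v. deg T v \<le> D"
  shows "real (card (T - leaves T)) = (\<Sum>j=2..D. real (num T j) * real j)"
proof -
  have "real (card (T - leaves T)) = (\<Sum>j=1..D. real (num (T - leaves T) j) * real j)"
    using assms by (intro card_eq_sum_num) (auto simp: deg_Diff_leaves)
  also have "\<dots> = (\<Sum>j=2..D. real (num (T - leaves T) j) * real j)"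
    by (rule sum.mono_neutral_right) (auto simp: num_Diff_leaves)
  also have "\<dots> = (\<Sum>j=2..D. real (num T j) * real j)"
    by (rule sum.cong) (auto simp: num_Diff_leaves)
  finally show ?thesis .
qed

text \<open>A variable of degree \<open>l\<close> survives iff none of its sockets is matched to a
  leaf, which has probability close to the \<open>l\<close>-th power of the share of non-leaf
  sockets. That share is computed from the check degrees at least 2 alone. Checks other than leaves
  keep their sockets, hence \<open>c(1 := 0)\<close>.\<close>

lemma close_peel:
  fixes a a' c :: "nat \<Rightarrow> real"
  assumes cl: "close (nearF (\<le>) D {1..D} a' (c(1 := 0))) ment P d" and d: "0 \<le> d"
    and Es: "0 < (\<Sum>l=1..D. a l * real l)"
    and a': "\<And>l. l \<in> {1..D} \<Longrightarrow>
      a' l = a l * ((\<Sum>j=2..D. c j * real j) / (\<Sum>l=1..D. a l * real l)) ^ l"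
  shows "close (nearF (=) D {2..D} a c) lent P d"
  unfolding close_def
proof (intro allI impI)
  fix d' assume d': "d < d'"
  define F where "F = nearF (=) D {2..D} a c"
  define E where "E = (\<Sum>l=1..D. a l * real l)"
  define B where "B = max 0 (E + 1) + \<bar>P\<bar>"
  have B0: "0 \<le> B" by (simp add: B_def)
  from slack_exists[OF d' this] obtain g where g0: "0 < g" and dg: "(d + d') / 2 + g * B < d'" .
  from cl d' have "eventually (\<lambda>st. \<bar>ment (sv st) (sc st) / sn st - P\<bar> < (d + d') / 2) (nearF (\<le>) D {1..D} a' (c(1 := 0)))"
    by (intro cl[unfolded close_def, rule_format]) simp
  then obtain e where e: "0 < e" "\<And>st. near (\<le>) D {1..D} a' (c(1 := 0)) e st \<Longrightarrow>
      \<bar>ment (sv st) (sc st) / sn st - P\<bar> < (d + d') / 2"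
    unfolding eventually_nearF by blast
  define cen where "cen l st = real (num (sv st) l) / sn st *
     (real (card (sc st - leaves (sc st))) / real (card (sv st))) ^ l" for l st
  have ratio: "((\<lambda>st. real (card (sc st - leaves (sc st))) / real (card (sv st))) \<longlongrightarrow> (\<Sum>j=2..D. c j * real j) / E) F"
  proof -
    have "((\<lambda>st. (\<Sum>j=2..D. real (num (sc st) j) / sn st * real j) / (real (card (sv st)) / sn st)) \<longlongrightarrow> (\<Sum>j=2..D. c j * real j) / E) F"
      unfolding F_def E_def using Es by (intro tendsto_divide tendsto_sum tendsto_mult tendsto_const tendsto_card_var tendsto_num_chk) auto
    moreover have "eventually (\<lambda>st. (\<Sum>j=2..D. real (num (sc st) j) / sn st * real j) / (real (card (sv st)) / sn st)
       = real (card (sc st - leaves (sc st))) / real (card (sv st))) F"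
      unfolding F_def
    proof (rule eventually_mono[OF eventually_nearF_valid], elim conjE)
      fix st assume st: "finite (sc st)" "\<forall>v. deg (sc st) v \<le> D" "0 < sn st"
      have "(\<Sum>j=2..D. real (num (sc st) j) / sn st * real j) = real (card (sc st - leaves (sc st))) / sn st"
        using card_Diff_leaves[of "sc st" D] st by (simp add: sum_divide_distrib)
      then show "(\<Sum>j=2..D. real (num (sc st) j) / sn st * real j) / (real (card (sv st)) / sn st)
       = real (card (sc st - leaves (sc st))) / real (card (sv st))" using st by simp
    qed
    ultimately show ?thesis by (rule Lim_transform_eventually)
  qed
  have cen: "((\<lambda>st. cen l st) \<longlongrightarrow> a' l) F" if "l \<in> {1..D}" for l
    unfolding cen_def a'[OF that] E_def[symmetric]
    by (intro tendsto_mult tendsto_power ratio) (use that in \<open>auto simp: F_def intro!: tendsto_num_var\<close>)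
  have ev1: "eventually (\<lambda>st. \<forall>l\<in>{1..D}. \<bar>cen l st - a' l\<bar> < e / 2) F"
    using cen e by (intro eventually_ball_close) auto
  have ev2: "eventually (near (=) D {2..D} a c e) F" unfolding F_def using e by (intro eventually_near)
  have ev3: "eventually (\<lambda>st. real D * (dev_const D * (real (card (sv st)) / sn st) * (1 / sn st) * 4 / e\<^sup>2) < g) F"
  proof -
    have "((\<lambda>st. real D * (dev_const D * (real (card (sv st)) / sn st) * (1 / sn st) * 4 / e\<^sup>2)) \<longlongrightarrow>
        real D * (dev_const D * E * 0 * 4 / e\<^sup>2)) F"
      unfolding F_def E_def using e by (intro tendsto_mult tendsto_divide tendsto_const tendsto_card_var tendsto_inverse_size) auto
    from order_tendstoD(2)[OF this, of g] g0 show ?thesis by simp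
  qed
  have ev4: "eventually (\<lambda>st. real (card (sv st)) / sn st < E + 1) F"
    using order_tendstoD(2)[OF tendsto_card_var[of a D "(=)" "{2..D}" c], of "E + 1"] by (simp add: F_def E_def)
  have ev5: "eventually (\<lambda>st. 0 < real (card (sv st)) / sn st) F"
    using order_tendstoD(1)[OF tendsto_card_var[of a D "(=)" "{2..D}" c], of 0] Es by (simp add: F_def)
  show "eventually (\<lambda>st. \<bar>lent (sv st) (sc st) / sn st - P\<bar> < d') (nearF (=) D {2..D} a c)"
    unfolding F_def[symmetric] using ev1 ev2 ev3 ev4 ev5
  proof eventually_elim
    case (elim st)
    let ?S = "sv st" and ?T = "sc st" and ?n = "sn st" and ?K = "ksubsets (sv st) (card (leaves (sc st)))"
    let ?T1 = "sc st - leaves (sc st)"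
    have fin: "finite ?S" "finite ?T" and eq: "card ?S = card ?T" and D: "\<And>v. deg ?S v \<le> D" "\<And>v. deg ?T v \<le> D"
      and en: "1 \<le> e * ?n" using elim(2) by (auto simp: near_def)
    have n0: "0 < ?n" using en e by (metis less_le_trans zero_less_mult_pos zero_less_one)
    have S0: "0 < card ?S" using elim(5) by (simp add: zero_less_divide_iff)
    have lv: "leaves ?T \<subseteq> ?T" "finite (leaves ?T)" using fin by (auto simp: leaves_def)
    have le: "card (leaves ?T) \<le> card ?S" using card_mono[OF fin(2) lv(1)] eq by simp
    have K: "finite ?K" "0 < card ?K" using fin le card_ksubsets_pos by auto
    have p: "1 - real (card (leaves ?T)) / real (card ?S) = real (card ?T1) / real (card ?S)"
      using lv le eq S0 by (simp add: card_Diff_subset of_nat_diff field_simps)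
    define X where "X l A = real (card {v\<in>{v. deg ?S v = l}. deg A v = 0}) -
            (\<Sum>v | deg ?S v = l. binp (deg ?S v) 0 (real (card (leaves ?T)) / card ?S))" for l and A :: sockets
    define Bad where "Bad = (\<Union>l\<in>{1..D}. {A\<in>?K. e / 2 * ?n < \<bar>X l A\<bar>})"
    have "\<bar>avg ?K (\<lambda>A. ment (peel ?S A) ?T1 / ?n) - P\<bar> \<le> (d + d') / 2 + g * B"
    proof (rule avg_close[OF K, where Bad = Bad])
      fix A assume A: "A \<in> ?K"
      have AS: "A \<subseteq> ?S" "card A = card (leaves ?T)" "finite A"
        using A fin finite_subset by (auto simp: ksubsets_def)
      have pS: "peel ?S A \<subseteq> ?S - A" "finite (peel ?S A)" using fin by (auto simp: peel_def)
      have cp: "card (peel ?S A) \<le> card ?T1"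
        using card_mono[OF _ pS(1)] fin AS lv eq by (simp add: card_Diff_subset)
      have "0 \<le> ment (peel ?S A) ?T1" "ment (peel ?S A) ?T1 \<le> card (fst ` peel ?S A)"
        using ment_bounds[OF pS(2)] by auto
      moreover have "card (fst ` peel ?S A) \<le> card (peel ?S A)" using pS by (intro card_image_le)
      moreover have "card (peel ?S A) \<le> card ?S" using pS fin by (intro card_mono) auto
      ultimately have "0 \<le> ment (peel ?S A) ?T1 / ?n" "ment (peel ?S A) ?T1 / ?n \<le> card ?S / ?n"
        using n0 by (auto intro!: divide_right_mono)
      then show "\<bar>ment (peel ?S A) ?T1 / ?n - P\<bar> \<le> B" using elim(4) unfolding B_def by linarith
      show "\<bar>ment (peel ?S A) ?T1 / ?n - P\<bar> \<le> (d + d') / 2" if nb: "A \<notin> Bad"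
      proof -
        have "near (\<le>) D {1..D} a' (c(1 := 0)) e (fst st, peel ?S A, ?T1)"
          unfolding near_def
        proof (intro conjI ballI allI)
          fix v show "deg (sv (fst st, peel ?S A, ?T1)) v \<le> D" using D by (simp add: deg_peel)
          show "deg (sc (fst st, peel ?S A, ?T1)) v \<le> D" using D by (simp add: deg_Diff_leaves)
        next
          fix j assume j: "j \<in> {1..D}"
          show "\<bar>real (num (sc (fst st, peel ?S A, ?T1)) j) / sn (fst st, peel ?S A, ?T1) - (c(1 := 0)) j\<bar> \<le> e"
            using elim(2) j e by (auto simp: num_Diff_leaves near_def)
        next
          fix l assume l: "l \<in> {1..D}"
          have "\<bar>X l A\<bar> \<le> e / 2 * ?n" using nb A l by (auto simp: Bad_def not_less)
          moreover have "X l A = real (num (peel ?S A) l) - cen l st * ?n"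
          proof -
            have "(\<Sum>v | deg ?S v = l. binp (deg ?S v) 0 (real (card (leaves ?T)) / card ?S)) = cen l st * ?n"
              using n0 p by (simp add: cen_def binp_def num_def)
            then show ?thesis using num_peel[OF fin(1) AS(1), of l] l by (simp add: X_def)
          qed
          ultimately have "\<bar>real (num (peel ?S A) l) - cen l st * ?n\<bar> \<le> e / 2 * ?n" by simp
          moreover have "\<bar>cen l st - a' l\<bar> < e / 2" using elim(1) l by blast
          ultimately show "\<bar>real (num (sv (fst st, peel ?S A, ?T1)) l) / sn (fst st, peel ?S A, ?T1) - a' l\<bar> \<le> e"
            unfolding fst_conv snd_conv using n0 by (rule close_to_center)
        qed (use cp pS fin en in auto)
        from e(2)[OF this] show ?thesis by simp
      qed
    next
      have "real (card (?K \<inter> Bad)) \<le> real (\<Sum>j\<in>{1..D}. card {A\<in>?K. e / 2 * ?n < \<bar>X j A\<bar>})"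
      proof (rule of_nat_mono)
        have "card (?K \<inter> Bad) \<le> card Bad" using K by (intro card_mono) (auto simp: Bad_def)
        also have "\<dots> \<le> (\<Sum>j\<in>{1..D}. card {A\<in>?K. e / 2 * ?n < \<bar>X j A\<bar>})"
          unfolding Bad_def by (rule card_UN_le) simp
        finally show "card (?K \<inter> Bad) \<le> (\<Sum>j\<in>{1..D}. card {A\<in>?K. e / 2 * ?n < \<bar>X j A\<bar>})" .
      qed
      also have "\<dots> = (\<Sum>j\<in>{1..D}. real (card {A\<in>?K. e / 2 * ?n < \<bar>X j A\<bar>}))" by simp
      also have "\<dots> \<le> (\<Sum>j\<in>{1..D}. dev_const D * card ?S / (e / 2 * ?n)\<^sup>2 * card ?K)"
      proof (intro sum_mono)
        fix l assume l: "l \<in> {1..D}"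
        have I: "{v. deg ?S v = l} \<subseteq> fst ` ?S"
        proof
          fix v assume "v \<in> {v. deg ?S v = l}"
          then have "0 < deg ?S v" using l by simp
          then show "v \<in> fst ` ?S" using deg_pos_iff[OF fin(1)] by blast
        qed
        show "real (card {A\<in>?K. e / 2 * ?n < \<bar>X l A\<bar>}) \<le> dev_const D * card ?S / (e / 2 * ?n)\<^sup>2 * card ?K"
          unfolding X_def by (rule card_dev_ksubsets[OF fin(1) S0 le D(1) I]) (use e n0 in simp)
      qed
      also have "\<dots> = real D * (dev_const D * card ?S / (e / 2 * ?n)\<^sup>2) * card ?K" by simp
      also have "dev_const D * card ?S / (e / 2 * ?n)\<^sup>2 = dev_const D * (real (card ?S) / ?n) * (1 / ?n) * 4 / e\<^sup>2"
        using n0 e by (simp add: power2_eq_square field_simps)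
      also have "real D * (dev_const D * (real (card ?S) / ?n) * (1 / ?n) * 4 / e\<^sup>2) * card ?K \<le> g * card ?K"
        using elim(3) by (intro mult_right_mono) auto
      finally show "real (card (?K \<inter> Bad)) \<le> g * card ?K" .
    qed (use B0 d d' in auto)
    then show ?case using dg lent_peel[OF fin eq] by (simp add: divide_avg)
  qed
qed

section \<open>First moment of the kernel size\<close>

text \<open>\<open>w\<close> is the mode of the binomial law with success probability
  \<open>w / N\<close>, so its mass is at least the average \<open>1 / (N + 1)\<close>. The inverse
  binomial coefficient is thus bounded with only a polynomial loss.\<close>

lemma binomial_mode:
  assumes w: "0 < w" "w < N"
  shows "1 \<le> (real N + 1) * (real (N choose w) * (real w / N) ^ w * (1 - real w / N) ^ (N - w))"
proof -
  define p where "p = real w / N"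
  define q where "q = 1 - p"
  define t where "t i = real (N choose i) * p ^ i * q ^ (N - i)" for i
  have pq: "0 < p" "0 < q" "p * N = w" "q * N = real N - w" using w by (auto simp: p_def q_def field_simps)
  \<comment> \<open>The ratio of consecutive terms, cross-multiplied; it is at least 1 below
    \<open>w\<close> and at most 1 from \<open>w\<close> on.\<close>
  have step: "t (Suc i) * (real (Suc i) * q) = t i * ((real N - real i) * p)" if "i < N" for i
  proof -
    have "real (Suc i) * real (N choose Suc i) = (real N - real i) * real (N choose i)"
    proof -
      have "Suc i * (N choose Suc i) = (N - i) * (N choose i)"
        using binomial_absorption[of i N] binomial_absorb_comp[of N i] by simp
      then have "real (Suc i) * real (N choose Suc i) = real (N - i) * real (N choose i)"
        by (metis of_nat_mult)
      then show ?thesis using that by (simp add: of_nat_diff)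
    qed
    moreover have "q ^ (N - i) = q ^ (N - Suc i) * q" using that by (metis Suc_diff_Suc power_Suc2)
    ultimately show ?thesis unfolding t_def by (simp add: mult_ac)
  qed
  have t0: "0 \<le> t i" for i using pq by (simp add: t_def)
  have up: "t i \<le> t (Suc i)" if "i < w" for i
  proof -
    have "(real (Suc i) * q) * N \<le> ((real N - real i) * p) * N"
    proof -
      have "(real (Suc i) * q) * N = real (Suc i) * (real N - w)" using pq by (simp add: mult_ac)
      moreover have "((real N - real i) * p) * N = (real N - real i) * w" using pq by (simp add: mult_ac)
      moreover have "real (Suc i) * (real N - w) \<le> (real N - real i) * w"
      proof -
        have "real (Suc i) * real N \<le> real w * real N" using that by (intro mult_right_mono) auto
        then show ?thesis by (simp add: algebra_simps)
      qed
      ultimately show ?thesis by (simp only:)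
    qed
    then have le: "real (Suc i) * q \<le> (real N - real i) * p" using w by simp
    have "t i * (real (Suc i) * q) \<le> t (Suc i) * (real (Suc i) * q)"
      unfolding step[OF less_trans[OF that w(2)]] using le t0 by (intro mult_left_mono)
    then show ?thesis using pq by simp
  qed
  have down: "t (Suc i) \<le> t i" if "w \<le> i" "i < N" for i
  proof -
    have "((real N - real i) * p) * N \<le> (real (Suc i) * q) * N"
    proof -
      have "(real (Suc i) * q) * N = real (Suc i) * (real N - w)" using pq by (simp add: mult_ac)
      moreover have "((real N - real i) * p) * N = (real N - real i) * w" using pq by (simp add: mult_ac)
      moreover have "(real N - real i) * w \<le> real (Suc i) * (real N - w)"
      proof -
        have "real w * real N \<le> real i * real N" using that by (intro mult_right_mono) auto
        moreover have "real w \<le> real N" using w by simp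
        ultimately show ?thesis by (simp add: algebra_simps)
      qed
      ultimately show ?thesis by (simp only:)
    qed
    then have le: "(real N - real i) * p \<le> real (Suc i) * q" using w by simp
    have "t (Suc i) * (real (Suc i) * q) \<le> t i * (real (Suc i) * q)"
      unfolding step[OF that(2)] using le t0 by (intro mult_left_mono)
    then show ?thesis using pq by simp
  qed
  have le_w: "t i \<le> t w" if "i \<le> N" for i
  proof (cases "i \<le> w")
    case True
    then show ?thesis by (induction rule: inc_induct) (auto intro: order_trans up)
  next
    case False
    then have "w \<le> i" by simp
    then show ?thesis using that
      by (induction rule: dec_induct) (use down order_trans in fastforce)+
  qed
  have "1 = (p + q) ^ N" by (simp add: q_def)
  also have "\<dots> = (\<Sum>i\<le>N. t i)" unfolding t_def by (rule binomial_ring)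
  also have "\<dots> \<le> (\<Sum>i\<le>N. t w)" using le_w by (intro sum_mono) simp
  also have "\<dots> = (real N + 1) * t w" by simp
  finally show ?thesis by (simp add: t_def p_def q_def)
qed

section \<open>Generating functions of words and of even socket patterns\<close>

lemma sum_Pow_power:
  fixes z :: real
  assumes "finite B"
  shows "(\<Sum>W\<in>Pow B. z ^ card W) = (1 + z) ^ card B"
  using prod_add[OF assms, of "\<lambda>_. z" "\<lambda>_. 1"] by (simp add: add.commute)

definition even_enum :: "nat \<Rightarrow> real \<Rightarrow> real" where
  "even_enum r z = ((1 + z) ^ r + (1 - z) ^ r) / 2"

lemma sum_even_power:
  fixes z :: real
  assumes "finite B"
  shows "(\<Sum>W | W \<subseteq> B \<and> even (card W). z ^ card W) = even_enum (card B) z"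
proof -
  have "(\<Sum>W | W \<subseteq> B \<and> even (card W). z ^ card W) = (\<Sum>W\<in>Pow B. if even (card W) then z ^ card W else 0)"
    using assms by (subst sum.inter_filter[symmetric]) (auto intro: sum.cong)
  also have "\<dots> = (\<Sum>W\<in>Pow B. (z ^ card W + (- z) ^ card W) / 2)"
    by (rule sum.cong) auto
  also have "\<dots> = even_enum (card B) z"
    unfolding sum_divide_distrib[symmetric] sum.distrib sum_Pow_power[OF assms] by (simp add: even_enum_def)
  finally show ?thesis .
qed

definition evens :: "('c \<times> 'j) set \<Rightarrow> nat \<Rightarrow> ('c \<times> 'j) set set" where
  "evens T w = {W \<in> ksubsets T w. \<forall>c. even (deg W c)}"

lemma finite_evens [simp]: "finite T \<Longrightarrow> finite (evens T w)"
  by (simp add: evens_def)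

lemma card_evens_le: "finite T \<Longrightarrow> card (evens T w) \<le> card T choose w"
  unfolding card_ksubsets[symmetric] evens_def by (intro card_mono) auto

text \<open>For positive \<open>z\<close> a single term of a polynomial with nonnegative
  coefficients is at most its value. The polynomial is a product over the checks, since a socket set
  is determined by its traces on them and these can be chosen independently.\<close>

lemma card_evens_bound:
  fixes z :: real
  assumes T: "finite T" and z: "0 < z"
  shows "real (card (evens T w)) * z ^ w \<le> (\<Prod>c\<in>fst ` T. even_enum (deg T c) z)"
proof -
  let ?B = "\<lambda>c. {t\<in>T. fst t = c}" and ?C = "fst ` T"
  let ?F = "\<lambda>c. {W. W \<subseteq> ?B c \<and> even (card W)}"
  let ?h = "\<lambda>W. \<lambda>c\<in>?C. W \<inter> ?B c"
  have fB: "finite (?B c)" for c using T by simp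
  have fF: "finite (?F c)" for c by (rule finite_subset[of _ "Pow (?B c)"]) (use fB in auto)
  have inj: "inj_on ?h (evens T w)"
  proof (rule inj_onI)
    fix W W' assume W: "W \<in> evens T w" "W' \<in> evens T w" and eq: "?h W = ?h W'"
    have "W \<inter> ?B c = W' \<inter> ?B c" if "c \<in> ?C" for c using fun_cong[OF eq, of c] that by (simp only: restrict_apply if_True)
    moreover have "W \<subseteq> T" "W' \<subseteq> T" using W by (auto simp: evens_def ksubsets_def)
    ultimately show "W = W'" by blast
  qed
  have img: "?h ` evens T w \<subseteq> Pi\<^sub>E ?C ?F"
  proof clarify
    fix W assume W: "W \<in> evens T w"
    have "even (card (W \<inter> ?B c))" for c
    proof -
      have "W \<subseteq> T" using W by (auto simp: evens_def ksubsets_def)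
      then have "deg W c = card (W \<inter> ?B c)" by (rule deg_inter)
      moreover have "even (deg W c)" using W by (simp add: evens_def)
      ultimately show ?thesis by (simp only:)
    qed
    then show "?h W \<in> Pi\<^sub>E ?C ?F" by auto
  qed
  have val: "z ^ w = (\<Prod>c\<in>?C. z ^ card (?h W c))" if W: "W \<in> evens T w" for W
  proof -
    have WT: "W \<subseteq> T" "card W = w" "finite W" using W T finite_subset by (auto simp: evens_def ksubsets_def)
    have "w = (\<Sum>c\<in>?C. deg W c)"
      using sum.group[OF WT(3), of ?C fst "\<lambda>_. 1::nat"] WT T image_mono[OF WT(1), of fst] by (simp add: deg_def)
    also have "\<dots> = (\<Sum>c\<in>?C. card (?h W c))"
      using deg_inter[OF WT(1)] by (intro sum.cong) auto
    finally show ?thesis by (simp add: power_sum)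
  qed
  have "real (card (evens T w)) * z ^ w = (\<Sum>W\<in>evens T w. z ^ w)" by simp
  also have "\<dots> = (\<Sum>W\<in>evens T w. \<Prod>c\<in>?C. z ^ card (?h W c))"
    by (rule sum.cong[OF refl val])
  also have "\<dots> = (\<Sum>f\<in>?h ` evens T w. \<Prod>c\<in>?C. z ^ card (f c))"
    by (subst sum.reindex[OF inj]) simp
  also have "\<dots> \<le> (\<Sum>f\<in>Pi\<^sub>E ?C ?F. \<Prod>c\<in>?C. z ^ card (f c))"
    using img T fF z by (intro sum_mono2 finite_PiE) (auto intro!: prod_nonneg)
  also have "\<dots> = (\<Prod>c\<in>?C. \<Sum>W\<in>?F c. z ^ card W)"
    using T fF by (subst prod_sum_PiE) auto
  also have "\<dots> = (\<Prod>c\<in>?C. even_enum (deg T c) z)"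
    using sum_even_power[OF fB] by (intro prod.cong) (auto simp: deg_def)
  finally show ?thesis .
qed

definition lift :: "('v \<times> 'i) set \<Rightarrow> 'v set \<Rightarrow> ('v \<times> 'i) set" where
  "lift S X = {s\<in>S. fst s \<in> X}"

text \<open>The same coefficient bound on the variable side, where a node contributes all of its
  sockets or none.\<close>

lemma card_lift_bound:
  fixes u :: real
  assumes S: "finite S" and u: "0 < u"
  shows "real (card {X\<in>Pow (fst ` S). card (lift S X) = w}) * u ^ w \<le> (\<Prod>v\<in>fst ` S. 1 + u ^ deg S v)"
proof -
  have c: "card (lift S X) = (\<Sum>v\<in>X. deg S v)" if "X \<subseteq> fst ` S" for X
  proof -
    have fX: "finite X" "finite (lift S X)" using that S finite_subset by (auto simp: lift_def)
    have "(\<Sum>v\<in>X. \<Sum>s | s \<in> lift S X \<and> fst s = v. 1::nat) = (\<Sum>s\<in>lift S X. 1)"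
      using fX by (intro sum.group) (auto simp: lift_def)
    moreover have "{s. s \<in> lift S X \<and> fst s = v} = {s\<in>S. fst s = v}" if "v \<in> X" for v
      using that by (auto simp: lift_def)
    ultimately show ?thesis by (simp add: deg_def)
  qed
  have "real (card {X\<in>Pow (fst ` S). card (lift S X) = w}) * u ^ w =
     (\<Sum>X\<in>{X\<in>Pow (fst ` S). card (lift S X) = w}. u ^ card (lift S X))"
    by simp
  also have "\<dots> \<le> (\<Sum>X\<in>Pow (fst ` S). u ^ card (lift S X))"
    using S u by (intro sum_mono2) auto
  also have "\<dots> = (\<Sum>X\<in>Pow (fst ` S). (\<Prod>v\<in>X. u ^ deg S v) * (\<Prod>v\<in>fst ` S - X. 1))"
    using c by (intro sum.cong) (auto simp: power_sum)
  also have "\<dots> = (\<Prod>v\<in>fst ` S. u ^ deg S v + 1)"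
    using S by (intro prod_add[symmetric]) auto
  finally show ?thesis by (simp add: add.commute)
qed

text \<open>The sockets of \<open>X\<close> land on a uniform subset of \<open>T\<close>, so the
  probability depends on \<open>X\<close> only through its number of sockets.\<close>

lemma avg_mem_kern:
  assumes S: "finite S" "finite T" "card S = card T" and X: "X \<subseteq> fst ` S"
  shows "avg (bijs S T) (\<lambda>\<sigma>. of_bool (X \<in> kern S \<sigma>)) =
     real (card (evens T (card (lift S X)))) / real (card T choose card (lift S X))"
proof -
  let ?L = "lift S X"
  have L: "?L \<subseteq> S" "finite ?L" using S by (auto simp: lift_def)
  have "avg (bijs S T) (\<lambda>\<sigma>. of_bool (X \<in> kern S \<sigma>)) =
        avg (bijs S T) (\<lambda>\<sigma>. of_bool (\<forall>c. even (deg (restrict \<sigma> ?L ` ?L) c)))"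
  proof (rule avg_cong)
    fix \<sigma> assume "\<sigma> \<in> bijs S T"
    then have inj: "inj_on \<sigma> S" by (auto simp: bijs_def bij_betw_def)
    have "card {s\<in>S. fst (\<sigma> s) = c \<and> fst s \<in> X} = deg (restrict \<sigma> ?L ` ?L) c" for c
    proof -
      have "{t \<in> restrict \<sigma> ?L ` ?L. fst t = c} = \<sigma> ` {s\<in>S. fst (\<sigma> s) = c \<and> fst s \<in> X}"
        by (auto simp: lift_def)
      moreover have "inj_on \<sigma> {s\<in>S. fst (\<sigma> s) = c \<and> fst s \<in> X}"
        using inj by (rule inj_on_subset) auto
      ultimately show ?thesis unfolding deg_def by (simp add: card_image)
    qed
    then show "of_bool (X \<in> kern S \<sigma>) = (of_bool (\<forall>c. even (deg (restrict \<sigma> ?L ` ?L) c)) :: real)"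
      using X by (simp add: kern_def)
  qed
  also have "\<dots> = avg (ksubsets T (card ?L)) (\<lambda>B. avg (bijs ?L B) (\<lambda>\<sigma>. of_bool (\<forall>c. even (deg (\<sigma> ` ?L) c))))"
    by (rule avg_bijs_image[OF S L(1)])
  also have "\<dots> = avg (ksubsets T (card ?L)) (\<lambda>B. of_bool (\<forall>c. even (deg B c)))"
  proof (rule avg_cong)
    fix B assume "B \<in> ksubsets T (card ?L)"
    then have B: "finite B" "card ?L = card B" using S finite_subset by (auto simp: ksubsets_def)
    have "avg (bijs ?L B) (\<lambda>\<sigma>. of_bool (\<forall>c. even (deg (\<sigma> ` ?L) c))) =
          avg (bijs ?L B) (\<lambda>\<sigma>. of_bool (\<forall>c. even (deg B c)))"
      by (rule avg_cong) (auto simp: bijs_def bij_betw_def)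
    also have "\<dots> = of_bool (\<forall>c. even (deg B c))"
      using card_bijs[OF L(2) B] by (simp add: avg_def)
    finally show "avg (bijs ?L B) (\<lambda>\<sigma>. of_bool (\<forall>c. even (deg (\<sigma> ` ?L) c))) = of_bool (\<forall>c. even (deg B c))" .
  qed
  also have "\<dots> = real (card (evens T (card ?L))) / real (card T choose card ?L)"
    using S by (simp add: avg_def card_ksubsets evens_def of_bool_def sum.If_cases Int_def)
  finally show ?thesis .
qed

definition weight_enum :: "('v \<times> 'i) set \<Rightarrow> ('c \<times> 'j) set \<Rightarrow> real \<Rightarrow> real \<Rightarrow> real" where
  "weight_enum S T u v = (\<Prod>x\<in>fst ` S. 1 + u ^ deg S x) * (\<Prod>c\<in>fst ` T. even_enum (deg T c) v)"

text \<open>The condition on \<open>u v\<close> means \<open>u v = \<omega> / (1 - \<omega>)\<close> for \<open>\<omega> = w / N\<close>: then \<open>u\<^sup>-\<^sup>w v\<^sup>-\<^sup>w\<close> cancels against the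
  bound \<open>(N + 1) \<omega>\<^sup>w (1 - \<omega>)\<^sup>N\<^sup>-\<^sup>w\<close> for the inverse binomial coefficient up to \<open>(1 + u v)\<^sup>-\<^sup>N\<close>.\<close>
lemma avg_card_kern_le:
  assumes S: "finite S" "finite T" "card S = card T" "0 < card S" and R: "1 \<le> R"
    and uv: "\<And>w. 0 < w \<Longrightarrow> w < card S \<Longrightarrow> \<exists>u v. 0 < u \<and> 0 < v \<and> u * v * real (card S - w) = real w \<and>
       weight_enum S T u v \<le> R * (1 + u * v) ^ card S"
  shows "avg (bijs S T) (\<lambda>\<sigma>. real (card (kern S \<sigma>))) \<le> (real (card S) + 2)\<^sup>2 * R"
proof -
  let ?N = "card S"
  define A where "A w = card {X\<in>Pow (fst ` S). card (lift S X) = w}" for w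
  have lift_le: "card (lift S X) \<le> ?N" for X using S by (intro card_mono) (auto simp: lift_def)
  have "avg (bijs S T) (\<lambda>\<sigma>. real (card (kern S \<sigma>))) =
        avg (bijs S T) (\<lambda>\<sigma>. \<Sum>X\<in>Pow (fst ` S). of_bool (X \<in> kern S \<sigma>))"
  proof (rule avg_cong)
    fix \<sigma>
    have "kern S \<sigma> = {X \<in> Pow (fst ` S). X \<in> kern S \<sigma>}" by (auto simp: kern_def)
    then have "card (kern S \<sigma>) = card {X \<in> Pow (fst ` S). X \<in> kern S \<sigma>}" by simp
    then show "real (card (kern S \<sigma>)) = (\<Sum>X\<in>Pow (fst ` S). of_bool (X \<in> kern S \<sigma>))"
      using S by (simp add: of_bool_def sum.If_cases Int_def)
  qed
  also have "\<dots> = (\<Sum>X\<in>Pow (fst ` S). avg (bijs S T) (\<lambda>\<sigma>. of_bool (X \<in> kern S \<sigma>)))"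
    unfolding avg_def by (subst sum.swap) (simp add: sum_divide_distrib)
  also have "\<dots> = (\<Sum>X\<in>Pow (fst ` S). real (card (evens T (card (lift S X)))) / real (?N choose card (lift S X)))"
    using S by (intro sum.cong) (auto simp: avg_mem_kern)
  also have "\<dots> = (\<Sum>w\<le>?N. \<Sum>X | X \<in> Pow (fst ` S) \<and> card (lift S X) = w.
       real (card (evens T (card (lift S X)))) / real (?N choose card (lift S X)))"
    using S lift_le by (intro sum.group[symmetric]) auto
  also have "\<dots> = (\<Sum>w\<le>?N. real (A w) * (real (card (evens T w)) / real (?N choose w)))"
    by (intro sum.cong refl) (simp add: A_def)
  \<comment> \<open>The extreme weights admit no positive finite \<open>u * v\<close> satisfying the
    saddle equation. Only the empty word and the full word have these weights, so they are counted
    directly.\<close>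
  also have "\<dots> \<le> (\<Sum>w\<le>?N. if w = 0 \<or> w = ?N then 1 else (real ?N + 1) * R)"
  proof (rule sum_mono)
    fix w assume w: "w \<in> {..?N}"
    show "real (A w) * (real (card (evens T w)) / real (?N choose w)) \<le> (if w = 0 \<or> w = ?N then 1 else (real ?N + 1) * R)"
    proof (cases "w = 0 \<or> w = ?N")
      case True
      have "A w \<le> card {if w = 0 then {} else fst ` S}"
        unfolding A_def
      proof (rule card_mono)
        show "{X \<in> Pow (fst ` S). card (lift S X) = w} \<subseteq> {if w = 0 then {} else fst ` S}"
        proof clarify
          fix X assume X: "X \<subseteq> fst ` S" and w': "w = card (lift S X)"
          show "X = (if card (lift S X) = 0 then {} else fst ` S)"
          proof (cases "card (lift S X) = 0")
            case True
            then have "lift S X = {}" using S by (simp add: lift_def)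
            then show ?thesis using X True by (force simp: lift_def)
          next
            case False
            then have "card (lift S X) = card S" using \<open>w = 0 \<or> w = ?N\<close> w' by auto
            then have "lift S X = S" using S by (intro card_subset_eq) (auto simp: lift_def)
            then have "fst ` S \<subseteq> X" by (force simp: lift_def)
            then show ?thesis using X False by auto
          qed
        qed
      qed simp
      then have "real (A w) \<le> 1" by simp
      moreover have "real (card (evens T w)) / real (?N choose w) \<le> 1"
        using card_evens_le[OF S(2), of w] S w by (simp add: divide_le_eq)
      ultimately have "real (A w) * (real (card (evens T w)) / real (?N choose w)) \<le> 1 * 1"
        by (intro mult_mono) auto
      then show ?thesis using True by simp
    next
      case False
      then have w': "0 < w" "w < ?N" using w by auto
      then obtain u v where uv': "0 < u" "0 < v" "u * v * real (?N - w) = real w"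
        and bd: "weight_enum S T u v \<le> R * (1 + u * v) ^ ?N"
        using uv by blast
      define q where "q = 1 - real w / ?N"
      have q: "0 < q" "q * (1 + u * v) = 1" "real w / ?N = u * v * q"
        using w' uv' by (auto simp: q_def field_simps of_nat_diff)
      have q4: "1 - u * v * q = q" using q(2) by (simp add: algebra_simps)
      have bin: "1 / real (?N choose w) \<le> (real ?N + 1) * ((u * v * q) ^ w * q ^ (?N - w))"
        using binomial_mode[OF w'] w' unfolding q(3) q4 by (simp add: divide_le_eq mult_ac)
      have "real (A w) * (real (card (evens T w)) / real (?N choose w)) =
         (real (A w) * real (card (evens T w))) * (1 / real (?N choose w))" by simp
      also have "\<dots> \<le> (real (A w) * real (card (evens T w))) * ((real ?N + 1) * ((u * v * q) ^ w * q ^ (?N - w)))"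
        by (intro mult_left_mono bin) auto
      also have "(u * v * q) ^ w * q ^ (?N - w) = u ^ w * v ^ w * q ^ ?N"
      proof -
        have "q ^ ?N = q ^ w * q ^ (?N - w)" using w' by (metis le_add_diff_inverse less_imp_le power_add)
        then show ?thesis by (simp add: power_mult_distrib)
      qed
      also have "(real (A w) * real (card (evens T w))) * ((real ?N + 1) * (u ^ w * v ^ w * q ^ ?N)) =
         (real ?N + 1) * (((real (A w) * u ^ w) * (real (card (evens T w)) * v ^ w)) * q ^ ?N)"
        by (simp add: mult_ac)
      also have "\<dots> \<le> (real ?N + 1) * (weight_enum S T u v * q ^ ?N)"
        using card_lift_bound[OF S(1) uv'(1), of w] card_evens_bound[OF S(2) uv'(2), of w] q uv'
        by (intro mult_left_mono mult_right_mono mult_mono) (auto simp: A_def weight_enum_def intro!: prod_nonneg mult_mono)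
      also have "\<dots> \<le> (real ?N + 1) * ((R * (1 + u * v) ^ ?N) * q ^ ?N)"
        using bd q by (intro mult_left_mono mult_right_mono) auto
      also have "\<dots> = (real ?N + 1) * (R * ((q * (1 + u * v)) ^ ?N))" by (simp add: power_mult_distrib)
      also have "\<dots> = (real ?N + 1) * R" unfolding q(2) by simp
      finally show ?thesis using False by simp
    qed
  qed
  also have "\<dots> \<le> (\<Sum>w\<le>?N. (real ?N + 1) * R)"
  proof (rule sum_mono)
    have "1 * 1 \<le> (real ?N + 1) * R" using R by (intro mult_mono) auto
    then show "(if w = 0 \<or> w = ?N then 1 else (real ?N + 1) * R) \<le> (real ?N + 1) * R" for w by simp
  qed
  also have "\<dots> = (real ?N + 1)\<^sup>2 * R" by (simp add: power2_eq_square)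
  also have "\<dots> \<le> (real ?N + 2)\<^sup>2 * R" using R by (intro mult_right_mono power_mono) auto
  finally show ?thesis .
qed

text \<open>Jensen's inequality through the tangent line \<open>ln z \<le> z - 1\<close> at
  \<open>z = k \<sigma> / m\<close>: the linear correction averages to zero.\<close>

lemma lent_le_log_avg:
  assumes S: "finite S" "finite T" "card S = card T"
  shows "lent S T \<le> log 2 (avg (bijs S T) (\<lambda>\<sigma>. real (card (kern S \<sigma>))))"
proof -
  let ?K = "bijs S T"
  define k where "k \<sigma> = real (card (kern S \<sigma>))" for \<sigma> :: "'a \<times> 'b \<Rightarrow> 'c \<times> 'd"
  define m where "m = avg ?K k"
  have K: "finite ?K" "0 < card ?K" using S by (auto simp: card_bijs)
  have k0: "0 < k \<sigma>" for \<sigma> using card_kern_pos[OF S(1)] by (simp add: k_def)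
  have m0: "0 < m" unfolding m_def avg_def using K k0 by (intro divide_pos_pos sum_pos) auto
  have "log 2 (k \<sigma>) \<le> log 2 m + (k \<sigma> / m - 1) / ln 2" for \<sigma>
  proof -
    have "log 2 (k \<sigma>) = log 2 m + ln (k \<sigma> / m) / ln 2"
      using k0[of \<sigma>] m0 by (simp add: log_def ln_div diff_divide_distrib)
    also have "\<dots> \<le> log 2 m + (k \<sigma> / m - 1) / ln 2"
      using k0[of \<sigma>] m0 by (intro add_left_mono divide_right_mono ln_le_minus_one) auto
    finally show ?thesis .
  qed
  then have "(\<Sum>\<sigma>\<in>?K. log 2 (k \<sigma>)) \<le> (\<Sum>\<sigma>\<in>?K. log 2 m + (k \<sigma> / m - 1) / ln 2)" by (intro sum_mono)
  also have "\<dots> = card ?K * log 2 m + ((\<Sum>\<sigma>\<in>?K. k \<sigma>) / m - card ?K) / ln 2"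
    by (simp add: sum.distrib sum_divide_distrib[symmetric] sum_subtractf)
  also have "(\<Sum>\<sigma>\<in>?K. k \<sigma>) = m * card ?K" using K by (simp add: m_def avg_def)
  finally have "(\<Sum>\<sigma>\<in>?K. log 2 (k \<sigma>)) \<le> card ?K * log 2 m" using m0 by simp
  then have "(\<Sum>\<sigma>\<in>?K. log 2 (k \<sigma>)) / card ?K \<le> log 2 m" using K by (simp add: divide_le_eq mult.commute)
  then show ?thesis unfolding lent_def m_def k_def avg_def .
qed

section \<open>The entropy at a fixed point of the profile\<close>

lemma log2_prod:
  fixes f :: "'a \<Rightarrow> real"
  assumes "\<And>i. i \<in> I \<Longrightarrow> 0 < f i"
  shows "log 2 (\<Prod>i\<in>I. f i) = (\<Sum>i\<in>I. log 2 (f i))"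
  using assms
proof (induction I rule: infinite_finite_induct)
  case (insert x F)
  then have "0 < prod f F" by (intro prod_pos) auto
  moreover have "0 < f x" using insert by auto
  ultimately have "log 2 (f x * prod f F) = log 2 (f x) + log 2 (prod f F)"
    by (intro log_mult_pos)
  then show ?case using insert by simp
qed auto

text \<open>The exponent is split into an edge term, a variable term and a check term, normalised so
  that both node terms are nonpositive. \<open>Psi\<close> contains \<open>var_loss - 1\<close> and
  \<open>chk_loss + 1\<close>; these shifts add up to the number of checks minus the number of
  variables.\<close>

definition gain :: "real \<Rightarrow> real \<Rightarrow> real" where
  "gain u v = log 2 ((1 + u) * (1 + v) / (1 + u * v))"

definition var_loss :: "real \<Rightarrow> nat \<Rightarrow> real" where
  "var_loss u l = log 2 ((1 + u ^ l) / (1 + u) ^ l)"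

definition chk_loss :: "real \<Rightarrow> nat \<Rightarrow> real" where
  "chk_loss v r = log 2 ((1 + ((1 - v) / (1 + v)) ^ r) / 2)"

lemma tanh_like_bounds:
  fixes v :: real
  assumes "0 < v"
  shows "\<bar>(1 - v) / (1 + v)\<bar> < 1"
  using assms by (auto simp: abs_less_iff divide_simps)

lemma one_plus_power_bounds:
  fixes v :: real
  assumes "0 < v" "1 \<le> r"
  shows "0 < 1 + ((1 - v) / (1 + v)) ^ r" "((1 - v) / (1 + v)) ^ r \<le> 1"
proof -
  have "\<bar>((1 - v) / (1 + v)) ^ r\<bar> < 1"
    unfolding power_abs using tanh_like_bounds[OF assms(1)] assms(2)
    by (intro power_less_one_iff[THEN iffD2]) auto
  then show "0 < 1 + ((1 - v) / (1 + v)) ^ r" "((1 - v) / (1 + v)) ^ r \<le> 1" by auto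
qed

lemma chk_loss_le: "0 < v \<Longrightarrow> 1 \<le> r \<Longrightarrow> chk_loss v r \<le> 0"
  unfolding chk_loss_def using one_plus_power_bounds[of v r] by (subst log_le_zero_cancel_iff) auto

lemma one_plus_power_le:
  fixes u :: real
  assumes "0 \<le> u"
  shows "1 \<le> l \<Longrightarrow> 1 + u ^ l \<le> (1 + u) ^ l"
proof (induction l rule: dec_induct)
  case (step l)
  note Suc = step assms
  have "1 + u ^ Suc l \<le> (1 + u ^ l) * (1 + u)" using Suc by (simp add: algebra_simps)
  also have "\<dots> \<le> (1 + u) ^ l * (1 + u)" using Suc by (intro mult_right_mono) auto
  finally show ?case by (simp add: mult.commute)
qed auto

lemma var_loss_le: "0 < u \<Longrightarrow> 1 \<le> l \<Longrightarrow> var_loss u l \<le> 0"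
  unfolding var_loss_def using one_plus_power_le[of u l]
  by (subst log_le_zero_cancel_iff) (auto simp: divide_le_eq add_pos_pos)

text \<open>The upper bound is the sign condition itself, because
  \<open>2 * (1 + u * v) - (1 + u) * (1 + v) = (1 - u) * (1 - v)\<close>.\<close>

lemma gain_bounds:
  assumes "0 < u" "0 < v" "0 \<le> (1 - u) * (1 - v)"
  shows "0 \<le> gain u v" "gain u v \<le> 1"
proof -
  have p: "0 < 1 + u * v" using assms by (simp add: add_pos_pos)
  have "1 \<le> (1 + u) * (1 + v) / (1 + u * v)" using assms p by (simp add: le_divide_eq algebra_simps)
  then show "0 \<le> gain u v" unfolding gain_def by simp
  have "(1 + u) * (1 + v) / (1 + u * v) \<le> 2" using assms p by (simp add: divide_le_eq algebra_simps)
  then show "gain u v \<le> 1" unfolding gain_def using assms p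
    by (subst log_le_iff) (auto simp: add_pos_pos)
qed

text \<open>Factors \<open>(1 + u) ^ l\<close> and \<open>(1 + v) ^ r\<close> are pulled out of the
  node terms. On either side the degrees add up to \<open>card S\<close>, so these factors collect
  in the edge term \<open>gain\<close>.\<close>

lemma log_first_moment:
  assumes S: "finite S" "finite T" "card S = card T" and D: "\<And>v. deg S v \<le> D" "\<And>v. deg T v \<le> D"
    and u: "0 < u" and v: "0 < v"
  shows "log 2 (weight_enum S T u v / (1 + u * v) ^ card S) =
     card S * gain u v + (\<Sum>l=1..D. real (num S l) * var_loss u l) + (\<Sum>r=1..D. real (num T r) * chk_loss v r)"
    and "0 < weight_enum S T u v / (1 + u * v) ^ card S"
proof -
  have v1: "0 < 1 + u * v" "0 < 1 + u" "0 < 1 + v" using u v by (auto simp: add_pos_pos)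
  have dT: "1 \<le> deg T c" if "c \<in> fst ` T" for c using that deg_pos_iff[OF S(2), of c] by linarith
  have ee: "even_enum r v = (1 + ((1 - v) / (1 + v)) ^ r) / 2 * (1 + v) ^ r" for r
    using v1 by (simp add: even_enum_def power_divide field_simps)
  have ee0: "0 < even_enum r v" if "1 \<le> r" for r
    unfolding ee using one_plus_power_bounds[OF v that] v1 by simp
  have p1: "0 < (\<Prod>x\<in>fst ` S. 1 + u ^ deg S x)" using u by (intro prod_pos) (auto simp: add_pos_pos)
  have p2: "0 < (\<Prod>c\<in>fst ` T. even_enum (deg T c) v)" using dT ee0 by (intro prod_pos) auto
  show "0 < weight_enum S T u v / (1 + u * v) ^ card S"
    using p1 p2 v1 by (simp add: weight_enum_def)
  have "log 2 (\<Prod>x\<in>fst ` S. 1 + u ^ deg S x) = (\<Sum>x\<in>fst ` S. log 2 (1 + u ^ deg S x))"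
    using u by (intro log2_prod) (auto simp: add_pos_pos)
  also have "\<dots> = (\<Sum>l=1..D. real (num S l) * log 2 (1 + u ^ l))"
    using sum_by_deg[OF S(1) D(1), of "\<lambda>l. log 2 (1 + u ^ l)"] .
  also have "\<dots> = (\<Sum>l=1..D. real (num S l) * var_loss u l + (real (num S l) * real l) * log 2 (1 + u))"
  proof (rule sum.cong[OF refl])
    fix l
    have "0 < 1 + u ^ l" using u by (simp add: add_pos_pos)
    then have "log 2 (1 + u ^ l) = var_loss u l + real l * log 2 (1 + u)"
      unfolding var_loss_def using v1 by (simp add: log_divide log_nat_power)
    then show "real (num S l) * log 2 (1 + u ^ l) = real (num S l) * var_loss u l + (real (num S l) * real l) * log 2 (1 + u)"
      by (simp add: algebra_simps)
  qed
  also have "\<dots> = (\<Sum>l=1..D. real (num S l) * var_loss u l) + card S * log 2 (1 + u)"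
    using card_eq_sum_num[OF S(1) D(1)] by (simp add: sum.distrib sum_distrib_right)
  finally have l1: "log 2 (\<Prod>x\<in>fst ` S. 1 + u ^ deg S x) =
     (\<Sum>l=1..D. real (num S l) * var_loss u l) + card S * log 2 (1 + u)" .
  have "log 2 (\<Prod>c\<in>fst ` T. even_enum (deg T c) v) = (\<Sum>c\<in>fst ` T. log 2 (even_enum (deg T c) v))"
    using dT ee0 by (intro log2_prod) auto
  also have "\<dots> = (\<Sum>r=1..D. real (num T r) * log 2 (even_enum r v))"
    using sum_by_deg[OF S(2) D(2), of "\<lambda>r. log 2 (even_enum r v)"] .
  also have "\<dots> = (\<Sum>r=1..D. real (num T r) * chk_loss v r + (real (num T r) * real r) * log 2 (1 + v))"
  proof (rule sum.cong[OF refl])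
    fix r assume "r \<in> {1..D}"
    then have "0 < (1 + ((1 - v) / (1 + v)) ^ r) / 2" using one_plus_power_bounds[OF v] by simp
    then have "log 2 (even_enum r v) = chk_loss v r + real r * log 2 (1 + v)"
      unfolding chk_loss_def ee using v1 by (subst log_mult) (auto simp: log_nat_power)
    then show "real (num T r) * log 2 (even_enum r v) = real (num T r) * chk_loss v r + (real (num T r) * real r) * log 2 (1 + v)"
      by (simp add: algebra_simps)
  qed
  also have "\<dots> = (\<Sum>r=1..D. real (num T r) * chk_loss v r) + card S * log 2 (1 + v)"
    using card_eq_sum_num[OF S(2) D(2)] S(3) by (simp add: sum.distrib sum_distrib_right)
  finally have l2: "log 2 (\<Prod>c\<in>fst ` T. even_enum (deg T c) v) =
     (\<Sum>r=1..D. real (num T r) * chk_loss v r) + card S * log 2 (1 + v)" .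
  have "gain u v = log 2 (1 + u) + log 2 (1 + v) - log 2 (1 + u * v)"
    unfolding gain_def using v1 by (simp add: log_divide log_mult)
  then have "real (card S) * gain u v = card S * log 2 (1 + u) + card S * log 2 (1 + v) - card S * log 2 (1 + u * v)"
    by (simp only: distrib_left right_diff_distrib)
  then show "log 2 (weight_enum S T u v / (1 + u * v) ^ card S) =
     card S * gain u v + (\<Sum>l=1..D. real (num S l) * var_loss u l) + (\<Sum>r=1..D. real (num T r) * chk_loss v r)"
    using p1 p2 v1 l1 l2 by (simp add: weight_enum_def log_divide log_mult log_nat_power)
qed

text \<open>The function v(u) of \<open>Psi\<close> with unnormalised edge weights
  \<open>a l * l\<close>; the normalisation cancels in the quotient.\<close>

definition vfun :: "nat \<Rightarrow> (nat \<Rightarrow> real) \<Rightarrow> real \<Rightarrow> real" where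
  "vfun D a u = (\<Sum>l=1..D. a l * real l * u ^ (l - 1) / (1 + u ^ l)) / (\<Sum>l=1..D. a l * real l / (1 + u ^ l))"

text \<open>\<open>u\<close> times the numerator of \<open>vfun\<close> is \<open>f u\<close>, and
  its denominator is \<open>E - f u\<close>, so the equation says \<open>f u = \<omega> * E\<close>
  and the intermediate value theorem applies. Each \<open>u ^ (l - 1)\<close> lies weakly on the
  same side of 1 as \<open>u\<close>; therefore so does \<open>vfun D a u\<close>, which is the sign
  condition of \<open>gain_bounds\<close>.\<close>

lemma saddle_point_exists:
  fixes a :: "nat \<Rightarrow> real"
  assumes a0: "\<And>l. 0 \<le> a l" and E: "0 < (\<Sum>l=1..D. a l * real l)" and \<omega>: "0 < \<omega>" "\<omega> < 1"
  obtains u where "0 < u" "0 < vfun D a u" "u * vfun D a u * (1 - \<omega>) = \<omega>"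
    "0 \<le> (1 - u) * (1 - vfun D a u)"
proof -
  define E where "E = (\<Sum>l=1..D. a l * real l)"
  define f where "f u = (\<Sum>l=1..D. a l * real l * (u ^ l / (1 + u ^ l)))" for u :: real
  \<comment> \<open>\<open>U \<ge> 1\<close> gives \<open>U \<le> U ^ l\<close>, and
    \<open>U \<ge> \<omega> / (1 - \<omega>)\<close> gives
    \<open>\<omega> \<le> U / (1 + U)\<close>; together they yield
    \<open>\<omega> * E \<le> f U\<close>.\<close>
  define U where "U = max 1 (\<omega> / (1 - \<omega>))"
  have E0: "0 < E" using E by (simp add: E_def)
  have f0: "f 0 \<le> \<omega> * E"
  proof -
    have "f 0 = 0" unfolding f_def by (intro sum.neutral) auto
    then show ?thesis using \<omega> E0 by simp
  qed
  have fU: "\<omega> * E \<le> f U"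
  proof -
    have U: "1 \<le> U" "\<omega> / (1 - \<omega>) \<le> U" by (auto simp: U_def)
    have "\<omega> \<le> U * (1 - \<omega>)" using U(2) \<omega> by (simp add: divide_le_eq)
    then have "\<omega> * (1 + U) \<le> U" by (simp add: algebra_simps)
    then have oU: "\<omega> \<le> U / (1 + U)" using U by (simp add: le_divide_eq)
    have "(\<Sum>l=1..D. a l * real l * \<omega>) \<le> f U" unfolding f_def
    proof (intro sum_mono mult_left_mono)
      fix l assume "l \<in> {1..D}"
      then have "U \<le> U ^ l" using U self_le_power[of U l] by simp
      then have "U / (1 + U) \<le> U ^ l / (1 + U ^ l)" using U by (simp add: divide_simps add_pos_pos) (simp add: algebra_simps)
      then show "\<omega> \<le> U ^ l / (1 + U ^ l)" using oU by simp
    qed (use a0 in simp)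
    then show ?thesis by (simp add: E_def sum_distrib_left mult.commute)
  qed
  have cont: "continuous_on {0..U} f" unfolding f_def
    by (intro continuous_intros) (auto simp: add_nonneg_eq_0_iff)
  have "0 \<le> U" by (simp add: U_def)
  then obtain u where u: "0 \<le> u" "f u = \<omega> * E"
    using IVT'[of f 0 "\<omega> * E" U] f0 fU cont by auto
  have u0: "0 < u"
  proof (rule ccontr)
    assume "\<not> 0 < u"
    then have "u = 0" using u by simp
    then have "f u = 0" unfolding f_def by (intro sum.neutral) auto
    then show False using u \<omega> E0 by simp
  qed
  define A where "A = (\<Sum>l=1..D. a l * real l * u ^ (l - 1) / (1 + u ^ l))"
  define B where "B = (\<Sum>l=1..D. a l * real l / (1 + u ^ l))"
  have pw: "0 < 1 + u ^ l" for l using u0 by (simp add: add_pos_pos)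
  have uA: "u * A = \<omega> * E"
  proof -
    have "u * A = f u" unfolding A_def f_def sum_distrib_left
    proof (rule sum.cong[OF refl])
      fix l assume "l \<in> {1..D}"
      then have "u ^ l = u * u ^ (l - 1)" by (simp add: power_eq_if)
      then show "u * (a l * real l * u ^ (l - 1) / (1 + u ^ l)) = a l * real l * (u ^ l / (1 + u ^ l))" by simp
    qed
    then show ?thesis using u by simp
  qed
  have BE: "B = (1 - \<omega>) * E"
  proof -
    have "B + f u = E" unfolding B_def f_def E_def sum.distrib[symmetric]
    proof (rule sum.cong[OF refl])
      fix l
      have "a l * real l / (1 + u ^ l) + a l * real l * (u ^ l / (1 + u ^ l)) = a l * real l * ((1 + u ^ l) / (1 + u ^ l))"
        by (simp only: distrib_left add_divide_distrib) simp
      then show "a l * real l / (1 + u ^ l) + a l * real l * (u ^ l / (1 + u ^ l)) = a l * real l"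
        using pw[of l] by simp
    qed
    then show ?thesis using u by (simp add: algebra_simps)
  qed
  have B0: "0 < B" using BE \<omega> E0 by simp
  have A0: "0 < A"
  proof -
    have "0 < u * A" using uA \<omega> E0 by simp
    then show ?thesis using u0 by (simp add: zero_less_mult_iff)
  qed
  have v: "vfun D a u = A / B" by (simp add: vfun_def A_def B_def)
  show ?thesis
  proof (rule that[OF u0])
    show "0 < vfun D a u" using A0 B0 v by simp
    have "u * vfun D a u * (1 - \<omega>) = (u * A) * (1 - \<omega>) / B" by (simp add: v)
    also have "\<dots> = \<omega> * E * (1 - \<omega>) / ((1 - \<omega>) * E)" by (simp only: uA BE)
    also have "\<dots> = \<omega>" using E0 \<omega> by simp
    finally show "u * vfun D a u * (1 - \<omega>) = \<omega>" .
    show "0 \<le> (1 - u) * (1 - vfun D a u)"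
    proof (cases "u \<le> 1")
      case True
      have "A \<le> B" unfolding A_def B_def
      proof (intro sum_mono divide_right_mono)
        fix l
        have "a l * real l * u ^ (l - 1) \<le> a l * real l * 1" using True u0 a0 by (intro mult_left_mono power_le_one) auto
        then show "a l * real l * u ^ (l - 1) \<le> a l * real l" by simp
      qed (use pw less_imp_le in blast)
      then have "vfun D a u \<le> 1" using B0 by (simp add: v)
      then show ?thesis using True by simp
    next
      case False
      have "B \<le> A" unfolding A_def B_def
      proof (intro sum_mono divide_right_mono)
        fix l
        have "a l * real l * 1 \<le> a l * real l * u ^ (l - 1)" using False u0 a0 by (intro mult_left_mono one_le_power) auto
        then show "a l * real l \<le> a l * real l * u ^ (l - 1)" by simp
      qed (use pw less_imp_le in blast)
      then have "1 \<le> vfun D a u" using B0 by (simp add: v)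
      then show ?thesis using False by (simp add: mult_nonpos_nonpos)
    qed
  qed
qed

lemma log2_le_sqrt: "1 \<le> x \<Longrightarrow> log 2 x \<le> 2 / ln 2 * sqrt x"
proof -
  assume x: "1 \<le> x"
  have "ln x = 2 * ln (sqrt x)" using x by (simp add: ln_sqrt)
  also have "\<dots> \<le> 2 * sqrt x" using ln_le_minus_one[of "sqrt x"] x by simp
  finally show ?thesis by (simp add: log_def divide_right_mono)
qed


lemma lent_ge:
  assumes S: "finite S" "finite T" "card S = card T"
  shows "real (card (fst ` S)) - real (card (fst ` T)) \<le> lent S T"
proof -
  let ?K = "bijs S T"
  have K: "finite ?K" "0 < card ?K" using S by (auto simp: card_bijs)
  have "real (card (fst ` S)) - real (card (fst ` T)) \<le> log 2 (card (kern S \<sigma>))" if \<sigma>: "\<sigma> \<in> ?K" for \<sigma>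
  proof -
    have k0: "0 < real (card (kern S \<sigma>))" using card_kern_pos[OF S(1)] by simp
    have "real (2 ^ card (fst ` S)) \<le> real (card (kern S \<sigma>) * 2 ^ card (fst ` T))"
      using card_kern_ge[OF S(1,2) \<sigma>] by (rule of_nat_mono)
    then have "2 ^ card (fst ` S) \<le> real (card (kern S \<sigma>)) * 2 ^ card (fst ` T)" by simp
    then have "log 2 (2 ^ card (fst ` S)) \<le> log 2 (real (card (kern S \<sigma>)) * 2 ^ card (fst ` T))"
      using k0 by (intro log_mono) auto
    then show ?thesis using k0 by (simp add: log_mult log_nat_power)
  qed
  then have "(\<Sum>\<sigma>\<in>?K. real (card (fst ` S)) - real (card (fst ` T))) \<le> (\<Sum>\<sigma>\<in>?K. log 2 (card (kern S \<sigma>)))"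
    by (rule sum_mono)
  then show ?thesis using K by (simp add: lent_def avg_def le_divide_eq mult.commute)
qed

text \<open>For odd \<open>r\<close> the check losses are unbounded as \<open>v \<rightarrow> \<infinity>\<close>. Since all losses are nonpositive,
  multiplicative lower bounds \<open>(1 - k) a\<^sub>l\<close> and \<open>(1 - k) c\<^sub>r\<close> on the profile still give a bound that is
  uniform in \<open>u\<close> and \<open>v\<close>.\<close>
lemma first_moment_exponent_le:
  fixes a c :: "nat \<Rightarrow> real"
  assumes S: "finite S" "finite T" "card S = card T" and D: "\<And>v. deg S v \<le> D" "\<And>v. deg T v \<le> D"
    and u: "0 < u" and v: "0 < v" "0 \<le> (1 - u) * (1 - v)"
    and n: "0 < n" and k: "0 \<le> k" "k \<le> 1" and E: "0 \<le> E" and P: "0 \<le> P"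
    and V: "\<And>l. l \<in> {1..D} \<Longrightarrow> (1 - k) * a l \<le> real (num S l) / n"
    and C: "\<And>r. r \<in> {2..D} \<Longrightarrow> (1 - k) * c r \<le> real (num T r) / n"
    and N: "real (card S) / n \<le> E + k"
    and H: "E * gain u v + (\<Sum>l=1..D. a l * var_loss u l) + (\<Sum>r=2..D. c r * chk_loss v r) \<le> P"
  shows "weight_enum S T u v
          \<le> 2 powr (n * (P + k * (E + 1))) * (1 + u * v) ^ card S"
proof -
  note lf = log_first_moment[OF S D u v(1)]
  note g = gain_bounds[OF u v]
  have "real (card S) * gain u v \<le> (n * (E + k)) * gain u v"
    using N n g by (intro mult_right_mono) (auto simp: divide_le_eq mult.commute)
  moreover have "(\<Sum>l=1..D. real (num S l) * var_loss u l) \<le> (\<Sum>l=1..D. (n * ((1 - k) * a l)) * var_loss u l)"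
  proof (intro sum_mono mult_right_mono_neg)
    fix l assume l: "l \<in> {1..D}"
    then show "n * ((1 - k) * a l) \<le> real (num S l)" using V[OF l] n by (simp add: le_divide_eq mult.commute)
    show "var_loss u l \<le> 0" using l u by (intro var_loss_le) auto
  qed
  moreover have "(\<Sum>r=1..D. real (num T r) * chk_loss v r) \<le> (\<Sum>r=2..D. (n * ((1 - k) * c r)) * chk_loss v r)"
  proof -
    \<comment> \<open>Checks of degree one have nonpositive loss, so dropping them only weakens the
      bound.\<close>
    have "(\<Sum>r=1..D. real (num T r) * chk_loss v r) \<le> (\<Sum>r=2..D. real (num T r) * chk_loss v r)"
    proof -
      have "(\<Sum>r=2..D. - (real (num T r) * chk_loss v r)) \<le> (\<Sum>r=1..D. - (real (num T r) * chk_loss v r))"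
      proof (rule sum_mono2)
        fix r assume "r \<in> {1..D} - {2..D}"
        then have "chk_loss v r \<le> 0" using v by (intro chk_loss_le) auto
        then show "0 \<le> - (real (num T r) * chk_loss v r)" by (simp add: mult_nonneg_nonpos)
      qed auto
      then show ?thesis by (simp add: sum_negf)
    qed
    also have "\<dots> \<le> (\<Sum>r=2..D. (n * ((1 - k) * c r)) * chk_loss v r)"
    proof (intro sum_mono mult_right_mono_neg)
      fix r assume r: "r \<in> {2..D}"
      then show "n * ((1 - k) * c r) \<le> real (num T r)" using C[OF r] n by (simp add: le_divide_eq mult.commute)
      show "chk_loss v r \<le> 0" using r v by (intro chk_loss_le) auto
    qed
    finally show ?thesis .
  qed
  ultimately have "log 2 (weight_enum S T u v / (1 + u * v) ^ card S) \<le> (n * (E + k)) * gain u v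
     + (\<Sum>l=1..D. (n * ((1 - k) * a l)) * var_loss u l) + (\<Sum>r=2..D. (n * ((1 - k) * c r)) * chk_loss v r)"
    unfolding lf(1) by linarith
  \<comment> \<open>The surplus in the edge count and the factor \<open>1 - k\<close> on the losses
    merge through \<open>E + k = (1 - k) * E + k * (E + 1)\<close>, which leaves a single error
    term.\<close>
  also have "\<dots> = n * ((1 - k) * (E * gain u v + (\<Sum>l=1..D. a l * var_loss u l) + (\<Sum>r=2..D. c r * chk_loss v r))
      + k * (E + 1) * gain u v)"
  proof -
    have "(\<Sum>l=1..D. (n * ((1 - k) * a l)) * var_loss u l) = n * (1 - k) * (\<Sum>l=1..D. a l * var_loss u l)"
      by (simp add: sum_distrib_left mult_ac)
    moreover have "(\<Sum>r=2..D. (n * ((1 - k) * c r)) * chk_loss v r) = n * (1 - k) * (\<Sum>r=2..D. c r * chk_loss v r)"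
      by (simp add: sum_distrib_left mult_ac)
    ultimately show ?thesis by (simp add: algebra_simps)
  qed
  also have "\<dots> \<le> n * (1 * P + k * (E + 1) * 1)"
  proof (intro mult_left_mono add_mono)
    have "(1 - k) * (E * gain u v + (\<Sum>l=1..D. a l * var_loss u l) + (\<Sum>r=2..D. c r * chk_loss v r)) \<le> (1 - k) * P"
      using H k by (intro mult_left_mono) auto
    also have "\<dots> \<le> 1 * P" using k P by (intro mult_right_mono) auto
    finally show "(1 - k) * (E * gain u v + (\<Sum>l=1..D. a l * var_loss u l) + (\<Sum>r=2..D. c r * chk_loss v r)) \<le> 1 * P" .
  qed (use g k E n in auto)
  finally have "log 2 (weight_enum S T u v / (1 + u * v) ^ card S) \<le> n * (P + k * (E + 1))" by simp
  then have "weight_enum S T u v / (1 + u * v) ^ card S \<le> 2 powr (n * (P + k * (E + 1)))"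
    using lf(2) by (subst (asm) log_le_iff) auto
  moreover have "0 < (1 + u * v) ^ card S" using u v by (simp add: add_pos_pos)
  ultimately show ?thesis by (simp add: divide_le_eq)
qed

text \<open>The second equation for \<open>E\<close> says that checks of degree at least 2 absorb
  all edges in the limit, so degree-one checks number o(n). Counting variables against checks then
  gives the lower bound \<open>P\<close>, the same value that \<open>H\<close> gives from
  above.\<close>

lemma close_fixpoint:
  fixes a c :: "nat \<Rightarrow> real"
  assumes a0: "\<And>l. 0 \<le> a l" and c0: "\<And>j. 0 \<le> c j"
    and E: "E = (\<Sum>l=1..D. a l * real l)" "E = (\<Sum>j=2..D. c j * real j)" "0 < E"
    and P: "P = (\<Sum>l=1..D. a l) - (\<Sum>j=2..D. c j)" "0 \<le> P"
    and H: "\<And>u. 0 < u \<Longrightarrow> E * gain u (vfun D a u) + (\<Sum>l=1..D. a l * var_loss u l)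
        + (\<Sum>r=2..D. c r * chk_loss (vfun D a u) r) \<le> P"
  shows "close (nearF (=) D {2..D} a c) lent P 0"
  unfolding close_def
proof (intro allI impI)
  fix d :: real assume d: "0 < d"
  define F where "F = nearF (=) D {2..D} a c"
  \<comment> \<open>Error budget for the upper bound: the profile error costs
    \<open>k * (E + 1) \<le> d / 4\<close>, the polynomial prefactor less than
    \<open>d / 2\<close>.\<close>
  define k where "k = min (1/2) (d / (4 * (E + 1)))"
  have k: "0 < k" "k \<le> 1" "k * (E + 1) \<le> d / 4"
  proof -
    show "0 < k" "k \<le> 1" using d E by (auto simp: k_def)
    have "k * (E + 1) \<le> d / (4 * (E + 1)) * (E + 1)" using E by (intro mult_right_mono) (auto simp: k_def)
    also have "\<dots> = d / 4" using E by (simp add: divide_simps)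
    finally show "k * (E + 1) \<le> d / 4" .
  qed
  have e1: "eventually (\<lambda>st. \<forall>l\<in>{1..D}. (1 - k) * a l \<le> real (num (sv st) l) / sn st) F"
  proof (rule eventually_ball_finite, simp, intro ballI)
    fix l assume l: "l \<in> {1..D}"
    show "eventually (\<lambda>st. (1 - k) * a l \<le> real (num (sv st) l) / sn st) F"
    \<comment> \<open>A zero entry has no strict inequality \<open>(1 - k) * a l < a l\<close> to
      pass to the limit, but there the claim is trivial.\<close>
    proof (cases "a l = 0")
      case False
      then have "(1 - k) * a l < a l" using a0[of l] k by (simp add: algebra_simps)
      from order_tendstoD(1)[OF tendsto_num_var[OF l, where a=a and R="(=)" and J="{2..D}" and c=c] this] show ?thesis
        unfolding F_def by (rule eventually_mono) simp
    qed simp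
  qed
  have e2: "eventually (\<lambda>st. \<forall>r\<in>{2..D}. (1 - k) * c r \<le> real (num (sc st) r) / sn st) F"
  proof (rule eventually_ball_finite, simp, intro ballI)
    fix r assume r: "r \<in> {2..D}"
    show "eventually (\<lambda>st. (1 - k) * c r \<le> real (num (sc st) r) / sn st) F"
    proof (cases "c r = 0")
      case False
      then have "(1 - k) * c r < c r" using c0[of r] k by (simp add: algebra_simps)
      from order_tendstoD(1)[OF tendsto_num_chk[OF r, where a=a and R="(=)" and D=D and c=c] this] show ?thesis
        unfolding F_def by (rule eventually_mono) simp
    qed simp
  qed
  have cv: "((\<lambda>st. real (card (sv st)) / sn st) \<longlongrightarrow> E) F" unfolding F_def E(1) by (rule tendsto_card_var)
  have inv: "((\<lambda>st. 1 / sn st) \<longlongrightarrow> 0) F" unfolding F_def by (rule tendsto_inverse_size)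
  have e3: "eventually (\<lambda>st. real (card (sv st)) / sn st < E + k) F"
    using order_tendstoD(2)[OF cv, of "E + k"] k by simp
  have e4: "eventually (\<lambda>st. 2 * (2 / ln 2 * sqrt ((real (card (sv st)) / sn st + 2 * (1 / sn st)) * (1 / sn st))) < d / 2) F"
  proof -
    have "((\<lambda>st. 2 * (2 / ln 2 * sqrt ((real (card (sv st)) / sn st + 2 * (1 / sn st)) * (1 / sn st)))) \<longlongrightarrow>
       2 * (2 / ln 2 * sqrt ((E + 2 * 0) * 0))) F"
      by (intro tendsto_mult tendsto_const tendsto_real_sqrt tendsto_add cv inv)
    from order_tendstoD(2)[OF this, of "d / 2"] d show ?thesis by simp
  qed
  have e5: "eventually (\<lambda>st. 0 < real (card (sv st)) / sn st) F"
    using order_tendstoD(1)[OF cv, of 0] E by simp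
  \<comment> \<open>The last bracket is the number of degree-one checks divided by \<open>n\<close>,
    written through the edge balance; its limit is \<open>E - E\<close>.\<close>
  have e6: "eventually (\<lambda>st. P - d < (\<Sum>l=1..D. real (num (sv st) l) / sn st) - (\<Sum>j=2..D. real (num (sc st) j) / sn st)
     - (real (card (sv st)) / sn st - (\<Sum>j=2..D. real (num (sc st) j) / sn st * real j))) F"
  proof -
    have "((\<lambda>st. (\<Sum>l=1..D. real (num (sv st) l) / sn st) - (\<Sum>j=2..D. real (num (sc st) j) / sn st)
     - (real (card (sv st)) / sn st - (\<Sum>j=2..D. real (num (sc st) j) / sn st * real j))) \<longlongrightarrow>
       (\<Sum>l=1..D. a l) - (\<Sum>j=2..D. c j) - (E - (\<Sum>j=2..D. c j * real j))) F"
      by (intro tendsto_diff tendsto_sum tendsto_mult tendsto_const cv)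
        (auto simp: F_def intro!: tendsto_num_var tendsto_num_chk)
    from order_tendstoD(1)[OF this, of "P - d"] d P E show ?thesis by simp
  qed
  have e7: "eventually (\<lambda>st. finite (sv st) \<and> finite (sc st) \<and> card (sv st) = card (sc st) \<and>
     (\<forall>v. deg (sv st) v \<le> D) \<and> (\<forall>v. deg (sc st) v \<le> D) \<and> 0 < sn st) F"
    unfolding F_def by (rule eventually_nearF_valid)
  show "eventually (\<lambda>st. \<bar>lent (sv st) (sc st) / sn st - P\<bar> < d) (nearF (=) D {2..D} a c)"
    unfolding F_def[symmetric] using e1 e2 e3 e4 e5 e6 e7
  proof eventually_elim
    case (elim st)
    define S where "S = sv st"
    define T where "T = sc st"
    define n where "n = sn st"
    define N where "N = card S"
    have S: "finite S" "finite T" "card S = card T" and D: "\<And>v. deg S v \<le> D" "\<And>v. deg T v \<le> D" and n0: "0 < n"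
      using elim(7) by (auto simp: S_def T_def n_def)
    have N0: "0 < N" using elim(5) by (auto simp: zero_less_divide_iff N_def S_def)
    define R where "R = 2 powr (n * (P + k * (E + 1)))"
    have R1: "1 \<le> R" unfolding R_def using n0 P k E by (intro ge_one_powr_ge_zero) auto
    have "avg (bijs S T) (\<lambda>\<sigma>. real (card (kern S \<sigma>))) \<le> (real (card S) + 2)\<^sup>2 * R"
    proof (rule avg_card_kern_le[OF S])
      fix w assume w: "0 < w" "w < card S"
      have w1: "0 < real w / N" "real w / N < 1" using w by (auto simp: N_def)
      have "0 < (\<Sum>l=1..D. a l * real l)" using E by simp
      from saddle_point_exists[OF a0 this w1] obtain u where u: "0 < u" "0 < vfun D a u" "u * vfun D a u * (1 - real w / N) = real w / N"
        "0 \<le> (1 - u) * (1 - vfun D a u)"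
        by blast
      let ?v = "vfun D a u"
      have "u * ?v * real (card S - w) = real w"
      proof -
        have "u * ?v * real (card S - w) = u * ?v * (1 - real w / N) * N"
          using w N0 by (simp add: N_def of_nat_diff field_simps)
        also have "\<dots> = real w" unfolding u(3) using N0 by simp
        finally show ?thesis .
      qed
      moreover have "weight_enum S T u ?v \<le> R * (1 + u * ?v) ^ card S"
        unfolding R_def
      proof (rule first_moment_exponent_le[OF S D u(1,2,4) n0])
        show "(1 - k) * a l \<le> real (num S l) / n" if "l \<in> {1..D}" for l using elim(1) that by (simp add: S_def n_def)
        show "(1 - k) * c l \<le> real (num T l) / n" if "l \<in> {2..D}" for l using elim(2) that by (simp add: T_def n_def)
        show "real (card S) / n \<le> E + k" using elim(3) by (simp add: S_def n_def)
      qed (use k E P H[OF u(1)] in auto)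
      ultimately show "\<exists>u v. 0 < u \<and> 0 < v \<and> u * v * real (card S - w) = real w \<and>
       weight_enum S T u v \<le> R * (1 + u * v) ^ card S"
        using u by blast
    qed (use N0 R1 in \<open>auto simp: N_def\<close>)
    moreover have "0 < avg (bijs S T) (\<lambda>\<sigma>. real (card (kern S \<sigma>)))"
    proof -
      have "finite (bijs S T)" "0 < card (bijs S T)" using S by (auto simp: card_bijs)
      then show ?thesis
        unfolding avg_def using card_kern_pos[OF S(1)] by (intro divide_pos_pos sum_pos) auto
    qed
    ultimately have "lent S T \<le> log 2 ((real N + 2)\<^sup>2 * R)"
      using lent_le_log_avg[OF S] unfolding N_def by (smt (verit) log_le_cancel_iff)
    also have "\<dots> = 2 * log 2 (real N + 2) + n * (P + k * (E + 1))"
      using R1 by (simp add: log_mult log_nat_power R_def)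
    also have "log 2 (real N + 2) \<le> 2 / ln 2 * sqrt (real N + 2)" by (rule log2_le_sqrt) simp
    finally have "lent S T \<le> 2 * (2 / ln 2 * sqrt (real N + 2)) + n * (P + k * (E + 1))" by simp
    then have "lent S T / n \<le> (2 * (2 / ln 2 * sqrt (real N + 2)) + n * (P + k * (E + 1))) / n"
      using n0 by (simp add: divide_right_mono)
    also have "\<dots> = 2 * (2 / ln 2 * (sqrt (real N + 2) / n)) + (P + k * (E + 1))"
      using n0 by (simp add: add_divide_distrib)
    also have "sqrt (real N + 2) / n = sqrt ((real N / n + 2 * (1 / n)) * (1 / n))"
    proof -
      have "(real N / n + 2 * (1 / n)) * (1 / n) = (real N + 2) / n\<^sup>2"
        by (simp add: power2_eq_square add_divide_distrib)
      then show ?thesis using n0 by (simp add: real_sqrt_divide)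
    qed
    finally have up: "lent S T / n < P + d"
      using elim(4) k(3) d by (simp add: N_def S_def n_def)
    have "real (card (fst ` S)) - real (card (fst ` T)) =
       (\<Sum>l=1..D. real (num S l)) - (\<Sum>j=2..D. real (num T j)) - (real (card S) - (\<Sum>j=2..D. real (num T j) * real j))"
    proof (cases "D = 0")
      case True
      then show ?thesis
        using card_nodes_eq_sum_num[OF S(1) D(1)] card_nodes_eq_sum_num[OF S(2) D(2)] card_eq_sum_num[OF S(2) D(2)] S by simp
    next
      case False
      then have "{1..D} = insert 1 {2..D}" by auto
      then show ?thesis
        using card_nodes_eq_sum_num[OF S(1) D(1)] card_nodes_eq_sum_num[OF S(2) D(2)] card_eq_sum_num[OF S(2) D(2)] S
        by simp
    qed
    then have "(real (card (fst ` S)) - real (card (fst ` T))) / n =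
       (\<Sum>l=1..D. real (num S l) / n) - (\<Sum>j=2..D. real (num T j) / n) - (real (card S) / n - (\<Sum>j=2..D. real (num T j) / n * real j))"
      by (simp add: diff_divide_distrib sum_divide_distrib)
    also have "\<dots> > P - d" using elim(6) by (simp add: S_def T_def n_def)
    finally have "P - d < (real (card (fst ` S)) - real (card (fst ` T))) / n" .
    also have "\<dots> \<le> lent S T / n" using lent_ge[OF S] n0 by (intro divide_right_mono) auto
    finally have "P - d < lent S T / n" .
    with up show ?case by (simp add: S_def T_def n_def abs_less_iff)
  qed
qed

section \<open>The ensemble and the channel\<close>

text \<open>Giving the positions of \<open>J\<close> the factor 0 when they are not in
  \<open>E\<close> keeps exactly the sets that contain \<open>J\<close>, and the sum becomes an
  expanded product.\<close>

lemma sum_Pow_bernoulli: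
  fixes p :: real
  assumes V: "finite V" and J: "J \<subseteq> V"
  shows "(\<Sum>E\<in>Pow V. p ^ card E * (1 - p) ^ card (V - E) * of_bool (J \<subseteq> E)) = p ^ card J"
proof -
  let ?g = "\<lambda>i. if i \<in> J then 0 else 1 - p"
  have "(\<Sum>E\<in>Pow V. p ^ card E * (1 - p) ^ card (V - E) * of_bool (J \<subseteq> E)) =
        (\<Sum>E\<in>Pow V. (\<Prod>i\<in>E. p) * (\<Prod>i\<in>V - E. ?g i))"
  proof (rule sum.cong[OF refl])
    fix E assume E: "E \<in> Pow V"
    show "p ^ card E * (1 - p) ^ card (V - E) * of_bool (J \<subseteq> E) = (\<Prod>i\<in>E. p) * (\<Prod>i\<in>V - E. ?g i)"
    proof (cases "J \<subseteq> E")
      case True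
      then have "(\<Prod>i\<in>V - E. ?g i) = (\<Prod>i\<in>V - E. 1 - p)" by (intro prod.cong) auto
      then show ?thesis using True by simp
    next
      case False
      then have "(\<Prod>i\<in>V - E. ?g i) = 0" using V J by (intro prod_zero) auto
      then show ?thesis using False by simp
    qed
  qed
  also have "\<dots> = (\<Prod>i\<in>V. p + ?g i)" using V by (rule prod_add[symmetric])
  also have "\<dots> = (\<Prod>i\<in>V. if i \<in> J then p else 1)" by (rule prod.cong) auto
  also have "\<dots> = p ^ card J"
    using V J by (simp add: prod.If_cases Int_absorb1)
  finally show ?thesis .
qed

definition erasure_weight :: "real \<Rightarrow> nat \<Rightarrow> nat set \<Rightarrow> real" where
  "erasure_weight eps n E = eps ^ card E * (1 - eps) ^ card ({0..<n} - E)"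

text \<open>Given the erasure set \<open>E\<close>, the inputs compatible with the output form a
  coset of the words supported on \<open>E\<close> and are equally likely, so the conditional
  entropy is the log of the coset size.\<close>

lemma cond_entropy_bec_linear:
  assumes C: "C \<subseteq> {0..<n} \<rightarrow>\<^sub>E (UNIV :: bool set)" "C \<noteq> {}"
    and xor: "\<And>x x'. x \<in> C \<Longrightarrow> x' \<in> C \<Longrightarrow> (\<lambda>i\<in>{0..<n}. x i \<noteq> x' i) \<in> C"
  shows "cond_entropy_bec eps n C =
     (\<Sum>E\<in>Pow {0..<n}. erasure_weight eps n E * log 2 (card {x\<in>C. \<forall>i<n. x i \<longrightarrow> i \<in> E}))"
proof -
  let ?U = "{0..<n}" and ?W = "erasure_weight eps n"
  let ?Y = "{0..<n} \<rightarrow>\<^sub>E (UNIV :: bool option set)"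
  \<comment> \<open>For fixed \<open>x\<close> the output is an injective function of the erasure
    set, so the sum over outputs turns into a sum over erasure sets.\<close>
  define yy where "yy x E = (\<lambda>i\<in>?U. if i \<in> E then None else Some (x i))" for x :: "nat \<Rightarrow> bool" and E
  define CE where "CE E = {x\<in>C. \<forall>i<n. x i \<longrightarrow> i \<in> E}" for E
  have fC: "finite C" using finite_PiE[of ?U "\<lambda>_. UNIV :: bool set"] C(1) finite_subset by auto
  have cC: "0 < card C" using fC C(2) by (simp add: card_gt_0_iff)
  have jt: "bec_joint eps n C x' (yy x E) =
      (if \<forall>i<n. i \<notin> E \<longrightarrow> x' i = x i then ?W E / card C else 0)" if E: "E \<subseteq> ?U" for x x' E
  proof (cases "\<forall>i<n. i \<notin> E \<longrightarrow> x' i = x i")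
    case True
    have "(\<Prod>i<n. bec_W eps (x' i) (yy x E i)) = (\<Prod>i\<in>?U. if i \<in> E then eps else 1 - eps)"
      unfolding lessThan_atLeast0 by (rule prod.cong) (use True in \<open>auto simp: bec_W_def yy_def\<close>)
    also have "\<dots> = ?W E"
    proof -
      have "?U \<inter> {i. i \<in> E} = E" "?U \<inter> - {i. i \<in> E} = ?U - E" using E by auto
      then show ?thesis by (simp add: prod.If_cases erasure_weight_def)
    qed
    finally show ?thesis using True by (simp add: bec_joint_def)
  next
    case False
    then obtain i where i: "i < n" "i \<notin> E" "x' i \<noteq> x i" by blast
    have "bec_W eps (x' i) (yy x E i) = 0" using i by (auto simp: bec_W_def yy_def)
    then have "(\<Prod>i<n. bec_W eps (x' i) (yy x E i)) = 0" using i(1) by (intro prod_zero) blast+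
    then show ?thesis unfolding bec_joint_def using False by auto
  qed
  \<comment> \<open>Adding \<open>x\<close> is an involution that exchanges the coset and the words
    supported on \<open>E\<close>.\<close>
  have agree: "card {x'\<in>C. \<forall>i<n. i \<notin> E \<longrightarrow> x' i = x i} = card (CE E)" if x: "x \<in> C" for x E
  proof (rule bij_betw_same_card)
    let ?f = "\<lambda>z. \<lambda>i\<in>?U. z i \<noteq> x i"
    have ff: "?f (?f z) = z" if "z \<in> C" for z
    proof
      fix i
      have "z \<in> extensional ?U" using that C(1) by (auto simp: PiE_def)
      then show "?f (?f z) i = z i" by (auto simp: extensional_def)
    qed
    show "bij_betw ?f {x'\<in>C. \<forall>i<n. i \<notin> E \<longrightarrow> x' i = x i} (CE E)"
    proof (rule bij_betw_byWitness[where f' = ?f])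
      show "\<forall>a\<in>{x'\<in>C. \<forall>i<n. i \<notin> E \<longrightarrow> x' i = x i}. ?f (?f a) = a" using ff by blast
      show "\<forall>a'\<in>CE E. ?f (?f a') = a'" using ff by (auto simp: CE_def)
      show "?f ` {x'\<in>C. \<forall>i<n. i \<notin> E \<longrightarrow> x' i = x i} \<subseteq> CE E"
        using xor[OF _ x] by (auto simp: CE_def)
      show "?f ` CE E \<subseteq> {x'\<in>C. \<forall>i<n. i \<notin> E \<longrightarrow> x' i = x i}"
        using xor[OF _ x] by (auto simp: CE_def)
    qed
  qed
  have out: "bec_out eps n C (yy x E) = ?W E / card C * card (CE E)" if x: "x \<in> C" and E: "E \<subseteq> ?U" for x E
  proof -
    have "bec_out eps n C (yy x E) = (\<Sum>x'\<in>C. if \<forall>i<n. i \<notin> E \<longrightarrow> x' i = x i then ?W E / card C else 0)"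
      unfolding bec_out_def using jt[OF E] by simp
    also have "\<dots> = ?W E / card C * card {x'\<in>C. \<forall>i<n. i \<notin> E \<longrightarrow> x' i = x i}"
      using fC by (simp add: sum.If_cases Int_def mult.commute)
    finally show ?thesis using agree[OF x] by simp
  qed
  define g where "g x y = (if bec_joint eps n C x y = 0 then 0
         else - bec_joint eps n C x y * log 2 (bec_joint eps n C x y / bec_out eps n C y))" for x y
  have g: "g x (yy x E) = ?W E * log 2 (card (CE E)) / card C" if x: "x \<in> C" and E: "E \<subseteq> ?U" for x E
  proof (cases "?W E = 0")
    case True
    then show ?thesis using jt[OF E, of x x] by (simp add: g_def)
  next
    case False
    have "x \<in> {x'\<in>C. \<forall>i<n. i \<notin> E \<longrightarrow> x' i = x i}" using x by simp
    then have "0 < card {x'\<in>C. \<forall>i<n. i \<notin> E \<longrightarrow> x' i = x i}" using fC by (auto simp: card_gt_0_iff)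
    then have c0: "0 < card (CE E)" using agree[OF x, of E] by simp
    have j: "bec_joint eps n C x (yy x E) = ?W E / card C" using jt[OF E, of x x] by simp
    have "bec_joint eps n C x (yy x E) / bec_out eps n C (yy x E) = 1 / card (CE E)"
      unfolding j out[OF x E] using False cC by simp
    then show ?thesis unfolding g_def using False cC c0 j
      by (simp add: log_divide)
  qed
  have inj: "inj_on (yy x) (Pow ?U)" for x
  proof (rule inj_onI)
    fix E E' assume E: "E \<in> Pow ?U" "E' \<in> Pow ?U" "yy x E = yy x E'"
    have "i \<in> E \<longleftrightarrow> i \<in> E'" if "i < n" for i
      using fun_cong[OF E(3), of i] that by (auto simp: yy_def split: if_splits)
    then show "E = E'" using E(1,2) by auto
  qed
  \<comment> \<open>Any other output shows a wrong bit, so its joint probability with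
    \<open>x\<close> is 0 and the first branch of \<open>g\<close> applies.\<close>
  have zero: "g x y = 0" if x: "x \<in> C" and y: "y \<in> ?Y" "y \<notin> yy x ` Pow ?U" for x y
  proof -
    have "\<exists>i<n. bec_W eps (x i) (y i) = 0"
    proof (rule ccontr)
      assume "\<not> (\<exists>i<n. bec_W eps (x i) (y i) = 0)"
      then have *: "y i = None \<or> y i = Some (x i)" if "i < n" for i
        using that by (cases "y i") (auto simp: bec_W_def split: if_splits)
      have "y = yy x {i\<in>?U. y i = None}"
      proof
        fix i
        show "y i = yy x {i\<in>?U. y i = None} i"
          using *[of i] y(1) by (cases "i < n") (auto simp: yy_def PiE_def extensional_def)
      qed
      then show False using y(2) by blast
    qed
    then have "(\<Prod>i<n. bec_W eps (x i) (y i)) = 0" by (intro prod_zero) auto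
    then show ?thesis by (simp add: g_def bec_joint_def)
  qed
  have "cond_entropy_bec eps n C = (\<Sum>x\<in>C. \<Sum>y\<in>?Y. g x y)"
    by (simp add: cond_entropy_bec_def g_def)
  also have "\<dots> = (\<Sum>x\<in>C. \<Sum>y\<in>yy x ` Pow ?U. g x y)"
  proof (rule sum.cong[OF refl])
    fix x assume x: "x \<in> C"
    show "(\<Sum>y\<in>?Y. g x y) = (\<Sum>y\<in>yy x ` Pow ?U. g x y)"
      by (rule sum.mono_neutral_right) (use zero[OF x] in \<open>auto simp: yy_def intro!: finite_PiE\<close>)
  qed
  also have "\<dots> = (\<Sum>x\<in>C. \<Sum>E\<in>Pow ?U. ?W E * log 2 (card (CE E)) / card C)"
    using g by (intro sum.cong refl) (subst sum.reindex[OF inj], auto)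
  also have "\<dots> = (\<Sum>E\<in>Pow ?U. ?W E * log 2 (card (CE E)))"
    using cC by (subst sum.swap) simp
  finally show ?thesis by (simp add: CE_def)
qed

section \<open>The socket layout of the ensemble\<close>

lemma sum_list_take_mono: "i \<le> j \<Longrightarrow> sum_list (take i ds) \<le> sum_list (take j (ds :: nat list))"
proof -
  assume "i \<le> j"
  then have "take j ds = take i ds @ take (j - i) (drop i ds)"
    by (metis le_add_diff_inverse take_add)
  then show ?thesis by simp
qed

lemma owner_eqI:
  assumes "v < length ds" "sum_list (take v ds) \<le> s" "s < sum_list (take (Suc v) ds)"
  shows "owner ds s = v"
proof -
  have "{w. w < length ds \<and> sum_list (take (Suc w) ds) \<le> s} = {..<v}"
  proof (intro equalityI subsetI)
    fix w assume w: "w \<in> {w. w < length ds \<and> sum_list (take (Suc w) ds) \<le> s}"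
    show "w \<in> {..<v}"
    proof (rule ccontr)
      assume "w \<notin> {..<v}"
      then have "sum_list (take (Suc v) ds) \<le> sum_list (take (Suc w) ds)"
        by (intro sum_list_take_mono) simp
      then show False using w assms by simp
    qed
  next
    fix w assume "w \<in> {..<v}"
    then have "sum_list (take (Suc w) ds) \<le> sum_list (take v ds)" "w < length ds"
      using assms by (auto intro: sum_list_take_mono)
    then show "w \<in> {w. w < length ds \<and> sum_list (take (Suc w) ds) \<le> s}" using assms by simp
  qed
  then show ?thesis by (simp add: owner_def)
qed

lemma owner_exists:
  assumes "s < sum_list (ds :: nat list)"
  shows "\<exists>v<length ds. sum_list (take v ds) \<le> s \<and> s < sum_list (take (Suc v) ds)"
proof -
  have "s < sum_list (take (length ds) ds)" "\<not> s < sum_list (take 0 ds)" using assms by simp_all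
  from ex_least_nat_less[of "\<lambda>i. s < sum_list (take i ds)", OF this]
  obtain k where "k < length ds" "\<forall>i\<le>k. \<not> s < sum_list (take i ds)" "s < sum_list (take (Suc k) ds)"
    by blast
  then show ?thesis by (intro exI[of _ k]) (auto simp: not_less)
qed

lemma owner_less: "s < sum_list ds \<Longrightarrow> owner ds s < length ds"
  using owner_exists owner_eqI by metis

lemma owner_fibre:
  assumes "v < length ds"
  shows "{s. s < sum_list ds \<and> owner ds s = v} = {sum_list (take v ds)..<sum_list (take (Suc v) ds)}"
proof (intro equalityI subsetI)
  fix s assume "s \<in> {s. s < sum_list ds \<and> owner ds s = v}"
  then show "s \<in> {sum_list (take v ds)..<sum_list (take (Suc v) ds)}"
    using owner_exists[of s ds] owner_eqI by auto
next
  fix s assume s: "s \<in> {sum_list (take v ds)..<sum_list (take (Suc v) ds)}"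
  have "sum_list (take (Suc v) ds) \<le> sum_list (take (length ds) ds)"
    using assms by (intro sum_list_take_mono) simp
  then show "s \<in> {s. s < sum_list ds \<and> owner ds s = v}"
    using s owner_eqI[OF assms] by auto
qed

definition socks :: "nat list \<Rightarrow> (nat \<times> nat) set" where
  "socks ds = (\<lambda>s. (owner ds s, s)) ` {0..<sum_list ds}"

lemma finite_socks [simp]: "finite (socks ds)"
  by (simp add: socks_def)

lemma inj_socket: "inj_on (\<lambda>s. (owner ds s, s)) A"
  by (auto simp: inj_on_def)

lemma card_socks: "card (socks ds) = sum_list ds"
  unfolding socks_def by (subst card_image[OF inj_socket]) simp

lemma deg_socks: "deg (socks ds) v = (if v < length ds then ds ! v else 0)"
proof -
  have "{t \<in> socks ds. fst t = v} = (\<lambda>s. (owner ds s, s)) ` {s. s < sum_list ds \<and> owner ds s = v}"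
    by (auto simp: socks_def)
  then have "deg (socks ds) v = card {s. s < sum_list ds \<and> owner ds s = v}"
    unfolding deg_def by (simp only: card_image[OF inj_socket])
  also have "\<dots> = (if v < length ds then ds ! v else 0)"
  proof (cases "v < length ds")
    case True
    then show ?thesis by (simp add: owner_fibre take_Suc_conv_app_nth)
  next
    case False
    then have "{s. s < sum_list ds \<and> owner ds s = v} = {}" using owner_less by auto
    then show ?thesis using False by (simp only: card.empty if_False)
  qed
  finally show ?thesis .
qed

lemma lift_deg: "deg (lift S X) v = (if v \<in> X then deg S v else 0)"
proof (cases "v \<in> X")
  case True
  then have "{s \<in> lift S X. fst s = v} = {s\<in>S. fst s = v}" by (auto simp: lift_def)
  then show ?thesis using True unfolding deg_def by (simp only: if_True)
next
  case False
  then have "{s \<in> lift S X. fst s = v} = {}" by (auto simp: lift_def)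
  then show ?thesis using False unfolding deg_def by (simp only: if_False card.empty)
qed

lemma length_filter_degs:
  "length (filter (\<lambda>d. d = l) (degs P N)) = nat \<lfloor>N * coeff P l\<rfloor>"
proof -
  have *: "length (filter (\<lambda>d. d = l) (concat (map (\<lambda>i. replicate (f i) i) xs))) =
      (if l \<in> set xs then f l else 0)" if "distinct xs" for f :: "nat \<Rightarrow> nat" and xs
    using that by (induction xs) (auto simp: filter_replicate)
  show ?thesis unfolding degs_def
    by (subst *) (auto simp: coeff_eq_0)
qed

lemma set_degs: "d \<in> set (degs P N) \<Longrightarrow> d \<le> degree P \<and> coeff P d \<noteq> 0"
  by (auto simp: degs_def less_Suc_eq_le split: if_splits)


lemma num_socks:
  assumes "1 \<le> l"
  shows "num (socks ds) l = length (filter (\<lambda>d. d = l) ds)"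
proof -
  have "{v. deg (socks ds) v = l} = {v. v < length ds \<and> ds ! v = l}"
    using assms by (auto simp: deg_socks)
  then show ?thesis by (simp add: num_def length_filter_conv_card)
qed

lemma fst_socks: "(\<And>d. d \<in> set ds \<Longrightarrow> 0 < d) \<Longrightarrow> fst ` socks ds = {0..<length ds}"
proof -
  assume pos: "\<And>d. d \<in> set ds \<Longrightarrow> 0 < d"
  have "v \<in> fst ` socks ds \<longleftrightarrow> v < length ds" for v
  proof -
    have "v \<in> fst ` socks ds \<longleftrightarrow> 0 < deg (socks ds) v" by (rule deg_pos_iff[symmetric]) simp
    also have "\<dots> \<longleftrightarrow> v < length ds" using pos[of "ds ! v"] by (simp add: deg_socks)
    finally show ?thesis .
  qed
  then show ?thesis by (intro set_eqI) simp
qed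

lemma fst_lift: "X \<subseteq> fst ` S \<Longrightarrow> fst ` lift S X = X"
  by (force simp: lift_def)

text \<open>Supports are matched with kernel elements. Positive degrees make every erased variable
  own a socket; a variable without sockets would be a free code bit that \<open>kern\<close> cannot
  see.\<close>

lemma card_ldpc_code_supported:
  fixes Lam Gam :: "real poly" and n :: nat
  defines "vd \<equiv> vdegs Lam n" and "cd \<equiv> cdegs Lam Gam n"
  assumes len: "length vd = n" and pos: "\<And>d. d \<in> set vd \<Longrightarrow> 0 < d"
    and sum: "sum_list cd = sum_list vd"
    and \<pi>: "\<pi> permutes {0..<sum_list vd}" and E: "E \<subseteq> {0..<n}"
  shows "card {x\<in>ldpc_code Lam Gam n \<pi>. \<forall>i<n. x i \<longrightarrow> i \<in> E} =
     card (kern (lift (socks vd) E) (restrict ((\<lambda>s. (owner cd s, s)) \<circ> \<pi> \<circ> snd) (socks vd)))"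
proof (rule bij_betw_same_card)
  let ?N = "sum_list vd" and ?S = "socks vd"
  let ?\<sigma> = "restrict ((\<lambda>s. (owner cd s, s)) \<circ> \<pi> \<circ> snd) ?S"
  have ne: "nedges Lam n = ?N" by (simp add: nedges_def vd_def)
  have fE: "fst ` lift ?S E = E"
    using fst_socks[of vd, OF pos] len E by (intro fst_lift) auto
  have par: "card {t \<in> lift ?S E. fst (?\<sigma> t) = c \<and> fst t \<in> X} =
      card {s \<in> {0..<?N}. owner cd (\<pi> s) = c \<and> owner vd s \<in> X}" if "X \<subseteq> E" for X c
  proof -
    have "{t \<in> lift ?S E. fst (?\<sigma> t) = c \<and> fst t \<in> X} =
        (\<lambda>s. (owner vd s, s)) ` {s \<in> {0..<?N}. owner cd (\<pi> s) = c \<and> owner vd s \<in> X}"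
      using that by (auto simp: lift_def socks_def)
    then show ?thesis by (simp only: card_image[OF inj_socket])
  qed
  have kern: "X \<in> kern (lift ?S E) ?\<sigma> \<longleftrightarrow> X \<subseteq> E \<and>
     (\<forall>k<length cd. even (card {s \<in> {0..<?N}. owner cd (\<pi> s) = k \<and> owner vd s \<in> X}))" for X
  proof (cases "X \<subseteq> E")
    case True
    have "{s \<in> {0..<?N}. owner cd (\<pi> s) = k \<and> owner vd s \<in> X} = {}" if "\<not> k < length cd" for k
    proof -
      have "owner cd (\<pi> s) < length cd" if "s \<in> {0..<?N}" for s
        using permutes_in_image[OF \<pi>, of s] that sum by (intro owner_less) auto
      then show ?thesis using that by auto
    qed
    then have "even (card {s \<in> {0..<?N}. owner cd (\<pi> s) = k \<and> owner vd s \<in> X})" if "\<not> k < length cd" for k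
      using that by (metis (no_types, lifting) card.empty even_zero)
    then show ?thesis unfolding kern_def mem_Collect_eq fE par[OF True] using True by blast
  qed (simp add: kern_def fE)
  have own: "owner vd s < n" if "s < ?N" for s using owner_less[OF that] len by simp
  have code: "x \<in> ldpc_code Lam Gam n \<pi> \<longleftrightarrow> x \<in> {0..<n} \<rightarrow>\<^sub>E UNIV \<and>
     (\<forall>k<length cd. even (card {s \<in> {0..<?N}. owner cd (\<pi> s) = k \<and> owner vd s \<in> {i\<in>{0..<n}. x i}}))" for x
  proof -
    have "{s \<in> {0..<?N}. owner cd (\<pi> s) = k \<and> owner vd s \<in> {i\<in>{0..<n}. x i}} =
        {s \<in> {0..<?N}. owner cd (\<pi> s) = k \<and> x (owner vd s)}" for k
      using own by auto
    then show ?thesis by (simp only: ldpc_code_def mem_Collect_eq ne cd_def[symmetric] vd_def[symmetric])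
  qed
  show "bij_betw (\<lambda>x. {i\<in>{0..<n}. x i}) {x\<in>ldpc_code Lam Gam n \<pi>. \<forall>i<n. x i \<longrightarrow> i \<in> E} (kern (lift ?S E) ?\<sigma>)"
  proof (rule bij_betw_byWitness[where f' = "\<lambda>X. \<lambda>i\<in>{0..<n}. i \<in> X"])
    show "\<forall>x\<in>{x\<in>ldpc_code Lam Gam n \<pi>. \<forall>i<n. x i \<longrightarrow> i \<in> E}. (\<lambda>i\<in>{0..<n}. i \<in> {i\<in>{0..<n}. x i}) = x"
      by (auto simp: code PiE_def extensional_def fun_eq_iff)
    show "\<forall>X\<in>kern (lift ?S E) ?\<sigma>. {i\<in>{0..<n}. (\<lambda>i\<in>{0..<n}. i \<in> X) i} = X"
    proof
      fix X assume "X \<in> kern (lift ?S E) ?\<sigma>"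
      then have "X \<subseteq> {0..<n}" unfolding kern using E by blast
      then show "{i\<in>{0..<n}. (\<lambda>i\<in>{0..<n}. i \<in> X) i} = X" by auto
    qed
    show "(\<lambda>x. {i\<in>{0..<n}. x i}) ` {x\<in>ldpc_code Lam Gam n \<pi>. \<forall>i<n. x i \<longrightarrow> i \<in> E} \<subseteq> kern (lift ?S E) ?\<sigma>"
    proof clarify
      fix x assume "x \<in> ldpc_code Lam Gam n \<pi>" "\<forall>i<n. x i \<longrightarrow> i \<in> E"
      then show "{i\<in>{0..<n}. x i} \<in> kern (lift ?S E) ?\<sigma>" unfolding kern code by auto
    qed
    show "(\<lambda>X. \<lambda>i\<in>{0..<n}. i \<in> X) ` kern (lift ?S E) ?\<sigma> \<subseteq> {x\<in>ldpc_code Lam Gam n \<pi>. \<forall>i<n. x i \<longrightarrow> i \<in> E}"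
    proof clarify
      fix X assume X: "X \<in> kern (lift ?S E) ?\<sigma>"
      then have "{i\<in>{0..<n}. (\<lambda>i\<in>{0..<n}. i \<in> X) i} = X" unfolding kern using E by auto
      then show "(\<lambda>i\<in>{0..<n}. i \<in> X) \<in> ldpc_code Lam Gam n \<pi> \<and> (\<forall>i<n. (\<lambda>i\<in>{0..<n}. i \<in> X) i \<longrightarrow> i \<in> E)"
        using X unfolding kern code by auto
    qed
  qed
qed

lemma ldpc_code_xor:
  assumes len: "length (vdegs Lam n) = n"
    and x: "x \<in> ldpc_code Lam Gam n \<pi>" "x' \<in> ldpc_code Lam Gam n \<pi>"
  shows "(\<lambda>i\<in>{0..<n}. x i \<noteq> x' i) \<in> ldpc_code Lam Gam n \<pi>"
proof -
  let ?A = "\<lambda>x k. {s \<in> {0..<nedges Lam n}. owner (cdegs Lam Gam n) (\<pi> s) = k \<and> x (owner (vdegs Lam n) s)}"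
  have own: "owner (vdegs Lam n) s < n" if "s < nedges Lam n" for s
    using owner_less[of s "vdegs Lam n"] that len by (simp add: nedges_def)
  have "?A (\<lambda>i\<in>{0..<n}. x i \<noteq> x' i) k = sym_diff (?A x k) (?A x' k)" for k
    using own by auto
  then show ?thesis using x even_card_sym_diff[of "?A x _" "?A x' _"] by (simp add: ldpc_code_def)
qed

text \<open>Exchanging the averages over matchings and erasures fixes the erasure set first. Then
  only the sockets of erased variables matter, a partial matching, hence
  \<open>ment\<close>.\<close>

lemma ldpc_avg_entropy_eq:
  fixes Lam Gam :: "real poly" and n :: nat
  defines "vd \<equiv> vdegs Lam n" and "cd \<equiv> cdegs Lam Gam n"
  assumes len: "length vd = n" and pos: "\<And>d. d \<in> set vd \<Longrightarrow> 0 < d"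
    and sum: "sum_list cd = sum_list vd"
  shows "ldpc_avg_entropy Lam Gam eps n =
     (\<Sum>E\<in>Pow {0..<n}. erasure_weight eps n E * ment (lift (socks vd) E) (socks cd))"
proof -
  let ?N = "sum_list vd" and ?S = "socks vd" and ?T = "socks cd"
  let ?\<sigma> = "\<lambda>\<pi>. restrict ((\<lambda>s. (owner cd s, s)) \<circ> \<pi> \<circ> snd) ?S"
  have ne: "nedges Lam n = ?N" by (simp add: nedges_def vd_def)
  have bij: "bij_betw ?\<sigma> {\<pi>. \<pi> permutes {0..<?N}} (bijs ?S ?T)"
  proof (rule bijs_bij_betw_permutes)
    show "bij_betw snd ?S {0..<?N}"
      unfolding socks_def by (rule bij_betw_byWitness[where f' = "\<lambda>s. (owner vd s, s)"]) auto
    show "bij_betw (\<lambda>s. (owner cd s, s)) {0..<?N} ?T"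
      unfolding socks_def sum by (rule bij_betw_imageI[OF inj_socket]) simp
  qed
  have cb: "card (bijs ?S ?T) = fact ?N" using sum by (simp add: card_bijs card_socks)
  have ent: "cond_entropy_bec eps n (ldpc_code Lam Gam n \<pi>) =
     (\<Sum>E\<in>Pow {0..<n}. erasure_weight eps n E * log 2 (card (kern (lift ?S E) (?\<sigma> \<pi>))))"
    if \<pi>: "\<pi> permutes {0..<?N}" for \<pi>
  proof -
    have "(\<lambda>i\<in>{0..<n}. False) \<in> ldpc_code Lam Gam n \<pi>"
    proof -
      have "owner vd s < n" if "s < ?N" for s using owner_less[OF that] len by simp
      then have "{s \<in> {0..<?N}. owner cd (\<pi> s) = k \<and> (\<lambda>i\<in>{0..<n}. False) (owner vd s)} = {}" for k
        by auto
      then show ?thesis unfolding ldpc_code_def ne vd_def[symmetric] cd_def[symmetric]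
        by (simp only: mem_Collect_eq card.empty even_zero) simp
    qed
    then have ne: "ldpc_code Lam Gam n \<pi> \<noteq> {}" by blast
    have "cond_entropy_bec eps n (ldpc_code Lam Gam n \<pi>) =
      (\<Sum>E\<in>Pow {0..<n}. erasure_weight eps n E * log 2 (card {x\<in>ldpc_code Lam Gam n \<pi>. \<forall>i<n. x i \<longrightarrow> i \<in> E}))"
    proof (rule cond_entropy_bec_linear[OF _ ne])
      show "ldpc_code Lam Gam n \<pi> \<subseteq> {0..<n} \<rightarrow>\<^sub>E UNIV" unfolding ldpc_code_def by blast
      show "(\<lambda>i\<in>{0..<n}. x i \<noteq> x' i) \<in> ldpc_code Lam Gam n \<pi>"
        if "x \<in> ldpc_code Lam Gam n \<pi>" "x' \<in> ldpc_code Lam Gam n \<pi>" for x x'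
        using ldpc_code_xor[OF len[unfolded vd_def] that] .
    qed
    also have "\<dots> = (\<Sum>E\<in>Pow {0..<n}. erasure_weight eps n E * log 2 (card (kern (lift ?S E) (?\<sigma> \<pi>))))"
    proof (rule sum.cong[OF refl])
      fix E assume "E \<in> Pow {0..<n}"
      then have "card {x\<in>ldpc_code Lam Gam n \<pi>. \<forall>i<n. x i \<longrightarrow> i \<in> E} = card (kern (lift ?S E) (?\<sigma> \<pi>))"
        unfolding vd_def cd_def
        by (intro card_ldpc_code_supported) (use len pos sum \<pi> in \<open>auto simp: vd_def cd_def\<close>)
      then show "erasure_weight eps n E * log 2 (card {x\<in>ldpc_code Lam Gam n \<pi>. \<forall>i<n. x i \<longrightarrow> i \<in> E}) =
        erasure_weight eps n E * log 2 (card (kern (lift ?S E) (?\<sigma> \<pi>)))" by (simp only:)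
    qed
    finally show ?thesis .
  qed
  have "(\<Sum>\<pi> | \<pi> permutes {0..<?N}. cond_entropy_bec eps n (ldpc_code Lam Gam n \<pi>)) =
     (\<Sum>\<pi> | \<pi> permutes {0..<?N}. \<Sum>E\<in>Pow {0..<n}. erasure_weight eps n E * log 2 (card (kern (lift ?S E) (?\<sigma> \<pi>))))"
    using ent by (intro sum.cong) auto
  also have "\<dots> = (\<Sum>\<sigma>\<in>bijs ?S ?T. \<Sum>E\<in>Pow {0..<n}. erasure_weight eps n E * log 2 (card (kern (lift ?S E) \<sigma>)))"
    by (rule sum.reindex_bij_betw[OF bij])
  also have "\<dots> = (\<Sum>E\<in>Pow {0..<n}. erasure_weight eps n E * (\<Sum>\<sigma>\<in>bijs ?S ?T. log 2 (card (kern (lift ?S E) \<sigma>))))"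
    by (subst sum.swap) (simp add: sum_distrib_left)
  finally have "ldpc_avg_entropy Lam Gam eps n =
     (\<Sum>E\<in>Pow {0..<n}. erasure_weight eps n E * avg (bijs ?S ?T) (\<lambda>\<sigma>. log 2 (card (kern (lift ?S E) \<sigma>))))"
  proof -
    assume eq: "(\<Sum>\<pi> | \<pi> permutes {0..<?N}. cond_entropy_bec eps n (ldpc_code Lam Gam n \<pi>)) =
      (\<Sum>E\<in>Pow {0..<n}. erasure_weight eps n E * (\<Sum>\<sigma>\<in>bijs ?S ?T. log 2 (card (kern (lift ?S E) \<sigma>))))"
    have *: "(\<Sum>E\<in>Pow {0..<n}. w E * z E) / f = (\<Sum>E\<in>Pow {0..<n}. w E * (z E / f))" for w z :: "nat set \<Rightarrow> real" and f
      by (simp add: sum_divide_distrib)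
    show ?thesis unfolding ldpc_avg_entropy_def ne eq avg_def cb * of_nat_fact ..
  qed
  also have "\<dots> = (\<Sum>E\<in>Pow {0..<n}. erasure_weight eps n E * ment (lift ?S E) ?T)"
    using sum by (intro sum.cong refl arg_cong2[where f="(*)"] ment_eq) (auto simp: card_socks lift_def)
  finally show ?thesis .
qed

lemma erasure_weight_nonneg: "0 \<le> eps \<Longrightarrow> eps \<le> 1 \<Longrightarrow> 0 \<le> erasure_weight eps n E"
  by (simp add: erasure_weight_def)

lemma sum_erasure_weight_subset:
  "J \<subseteq> {0..<n} \<Longrightarrow> (\<Sum>E\<in>Pow {0..<n}. erasure_weight eps n E * of_bool (J \<subseteq> E)) = eps ^ card J"
  unfolding erasure_weight_def by (intro sum_Pow_bernoulli) auto

lemma sum_erasure_weight: "(\<Sum>E\<in>Pow {0..<n}. erasure_weight eps n E) = 1"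
  using sum_erasure_weight_subset[of "{}" n eps] by simp

text \<open>Erasures are independent with exact probability \<open>eps\<close>, so
  \<open>second_moment\<close> applies with \<open>c = 0\<close>.\<close>

lemma erasure_deviation:
  assumes eps: "0 \<le> eps" "eps \<le> 1" and I: "I \<subseteq> {0..<n}" and \<tau>: "0 < \<tau>"
  shows "(\<Sum>E | E \<in> Pow {0..<n} \<and> \<tau> < \<bar>real (card {i\<in>I. i \<in> E}) - real (card I) * eps\<bar>. erasure_weight eps n E)
     \<le> real n / \<tau>\<^sup>2"
proof (rule chebyshev_weighted)
  have fI: "finite I" using I finite_subset by blast
  have "(\<Sum>E\<in>Pow {0..<n}. erasure_weight eps n E * (real (card {i\<in>I. i \<in> E}) - (\<Sum>i\<in>I. eps))\<^sup>2)
      \<le> real (card I) + 3 * 0 * real ((card I)\<^sup>2)"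
  proof (rule second_moment)
    show "\<bar>(\<Sum>E\<in>Pow {0..<n}. erasure_weight eps n E * of_bool (i \<in> E)) - eps\<bar> \<le> 0" if "i \<in> I" for i
      using sum_erasure_weight_subset[of "{i}" n eps] that I by auto
    show "\<bar>(\<Sum>E\<in>Pow {0..<n}. erasure_weight eps n E * of_bool (i \<in> E \<and> i' \<in> E)) - eps * eps\<bar> \<le> 0"
      if "i \<in> I" "i' \<in> I" "i \<noteq> i'" for i i'
    proof -
      have "{i, i'} \<subseteq> {0..<n}" using that I by blast
      from sum_erasure_weight_subset[OF this, of eps] that show ?thesis by (simp add: power2_eq_square)
    qed
  qed (use eps fI in \<open>auto simp: erasure_weight_nonneg sum_erasure_weight\<close>)
  also have "\<dots> \<le> real n" using card_mono[OF _ I] by simp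
  finally show "(\<Sum>E\<in>Pow {0..<n}. erasure_weight eps n E * (real (card {i\<in>I. i \<in> E}) - real (card I) * eps)\<^sup>2) \<le> real n"
    by simp
qed (use eps \<tau> in \<open>auto simp: erasure_weight_nonneg\<close>)


lemma sum_coeff_deriv:
  fixes p :: "real poly"
  assumes "degree p \<le> D"
  shows "(\<Sum>l=1..D. coeff p l * real l * y ^ l) = y * poly (pderiv p) y"
proof -
  have "degree (pderiv p) \<le> D" using assms by (simp add: degree_pderiv)
  then have "poly (pderiv p) y = (\<Sum>i\<le>D. coeff (pderiv p) i * y ^ i)"
    unfolding poly_altdef by (intro sum.mono_neutral_left) (auto simp: coeff_eq_0)
  also have "\<dots> = (\<Sum>i<D. coeff (pderiv p) i * y ^ i)"
    using assms by (intro sum.mono_neutral_right) (auto simp: coeff_pderiv coeff_eq_0)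
  finally have "y * poly (pderiv p) y = (\<Sum>i<D. coeff p (Suc i) * real (Suc i) * y ^ Suc i)"
    by (simp add: sum_distrib_left coeff_pderiv mult_ac)
  also have "\<dots> = (\<Sum>l=1..D. coeff p l * real l * y ^ l)"
    by (rule sum.reindex_bij_witness[of _ "\<lambda>l. l - 1" Suc]) auto
  finally show ?thesis by simp
qed

lemma dderiv1_eq_sum: "degree p \<le> D \<Longrightarrow> dderiv1 p = (\<Sum>l=1..D. coeff p l * real l)"
  using sum_coeff_deriv[of p D 1] by (simp add: dderiv1_def)

lemma real_num_socks_degs:
  assumes "1 \<le> l" "N * coeff P l \<in> \<nat>"
  shows "real (num (socks (degs P N)) l) = N * coeff P l"
proof -
  obtain m where "N * coeff P l = real m" using assms(2) by (auto simp: Nats_def)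
  then show ?thesis using assms(1) by (simp add: num_socks length_filter_degs)
qed

lemma deg_socks_degs: "deg (socks (degs P N)) v \<le> degree P"
  using set_degs[of "degs P N ! v" P N] by (auto simp: deg_socks)

lemma sum_UNION_le:
  fixes w :: "'a \<Rightarrow> real"
  assumes "finite I" "\<And>i. i \<in> I \<Longrightarrow> finite (A i)" "\<And>x. 0 \<le> w x"
  shows "sum w (\<Union>i\<in>I. A i) \<le> (\<Sum>i\<in>I. sum w (A i))"
  using assms
proof (induction I rule: finite_induct)
  case (insert i I)
  have "sum w (A i \<union> (\<Union>i\<in>I. A i)) \<le> sum w (A i) + sum w (\<Union>i\<in>I. A i)"
    using insert by (subst sum.union_inter[symmetric]) (auto intro!: sum_nonneg)
  then show ?case using insert by fastforce
qed simp

text \<open>For admissible \<open>n\<close> the degree counts are exact, so the check profile has no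
  error and only the variable profile fluctuates, through the erasures.\<close>

lemma ldpc_avg_entropy_near:
  fixes Lam Gam :: "real poly" and eps P d d' :: real
  assumes Lam: "coeff Lam 0 = 0" "(\<Sum>l=1..D. coeff Lam l) = 1" "degree Lam \<le> D"
    and Gam: "degree Gam \<le> D" "0 < dderiv1 Gam"
    and eps: "0 \<le> eps" "eps \<le> 1"
    and cl: "close (nearF (\<le>) D {1..D} (\<lambda>l. eps * coeff Lam l) (\<lambda>j. dderiv1 Lam / dderiv1 Gam * coeff Gam j)) ment P d"
    and d: "0 \<le> d" "d < d'"
  shows "eventually (\<lambda>n. ldpc_adm Lam Gam n \<longrightarrow> \<bar>ldpc_avg_entropy Lam Gam eps n / real n - P\<bar> < d') sequentially"
proof -
  define a where "a = (\<lambda>l. eps * coeff Lam l)"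
  define c where "c = (\<lambda>j. dderiv1 Lam / dderiv1 Gam * coeff Gam j)"
  define B where "B = 1 + \<bar>P\<bar>"
  have B0: "0 \<le> B" by (simp add: B_def)
  from slack_exists[OF d(2) this] obtain g where g0: "0 < g" and dg: "(d + d') / 2 + g * B < d'" .
  from cl d have "eventually (\<lambda>st. \<bar>ment (sv st) (sc st) / sn st - P\<bar> < (d + d') / 2) (nearF (\<le>) D {1..D} a c)"
    unfolding a_def c_def by (intro cl[unfolded close_def, rule_format]) simp
  then obtain e where e: "0 < e" "\<And>st. near (\<le>) D {1..D} a c e st \<Longrightarrow>
      \<bar>ment (sv st) (sc st) / sn st - P\<bar> < (d + d') / 2"
    unfolding eventually_nearF by blast
  \<comment> \<open>The first summand gives \<open>1 \<le> e * n\<close> as required by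
    \<open>near\<close>, the second makes the Chebyshev bound \<open>D / (e^2 * n)\<close> at most
    \<open>g\<close>, and the third keeps \<open>n\<close> positive.\<close>
  define n0 where "n0 = nat \<lceil>1 / e + real D / (e\<^sup>2 * g) + 1\<rceil>"
  show ?thesis
  proof (rule eventually_sequentiallyI[of n0], intro impI)
    fix n assume n: "n0 \<le> n" and adm: "ldpc_adm Lam Gam n"
    have "1 / e + real D / (e\<^sup>2 * g) + 1 \<le> real n" using n unfolding n0_def by linarith
    moreover have "0 \<le> 1 / e" "0 \<le> real D / (e\<^sup>2 * g)" using e g0 by auto
    ultimately have n1: "1 / e \<le> real n" "real D / (e\<^sup>2 * g) \<le> real n" "0 < real n" by linarith+
    define vd where "vd = vdegs Lam n"
    define cd where "cd = cdegs Lam Gam n"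
    have nv: "real (num (socks vd) l) = real n * coeff Lam l" if "1 \<le> l" for l
      unfolding vd_def vdegs_def using adm that by (intro real_num_socks_degs) (auto simp: ldpc_adm_def)
    have nc: "real (num (socks cd) j) = real n * c j" if "1 \<le> j" for j
    proof -
      have "real (num (socks cd) j) = ncheck Lam Gam n * coeff Gam j"
        unfolding cd_def cdegs_def using adm that by (intro real_num_socks_degs) (auto simp: ldpc_adm_def)
      then show ?thesis by (simp add: c_def ncheck_def)
    qed
    have degv: "deg (socks vd) v \<le> D" for v
      unfolding vd_def vdegs_def using deg_socks_degs[of Lam "real n" v] Lam by simp
    have degc: "deg (socks cd) v \<le> D" for v
      unfolding cd_def cdegs_def using deg_socks_degs[of Gam "ncheck Lam Gam n" v] Gam by simp
    have pos: "0 < x" if "x \<in> set vd" for x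
    proof (rule ccontr)
      assume "\<not> 0 < x"
      then show False using set_degs[of x Lam "real n"] that Lam(1) by (simp add: vd_def vdegs_def)
    qed
    have len: "length vd = n"
    proof -
      have "real (length vd) = (\<Sum>l=1..D. real (num (socks vd) l))"
        using card_nodes_eq_sum_num[OF finite_socks degv] fst_socks[OF pos] by simp
      also have "\<dots> = (\<Sum>l=1..D. real n * coeff Lam l)" using nv by (intro sum.cong) auto
      also have "\<dots> = real n" using Lam(2) by (simp add: sum_distrib_left[symmetric])
      finally show ?thesis by simp
    qed
    have "real (sum_list vd) = (\<Sum>l=1..D. real n * coeff Lam l * real l)"
      using card_eq_sum_num[OF finite_socks degv] nv by (simp add: card_socks)
    also have "\<dots> = real n * dderiv1 Lam" using dderiv1_eq_sum[OF Lam(3)] by (simp add: sum_distrib_left mult_ac)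
    finally have sv: "real (sum_list vd) = real n * dderiv1 Lam" .
    have "real (sum_list cd) = (\<Sum>l=1..D. real n * c l * real l)"
      using card_eq_sum_num[OF finite_socks degc] nc by (simp add: card_socks)
    also have "\<dots> = real n * (dderiv1 Lam / dderiv1 Gam) * dderiv1 Gam"
      unfolding dderiv1_eq_sum[OF Gam(1)] sum_distrib_left by (simp add: c_def dderiv1_eq_sum[OF Gam(1)] mult_ac)
    finally have "real (sum_list cd) = real n * dderiv1 Lam" using Gam(2) by simp
    then have sum: "sum_list cd = sum_list vd" using sv by simp
    have num_lift: "num (lift (socks vd) E) l = card {v\<in>{v. deg (socks vd) v = l}. v \<in> E}" if "1 \<le> l" for l E
      unfolding num_def using that by (intro arg_cong[where f=card]) (auto simp: lift_deg split: if_splits)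
    let ?I = "\<lambda>l. {v. deg (socks vd) v = l}"
    let ?T = "socks cd" and ?w = "erasure_weight eps n" and ?K = "Pow {0..<n}"
    define X where "X l E = real (card {v\<in>?I l. v \<in> E}) - real (card (?I l)) * eps" for l E
    define Bad where "Bad = (\<Union>l\<in>{1..D}. {E\<in>?K. e * real n < \<bar>X l E\<bar>})"
    have "\<bar>(\<Sum>E\<in>?K. ?w E * (ment (lift (socks vd) E) ?T / real n)) - P\<bar> \<le> (d + d') / 2 + g * B"
    proof (rule weighted_close[where Bad = Bad])
      fix E assume E: "E \<in> ?K"
      let ?S = "lift (socks vd) E"
      have fS: "finite ?S" by (simp add: lift_def)
      have "fst ` ?S = E" using fst_socks[OF pos] len E by (intro fst_lift) auto
      then have "card (fst ` ?S) \<le> n" using E card_mono[of "{0..<n}" E] by simp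
      then have "0 \<le> ment ?S ?T" "ment ?S ?T \<le> real n" using ment_bounds[OF fS, of ?T] by linarith+
      then have "0 \<le> ment ?S ?T / real n" "ment ?S ?T / real n \<le> 1" using n1 by auto
      then show "\<bar>ment ?S ?T / real n - P\<bar> \<le> B" unfolding B_def by linarith
      show "\<bar>ment ?S ?T / real n - P\<bar> \<le> (d + d') / 2" if nb: "E \<notin> Bad"
      proof -
        have "near (\<le>) D {1..D} a c e (n, ?S, ?T)"
          unfolding near_def
        proof (intro conjI ballI allI)
          show "finite (sv (n, ?S, ?T))" "finite (sc (n, ?S, ?T))" using fS by auto
          show "card (sv (n, ?S, ?T)) \<le> card (sc (n, ?S, ?T))"
            using card_mono[of "socks vd" ?S] sum by (simp add: card_socks lift_def)
          show "deg (sv (n, ?S, ?T)) v \<le> D" for v using degv by (simp add: lift_deg)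
          show "deg (sc (n, ?S, ?T)) v \<le> D" for v using degc by simp
          show "1 \<le> e * sn (n, ?S, ?T)" using n1(1) e by (simp add: divide_le_eq mult.commute)
          show "\<bar>real (num (sc (n, ?S, ?T)) j) / sn (n, ?S, ?T) - c j\<bar> \<le> e" if "j \<in> {1..D}" for j
            using nc[of j] that n1 e by simp
          fix l assume l: "l \<in> {1..D}"
          have "\<bar>X l E\<bar> \<le> e * real n" using nb E l by (auto simp: Bad_def not_less)
          moreover have "X l E = real (num ?S l) - real n * a l"
            using num_lift[of l E] nv[of l] l by (simp add: X_def a_def num_def)
          ultimately have "\<bar>(real (num ?S l) - real n * a l) / real n\<bar> \<le> e"
            using n1 by (simp add: abs_divide divide_le_eq)
          then show "\<bar>real (num (sv (n, ?S, ?T)) l) / sn (n, ?S, ?T) - a l\<bar> \<le> e"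
            using n1 by (simp add: diff_divide_distrib)
        qed
        from e(2)[OF this] show ?thesis by simp
      qed
    next
      have "(\<Sum>E\<in>?K \<inter> Bad. ?w E) \<le> (\<Sum>l\<in>{1..D}. \<Sum>E\<in>{E\<in>?K. e * real n < \<bar>X l E\<bar>}. ?w E)"
      proof -
        have "?K \<inter> Bad = Bad" by (auto simp: Bad_def)
        then show ?thesis unfolding Bad_def
          using erasure_weight_nonneg[OF eps] by (simp only:) (intro sum_UNION_le, auto)
      qed
      also have "\<dots> \<le> (\<Sum>l\<in>{1..D}. real n / (e * real n)\<^sup>2)"
      proof (intro sum_mono)
        fix l assume l: "l \<in> {1..D}"
        have "?I l \<subseteq> {0..<n}" using l len by (auto simp: deg_socks split: if_splits)
        then show "(\<Sum>E\<in>{E\<in>?K. e * real n < \<bar>X l E\<bar>}. ?w E) \<le> real n / (e * real n)\<^sup>2"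
          unfolding X_def using eps e n1 by (intro erasure_deviation) auto
      qed
      also have "\<dots> = real D / (e\<^sup>2 * real n)" using n1 e by (simp add: power2_eq_square)
      also have "\<dots> \<le> g"
      proof -
        have "real D \<le> real n * (e\<^sup>2 * g)" using n1(2) e g0 by (simp add: divide_le_eq)
        then show ?thesis using n1 e by (simp add: divide_le_eq mult_ac)
      qed
      finally show "(\<Sum>E\<in>?K \<inter> Bad. ?w E) \<le> g" .
    qed (use eps d B0 in \<open>auto simp: erasure_weight_nonneg sum_erasure_weight\<close>)
    moreover have "ldpc_avg_entropy Lam Gam eps n / real n = (\<Sum>E\<in>?K. ?w E * (ment (lift (socks vd) E) ?T / real n))"
      using ldpc_avg_entropy_eq[of Lam n Gam eps] len pos sum
      by (simp add: vd_def cd_def sum_divide_distrib)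
    ultimately show "\<bar>ldpc_avg_entropy Lam Gam eps n / real n - P\<bar> < d'" using dg by simp
  qed
qed

section \<open>Density evolution\<close>

lemma coeff_antideriv: "coeff (antideriv p) l = (case l of 0 \<Rightarrow> 0 | Suc k \<Rightarrow> coeff p k / real (Suc k))"
  by (auto simp: antideriv_def nth_default_def nth_Cons coeff_eq_0 simp del: upt_Suc split: nat.splits)

lemma pderiv_antideriv: "pderiv (antideriv p) = p"
  by (rule poly_eqI) (simp add: coeff_pderiv coeff_antideriv)

lemma poly_mono_nonneg:
  fixes p :: "real poly"
  assumes "\<And>k. 0 \<le> coeff p k" "0 \<le> s" "s \<le> t"
  shows "poly p s \<le> poly p t"
  unfolding poly_altdef using assms by (intro sum_mono mult_left_mono power_mono) auto

lemma poly_nonneg: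
  fixes p :: "real poly"
  assumes "\<And>k. 0 \<le> coeff p k" "0 \<le> s"
  shows "0 \<le> poly p s"
  unfolding poly_altdef using assms by (intro sum_nonneg) auto

lemma nodep_props:
  fixes p :: "real poly"
  assumes nn: "\<And>k. 0 \<le> coeff p k" and p0: "coeff p 0 = 0" and p1: "poly p 1 = 1"
  shows "\<And>l. 0 \<le> coeff (nodep p) l" "coeff (nodep p) 0 = 0" "coeff (nodep p) 1 = 0"
    "poly (nodep p) 1 = 1" "0 < dderiv1 (nodep p)" "pderiv (nodep p) = smult (dderiv1 (nodep p)) p"
proof -
  define I where "I = poly (antideriv p) 1"
  have nna: "0 \<le> coeff (antideriv p) l" for l using nn by (auto simp: coeff_antideriv split: nat.splits)
  have "0 \<le> I" unfolding I_def using nna by (intro poly_nonneg) auto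
  moreover have "I \<noteq> 0"
  proof
    assume "I = 0"
    then have "(\<Sum>i\<le>degree (antideriv p). coeff (antideriv p) i) = 0" by (simp add: I_def poly_altdef)
    then have "coeff (antideriv p) i = 0" if "i \<le> degree (antideriv p)" for i
      using nna that by (subst (asm) sum_nonneg_eq_0_iff) auto
    then have "antideriv p = 0" by (simp add: leading_coeff_0_iff[symmetric])
    then have "p = 0" using pderiv_antideriv[of p] by simp
    then show False using p1 by simp
  qed
  ultimately have I: "0 < I" by simp
  have pd: "pderiv (nodep p) = smult (1 / I) p" by (simp add: nodep_def pderiv_smult pderiv_antideriv I_def)
  have dd: "dderiv1 (nodep p) = 1 / I" using p1 by (simp add: dderiv1_def pd)
  show "\<And>l. 0 \<le> coeff (nodep p) l" using I nna by (simp add: nodep_def I_def[symmetric])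
  show "coeff (nodep p) 0 = 0" "coeff (nodep p) 1 = 0" using p0 by (simp_all add: nodep_def coeff_antideriv)
  show "poly (nodep p) 1 = 1" using I by (simp add: nodep_def I_def)
  show "0 < dderiv1 (nodep p)" "pderiv (nodep p) = smult (dderiv1 (nodep p)) p" using I pd dd by auto
qed

lemma pcompose_power: "(q ^ n) \<circ>\<^sub>p r = (q \<circ>\<^sub>p r) ^ n" for q r :: "real poly"
  by (induction n) (simp_all add: pcompose_mult pcompose_1)

text \<open>On generating polynomials, binomial thinning is the substitution of
  \<open>1 - p + p * z\<close> for \<open>z\<close>.\<close>

lemma coeff_pcompose_binp:
  fixes q :: "real poly"
  assumes "degree q \<le> D"
  shows "coeff (q \<circ>\<^sub>p [:1 - p, p:]) j = (\<Sum>i\<le>D. coeff q i * binp i j p)"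
proof -
  have lin: "coeff ([:1 - p, p:] ^ i) j = binp i j p" for i
  proof (cases "j \<le> i")
    case True
    then show ?thesis by (simp add: coeff_linear_poly_power binp_def)
  next
    case False
    have "degree ([:1 - p, p:] ^ i) \<le> i" using degree_power_le[of "[:1 - p, p:]" i]
      by (metis degree_pCons_le degree_pCons_0 One_nat_def le_trans mult_1 mult_le_mono1)
    then show ?thesis using False by (simp add: coeff_eq_0 binp_def binomial_eq_0)
  qed
  have "q \<circ>\<^sub>p [:1 - p, p:] = (\<Sum>i\<le>D. monom (coeff q i) i) \<circ>\<^sub>p [:1 - p, p:]"
    using poly_as_sum_of_monoms'[OF assms] by simp
  also have "\<dots> = (\<Sum>i\<le>D. smult (coeff q i) ([:1 - p, p:] ^ i))"
    unfolding pcompose_sum by (intro sum.cong refl) (simp add: monom_altdef pcompose_smult pcompose_power pcompose_pCons)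
  finally show ?thesis by (simp add: coeff_sum lin)
qed

lemma poly_eq_sum_coeff:
  fixes q :: "real poly"
  assumes "degree q \<le> D"
  shows "poly q 1 = (\<Sum>i\<le>D. coeff q i)"
  unfolding poly_altdef using assms by (subst sum.mono_neutral_left[of "{..D}"]) (auto simp: coeff_eq_0)

text \<open>Brings \<open>Psi\<close> into the gain and loss form used by the first-moment bound.
  The point \<open>u = 0\<close> is included because the value there yields the sign of the trial
  entropy.\<close>

lemma Psi_eq:
  assumes deg: "degree Le \<le> D" "degree Ge \<le> D"
    and Le: "\<And>l. 0 \<le> coeff Le l" "coeff Le 0 = 0" "0 < dderiv1 Le"
    and Ge: "coeff Ge 0 = 0" "coeff Ge 1 = 0"
    and u: "0 \<le> u"
  defines "v \<equiv> vfun D (coeff Le) u"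
  shows "Psi Le Ge u = dderiv1 Le * gain u v + (\<Sum>l=1..D. coeff Le l * (var_loss u l - 1))
    + (\<Sum>r=2..D. dderiv1 Le / dderiv1 Ge * coeff Ge r * (chk_loss v r + 1))"
proof -
  define E where "E = dderiv1 Le"
  have E0: "0 < E" using Le by (simp add: E_def)
  have lm: "coeff (pderiv Le) (l - 1) / E = coeff Le l * real l / E" if "1 \<le> l" for l
    using that by (cases l) (simp_all add: coeff_pderiv)
  have ext: "(\<Sum>l\<in>{1..degree Le}. coeff (pderiv Le) (l - 1) / E * f l) = (\<Sum>l=1..D. coeff Le l * real l * f l) / E" for f :: "nat \<Rightarrow> real"
  proof -
    have "(\<Sum>l\<in>{1..degree Le}. coeff (pderiv Le) (l - 1) / E * f l) = (\<Sum>l\<in>{1..degree Le}. coeff Le l * real l / E * f l)"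
      using lm by (intro sum.cong) auto
    also have "\<dots> = (\<Sum>l\<in>{1..D}. coeff Le l * real l / E * f l)"
      using deg by (intro sum.mono_neutral_left) (auto simp: coeff_eq_0)
    finally show ?thesis by (simp add: sum_divide_distrib)
  qed
  have v: "(\<Sum>l\<in>{1..degree Le}. coeff (pderiv Le) (l - 1) / E * u ^ (l - 1) / (1 + u ^ l))
      / (\<Sum>l\<in>{1..degree Le}. coeff (pderiv Le) (l - 1) / E / (1 + u ^ l)) = v"
    using ext[of "\<lambda>l. u ^ (l - 1) / (1 + u ^ l)"] ext[of "\<lambda>l. 1 / (1 + u ^ l)"] E0
    by (simp add: v_def vfun_def)
  have pw: "0 < 1 + u ^ l" for l using u by (simp add: add_pos_nonneg)
  have v0: "0 \<le> v" unfolding v_def vfun_def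
    using Le u pw by (intro divide_nonneg_nonneg sum_nonneg) (auto intro: less_imp_le)
  have uv: "0 < 1 + u * v" "0 < 1 + u" "0 < 1 + v" using u v0 by (auto simp: add_pos_nonneg)
  have t1: "- E * log 2 ((1 + u * v) / ((1 + u) * (1 + v))) = E * gain u v"
    unfolding gain_def using uv by (simp add: log_divide log_mult algebra_simps)
  have t2: "(\<Sum>l\<le>degree Le. coeff Le l * log 2 ((1 + u ^ l) / (2 * (1 + u) ^ l))) = (\<Sum>l=1..D. coeff Le l * (var_loss u l - 1))"
  proof -
    have "log 2 ((1 + u ^ l) / (2 * (1 + u) ^ l)) = var_loss u l - 1" for l
    proof -
      have "(1 + u ^ l) / (2 * (1 + u) ^ l) = ((1 + u ^ l) / (1 + u) ^ l) / 2" by simp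
      moreover have "0 < (1 + u ^ l) / (1 + u) ^ l" using pw[of l] uv by simp
      ultimately show ?thesis unfolding var_loss_def by (simp only: log_divide_pos) simp
    qed
    then have "(\<Sum>l\<le>degree Le. coeff Le l * log 2 ((1 + u ^ l) / (2 * (1 + u) ^ l))) = (\<Sum>l\<le>degree Le. coeff Le l * (var_loss u l - 1))"
      by simp
    also have "\<dots> = (\<Sum>l\<le>D. coeff Le l * (var_loss u l - 1))"
      using deg by (intro sum.mono_neutral_left) (auto simp: coeff_eq_0)
    also have "\<dots> = (\<Sum>l=1..D. coeff Le l * (var_loss u l - 1))"
      using Le(2) by (intro sum.mono_neutral_right) (auto simp: not_less_eq_eq)
    finally show ?thesis .
  qed
  have t3: "(\<Sum>r\<le>degree Ge. coeff Ge r * log 2 (1 + ((1 - v) / (1 + v)) ^ r)) = (\<Sum>r=2..D. coeff Ge r * (chk_loss v r + 1))"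
  proof -
    have "(\<Sum>r\<le>degree Ge. coeff Ge r * log 2 (1 + ((1 - v) / (1 + v)) ^ r)) = (\<Sum>r\<le>D. coeff Ge r * log 2 (1 + ((1 - v) / (1 + v)) ^ r))"
      using deg by (intro sum.mono_neutral_left) (auto simp: coeff_eq_0)
    also have "\<dots> = (\<Sum>r=2..D. coeff Ge r * log 2 (1 + ((1 - v) / (1 + v)) ^ r))"
    proof (intro sum.mono_neutral_right)
      show "\<forall>i\<in>{..D} - {2..D}. coeff Ge i * log 2 (1 + ((1 - v) / (1 + v)) ^ i) = 0"
      proof
        fix i assume "i \<in> {..D} - {2..D}"
        then have "i = 0 \<or> i = 1" by auto
        then show "coeff Ge i * log 2 (1 + ((1 - v) / (1 + v)) ^ i) = 0" using Ge by auto
      qed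
    qed auto
    also have "\<dots> = (\<Sum>r=2..D. coeff Ge r * (chk_loss v r + 1))"
    proof (rule sum.cong[OF refl])
      fix r assume r: "r \<in> {2..D}"
      have "0 < 1 + ((1 - v) / (1 + v)) ^ r"
        using one_plus_power_bounds(1)[of v r] v0 r by (cases "v = 0") auto
      then have "log 2 (1 + ((1 - v) / (1 + v)) ^ r) = chk_loss v r + 1"
        unfolding chk_loss_def by (simp add: log_divide)
      then show "coeff Ge r * log 2 (1 + ((1 - v) / (1 + v)) ^ r) = coeff Ge r * (chk_loss v r + 1)" by simp
    qed
    finally show ?thesis .
  qed
  show ?thesis
    unfolding Psi_def Let_def E_def[symmetric] v t1 t2 t3
    by (simp add: sum_distrib_left mult.assoc)
qed

lemma Psi_zero: "Psi 0 G u = 0"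
  by (simp add: Psi_def dderiv1_def Let_def)

locale density_evolution =
  fixes lam rho :: "real poly" and eps :: real and D :: nat
  assumes ddp: "ddp lam rho" and eps: "0 \<le> eps" "eps \<le> 1"
    and D: "degree (nodep lam) \<le> D" "degree (nodep rho) \<le> D" "1 \<le> D"
begin

definition "L1 = dderiv1 (nodep lam)"
definition "G1 = dderiv1 (nodep rho)"
definition "va y l = eps * coeff (nodep lam) l * y ^ l" for y :: real and l :: nat
text \<open>Only the indices \<open>j \<ge> 2\<close> describe a residual graph. Leaves removed in
  earlier rounds are missing from it, so after the first round \<open>ch x 1\<close> is not the
  number of leaves; the edge balance determines that number.\<close>

definition "ch x j = L1 / G1 * coeff (nodep rho \<circ>\<^sub>p [:1 - x, x:]) j" for x :: real and j :: nat

lemma nn: "0 \<le> coeff lam k" "0 \<le> coeff rho k"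
  and c0: "coeff lam 0 = 0" "coeff rho 0 = 0"
  and one: "poly lam 1 = 1" "poly rho 1 = 1"
  using ddp by (auto simp: ddp_def)

lemmas Lam = nodep_props[OF nn(1) c0(1) one(1)]
lemmas Gam = nodep_props[OF nn(2) c0(2) one(2)]

lemma pos: "0 < L1" "0 < G1"
  using Lam Gam by (auto simp: L1_def G1_def)

lemma lam_bounds: "0 \<le> s \<Longrightarrow> s \<le> 1 \<Longrightarrow> 0 \<le> poly lam s \<and> poly lam s \<le> 1"
  and rho_bounds: "0 \<le> s \<Longrightarrow> s \<le> 1 \<Longrightarrow> 0 \<le> poly rho s \<and> poly rho s \<le> 1"
  using poly_nonneg[OF nn(1), of s] poly_mono_nonneg[OF nn(1), of s 1]
    poly_nonneg[OF nn(2), of s] poly_mono_nonneg[OF nn(2), of s 1] one by auto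

lemma edges_va: "(\<Sum>l=1..D. va y l * real l) = eps * y * L1 * poly lam y"
proof -
  have "(\<Sum>l=1..D. va y l * real l) = eps * (\<Sum>l=1..D. coeff (nodep lam) l * real l * y ^ l)"
    by (simp add: va_def sum_distrib_left mult_ac)
  then show ?thesis using sum_coeff_deriv[OF D(1), of y] Lam(6) by (simp add: L1_def)
qed

lemma degree_thin: "degree (nodep rho \<circ>\<^sub>p [:1 - x, x:]) \<le> D"
proof -
  have "degree (nodep rho \<circ>\<^sub>p [:1 - x, x:]) \<le> degree (nodep rho) * degree [:1 - x, x:]" by (rule degree_pcompose_le)
  also have "\<dots> \<le> degree (nodep rho) * 1" by (intro mult_le_mono) auto
  finally show ?thesis using D by simp
qed

lemma pderiv_thin: "poly (pderiv (nodep rho \<circ>\<^sub>p [:1 - x, x:])) z = x * G1 * poly rho (1 - x + z * x)"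
  by (simp add: pderiv_pcompose Gam(6) G1_def poly_pcompose pderiv_pCons)

lemma ch_1: "ch x 1 = L1 * x * poly rho (1 - x)"
proof -
  have "coeff (nodep rho \<circ>\<^sub>p [:1 - x, x:]) 1 = coeff (pderiv (nodep rho \<circ>\<^sub>p [:1 - x, x:])) 0"
    by (simp add: coeff_pderiv)
  also have "\<dots> = x * G1 * poly rho (1 - x)" using pderiv_thin[of x 0] by (simp add: poly_0_coeff_0)
  finally show ?thesis using pos by (simp add: ch_def)
qed

lemma edges_ch: "(\<Sum>j=1..D. ch x j * real j) = L1 * x"
proof -
  have "(\<Sum>j=1..D. ch x j * real j) = L1 / G1 * (\<Sum>l=1..D. coeff (nodep rho \<circ>\<^sub>p [:1 - x, x:]) l * real l * 1 ^ l)"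
    by (simp add: ch_def sum_distrib_left mult_ac)
  also have "\<dots> = L1 / G1 * (1 * poly (pderiv (nodep rho \<circ>\<^sub>p [:1 - x, x:])) 1)"
    using sum_coeff_deriv[OF degree_thin[of x], of 1] by (simp only:)
  also have "\<dots> = L1 * x" unfolding pderiv_thin using pos one by simp
  finally show ?thesis .
qed

lemma split1: "(\<Sum>j=1..D. f j) = f 1 + (\<Sum>j=2..D. f j)" for f :: "nat \<Rightarrow> real"
proof -
  have "{1..D} = insert 1 {2..D}" using D by auto
  then show ?thesis by simp
qed

lemma edges_ch2: "(\<Sum>j=2..D. ch x j * real j) = L1 * x * (1 - poly rho (1 - x))"
  using edges_ch[of x] ch_1[of x] unfolding split1 by (simp add: algebra_simps)

text \<open>Successive thinnings multiply their probabilities, because the substituted linear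
  polynomials compose to one of the same shape.\<close>

lemma ch_thin: "ch (x * p) j = (\<Sum>i\<le>D. ch x i * binp i j p)"
proof -
  have "[:1 - x, x:] \<circ>\<^sub>p [:1 - p, p:] = [:1 - x * p, x * p:]"
    by (simp add: pcompose_pCons algebra_simps)
  then have "nodep rho \<circ>\<^sub>p [:1 - x * p, x * p:] = (nodep rho \<circ>\<^sub>p [:1 - x, x:]) \<circ>\<^sub>p [:1 - p, p:]"
    by (simp only: pcompose_assoc[symmetric])
  then show ?thesis unfolding ch_def
    by (simp add: coeff_pcompose_binp[OF degree_thin] sum_distrib_left mult_ac)
qed

lemma ch_thin2:
  assumes "2 \<le> j"
  shows "ch (x * p) j = (\<Sum>i=2..D. ch x i * binp i j p)"
  unfolding ch_thin
proof (rule sum.mono_neutral_right)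
  show "\<forall>i\<in>{..D} - {2..D}. ch x i * binp i j p = 0"
  proof
    fix i assume "i \<in> {..D} - {2..D}"
    then have "i < j" using assms by auto
    then show "ch x i * binp i j p = 0" by (simp add: binp_def binomial_eq_0)
  qed
qed auto

lemma binp_1_eq_0: "2 \<le> j \<Longrightarrow> binp 1 j p = 0"
  by (simp add: binp_def binomial_eq_0)

lemma ch_nonneg: "0 \<le> x \<Longrightarrow> x \<le> 1 \<Longrightarrow> 0 \<le> ch x j"
  unfolding ch_def coeff_pcompose_binp[OF D(2)]
  using pos Gam(1) binp_bounds(1)[of x] by (intro mult_nonneg_nonneg sum_nonneg) auto

text \<open>Edge balance: the variables carry \<open>L1 * x * y\<close> sockets, of which
  \<open>L1 * x * y'\<close> belong to non-leaf checks. A socket avoids the leaves with probability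
  \<open>y' / y\<close>, which turns \<open>va y\<close> into \<open>va y'\<close>. Then
  \<open>L1 * x' * y'\<close> edges with \<open>x' = eps * poly lam y'\<close> occupy
  \<open>L1 * x * y'\<close> check sockets, and thinning by \<open>x' / x\<close> turns
  \<open>ch x\<close> into \<open>ch x'\<close>.\<close>

lemma close_round:
  assumes y: "0 < y" "x = eps * poly lam y" "0 < x"
    and y': "y' = 1 - poly rho (1 - x)" "0 < y'"
    and d: "0 \<le> d"
    and cl: "close (nearF (=) D {2..D} (va y') (ch (eps * poly lam y'))) lent P d"
  shows "close (nearF (=) D {2..D} (va y) (ch x)) lent P d"
proof (rule close_peel[OF _ d])
  have Es: "(\<Sum>l=1..D. va y l * real l) = L1 * x * y" using edges_va[of y] y by simp
  then show "0 < (\<Sum>l=1..D. va y l * real l)" using y pos by simp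
  show "va y' l = va y l * ((\<Sum>j=2..D. ch x j * real j) / (\<Sum>l=1..D. va y l * real l)) ^ l" for l
  proof -
    have "(\<Sum>j=2..D. ch x j * real j) / (\<Sum>l=1..D. va y l * real l) = y' / y"
      unfolding Es edges_ch2 y'(1)[symmetric] using pos(1) y(1,3) by simp
    then show ?thesis using y by (simp add: va_def power_divide)
  qed
  let ?c = "(ch x)(1 := 0)"
  have c2: "(\<Sum>i=1..D. ?c i * f i) = (\<Sum>i=2..D. ch x i * f i)" for f :: "nat \<Rightarrow> real"
    unfolding split1 by (auto intro!: sum.cong)
  have Ec: "(\<Sum>i=1..D. ?c i * real i) = L1 * x * y'" unfolding c2 edges_ch2 y'(1) by simp
  show "close (nearF (\<le>) D {1..D} (va y') ?c) ment P d"
  proof (rule close_thin[OF cl d])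
    show "0 < (\<Sum>i=1..D. ?c i * real i)" unfolding Ec using pos y y' by simp
    fix j assume j: "j \<in> {2..D}"
    have p: "(\<Sum>l=1..D. va y' l * real l) / (\<Sum>i=1..D. ?c i * real i) = eps * poly lam y' / x"
      unfolding Ec edges_va using pos y y' by simp
    show "ch (eps * poly lam y') j = (\<Sum>i=1..D. ?c i * binp i j ((\<Sum>l=1..D. va y' l * real l) / (\<Sum>i=1..D. ?c i * real i)))"
      unfolding p unfolding c2 using ch_thin2[of j x "eps * poly lam y' / x"] j y(3) by simp
  qed
qed

text \<open>The erasure step is a half-round: the full check side, \<open>x = 1\<close>, is thinned
  with probability \<open>eps\<close>.\<close>

lemma close_erasure:
  assumes d: "0 \<le> d" and cl: "close (nearF (=) D {2..D} (va 1) (ch eps)) lent P d"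
  shows "close (nearF (\<le>) D {1..D} (\<lambda>l. eps * coeff (nodep lam) l) (\<lambda>j. L1 / G1 * coeff (nodep rho) j)) ment P d"
proof -
  have a: "va 1 = (\<lambda>l. eps * coeff (nodep lam) l)" by (simp add: va_def fun_eq_iff)
  have c: "ch 1 = (\<lambda>j. L1 / G1 * coeff (nodep rho) j)" by (simp add: ch_def fun_eq_iff pcompose_idR)
  show ?thesis unfolding a[symmetric] c[symmetric]
  proof (rule close_thin[OF cl d])
    show "0 < (\<Sum>i=1..D. ch 1 i * real i)" using edges_ch[of 1] pos by simp
    fix j assume j: "j \<in> {2..D}"
    have p: "(\<Sum>l=1..D. va 1 l * real l) / (\<Sum>i=1..D. ch 1 i * real i) = eps"
      unfolding edges_ch edges_va using pos one by simp
    show "ch eps j = (\<Sum>i=1..D. ch 1 i * binp i j ((\<Sum>l=1..D. va 1 l * real l) / (\<Sum>i=1..D. ch 1 i * real i)))"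
      unfolding p unfolding split1 using ch_thin2[of j 1 eps] j binp_1_eq_0[of j eps] by simp
  qed
qed

fun ys :: "nat \<Rightarrow> real" where
  "ys 0 = 1"
| "ys (Suc t) = 1 - poly rho (1 - eps * poly lam (ys t))"

lemma next_mono:
  assumes "0 \<le> s" "s \<le> t" "t \<le> 1"
  shows "1 - poly rho (1 - eps * poly lam s) \<le> 1 - poly rho (1 - eps * poly lam t)"
proof -
  have "eps * poly lam s \<le> eps * poly lam t"
    using poly_mono_nonneg[OF nn(1), of s t] assms eps by (intro mult_left_mono) auto
  moreover have "eps * poly lam t \<le> 1" using lam_bounds[of t] assms eps by (simp add: mult_le_one)
  ultimately show ?thesis using poly_mono_nonneg[OF nn(2)] by simp
qed

lemma next_bounds:
  assumes "0 \<le> s" "s \<le> 1"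
  shows "0 \<le> 1 - poly rho (1 - eps * poly lam s)" "1 - poly rho (1 - eps * poly lam s) \<le> 1"
proof -
  have "0 \<le> eps * poly lam s" "eps * poly lam s \<le> 1"
    using lam_bounds[of s] assms eps by (auto simp: mult_le_one)
  then show "0 \<le> 1 - poly rho (1 - eps * poly lam s)" "1 - poly rho (1 - eps * poly lam s) \<le> 1"
    using rho_bounds[of "1 - eps * poly lam s"] by auto
qed

lemma ys_bounds: "0 \<le> ys t \<and> ys t \<le> 1"
  by (induction t) (use next_bounds in auto)

lemma ys_Suc_le: "ys (Suc t) \<le> ys t"
proof (induction t)
  case 0
  then show ?case using ys_bounds[of "Suc 0"] by simp
next
  case (Suc t)
  have "1 - poly rho (1 - eps * poly lam (ys (Suc t))) \<le> 1 - poly rho (1 - eps * poly lam (ys t))"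
    by (rule next_mono) (use Suc ys_bounds in blast)+
  then show ?case by simp
qed

definition "X = bp_fix lam rho eps"
definition "Y = 1 - poly rho (1 - X)"

text \<open>The recursion is monotone and starts above every fixed point, so its decreasing limit
  dominates them all. By continuity the limit is itself a fixed point, hence the maximum behind the
  \<open>Sup\<close> in \<open>bp_fix\<close>.\<close>

lemma fixpoint: "ys \<longlonglongrightarrow> Y" "X = eps * poly lam Y" "0 \<le> X" "X \<le> 1" "0 \<le> Y" "Y \<le> 1" "Y \<le> ys t"
proof -
  have "decseq ys" using ys_Suc_le by (rule decseq_SucI)
  then obtain L where L: "ys \<longlonglongrightarrow> L" "\<forall>t. L \<le> ys t"
    using decseq_convergent[of ys 0] ys_bounds by blast
  have L01: "0 \<le> L" "L \<le> 1"
    using LIMSEQ_le_const[OF L(1), of 0] ys_bounds L(2) order_trans by blast+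
  have "(\<lambda>t. ys (Suc t)) \<longlonglongrightarrow> 1 - poly rho (1 - eps * poly lam L)"
    unfolding ys.simps by (intro tendsto_intros tendsto_poly L)
  then have Lfix: "L = 1 - poly rho (1 - eps * poly lam L)"
    by (rule LIMSEQ_unique[OF LIMSEQ_Suc[OF L(1)]])
  define Z where "Z = eps * poly lam L"
  have Z: "Z \<in> {0..1}" using lam_bounds[OF L01] eps by (auto simp: Z_def mult_le_one)
  have "Z = eps * poly lam (1 - poly rho (1 - Z))" unfolding Z_def by (rule arg_cong[where f = "\<lambda>s. eps * poly lam s", OF Lfix])
  moreover have "x \<le> Z" if x: "x \<in> {0..1}" "x = eps * poly lam (1 - poly rho (1 - x))" for x
  proof -
    define z where "z = 1 - poly rho (1 - x)"
    have z: "0 \<le> z" "z \<le> 1" using rho_bounds[of "1 - x"] x(1) by (auto simp: z_def)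
    have xz: "eps * poly lam z = x" using x(2) unfolding z_def by (rule sym)
    have zfix: "1 - poly rho (1 - eps * poly lam z) = z" unfolding xz by (simp only: z_def)
    have "z \<le> ys t" for t
    proof (induction t)
      case (Suc t)
      then show ?case using next_mono[of z "ys t"] z ys_bounds[of t] zfix by simp
    qed (use z in simp)
    then have "z \<le> L" using LIMSEQ_le_const[OF L(1)] by blast
    then show ?thesis unfolding xz[symmetric] Z_def
      using poly_mono_nonneg[OF nn(1) z(1)] eps by (intro mult_left_mono) auto
  qed
  ultimately have "X = Z" unfolding X_def bp_fix_def using Z by (intro cSup_eq_maximum) auto
  then have "Y = 1 - poly rho (1 - eps * poly lam L)" by (simp add: Y_def Z_def)
  then have "Y = L" using Lfix by (rule trans[OF _ sym])
  then show "ys \<longlonglongrightarrow> Y" "X = eps * poly lam Y" "0 \<le> X" "X \<le> 1" "0 \<le> Y" "Y \<le> 1" "Y \<le> ys t"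
    using L L01 Z \<open>X = Z\<close> by (auto simp: Z_def)
qed

text \<open>Induction backwards through the rounds. The iterates stay above the limit, so
  \<open>0 < X\<close> and \<open>0 < Y\<close> keep every quotient in \<open>close_round\<close>
  defined.\<close>

lemma close_initial:
  assumes Y0: "0 < Y" and X0: "0 < X" and d: "0 \<le> d"
  shows "close (nearF (=) D {2..D} (va (ys t)) (ch (eps * poly lam (ys t)))) lent P d \<Longrightarrow>
    close (nearF (=) D {2..D} (va 1) (ch eps)) lent P d"
proof (induction t)
  case 0
  then show ?case using one by simp
next
  case (Suc t)
  have yt: "0 < ys t" "0 < ys (Suc t)" using fixpoint(7)[of t] fixpoint(7)[of "Suc t"] Y0 by linarith+
  have "X \<le> eps * poly lam (ys t)"
    unfolding fixpoint(2) using poly_mono_nonneg[OF nn(1) fixpoint(5,7)] eps by (intro mult_left_mono) auto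
  then have x0: "0 < eps * poly lam (ys t)" using X0 by linarith
  have "close (nearF (=) D {2..D} (va (ys t)) (ch (eps * poly lam (ys t)))) lent P d"
    by (rule close_round[OF yt(1) refl x0 ys.simps(2) yt(2) d Suc.prems])
  then show ?case by (rule Suc.IH)
qed

text \<open>The neighbourhood of the limiting profile is fixed before \<open>t\<close>. Some iterate
  lies within \<open>e / 2\<close> of the limit, so states within \<open>e / 2\<close> of that
  iterate lie in the neighbourhood. The zero tolerance at the limit becomes \<open>d > 0\<close>,
  since the rounds stop at a finite \<open>t\<close>.\<close>

lemma close_from_fixpoint:
  assumes Y0: "0 < Y" and X0: "0 < X" and d: "0 < d"
    and cl: "close (nearF (=) D {2..D} (va Y) (ch X)) lent P 0"
  shows "close (nearF (=) D {2..D} (va 1) (ch eps)) lent P d"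
proof -
  from cl d have "eventually (\<lambda>st. \<bar>lent (sv st) (sc st) / sn st - P\<bar> < d) (nearF (=) D {2..D} (va Y) (ch X))"
    by (simp add: close_def)
  then obtain e where e: "0 < e" "\<And>st. near (=) D {2..D} (va Y) (ch X) e st \<Longrightarrow> \<bar>lent (sv st) (sc st) / sn st - P\<bar> < d"
    unfolding eventually_nearF by blast
  have "eventually (\<lambda>t. \<forall>l\<in>{1..D}. \<bar>va (ys t) l - va Y l\<bar> < e / 2) sequentially"
  proof (rule eventually_ball_close)
    show "(\<lambda>t. va (ys t) l) \<longlonglongrightarrow> va Y l" for l unfolding va_def by (intro tendsto_intros fixpoint)
  qed (use e in auto)
  moreover have "eventually (\<lambda>t. \<forall>j\<in>{2..D}. \<bar>ch (eps * poly lam (ys t)) j - ch X j\<bar> < e / 2) sequentially"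
  proof (rule eventually_ball_close)
    fix j
    have "(\<lambda>t. eps * poly lam (ys t)) \<longlonglongrightarrow> X"
      unfolding fixpoint(2) by (intro tendsto_intros tendsto_poly fixpoint)
    then show "(\<lambda>t. ch (eps * poly lam (ys t)) j) \<longlonglongrightarrow> ch X j"
      unfolding ch_def coeff_pcompose_binp[OF D(2)] binp_def by (intro tendsto_intros)
  qed (use e in auto)
  ultimately have "eventually (\<lambda>t. (\<forall>l\<in>{1..D}. \<bar>va (ys t) l - va Y l\<bar> < e / 2) \<and>
     (\<forall>j\<in>{2..D}. \<bar>ch (eps * poly lam (ys t)) j - ch X j\<bar> < e / 2)) sequentially"
    by (rule eventually_conj)
  then obtain t where t: "\<forall>l\<in>{1..D}. \<bar>va (ys t) l - va Y l\<bar> < e / 2"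
     "\<forall>j\<in>{2..D}. \<bar>ch (eps * poly lam (ys t)) j - ch X j\<bar> < e / 2"
    unfolding eventually_sequentially by blast
  have "near (=) D {2..D} (va Y) (ch X) e st"
    if st: "near (=) D {2..D} (va (ys t)) (ch (eps * poly lam (ys t))) (e / 2) st" for st
    unfolding near_def
  proof (intro conjI ballI allI)
    have "1 \<le> e / 2 * sn st" using st by (simp add: near_def)
    moreover have "0 \<le> e * sn st" using e by simp
    ultimately show "1 \<le> e * sn st" by simp
    show "\<bar>real (num (sv st) l) / sn st - va Y l\<bar> \<le> e" if "l \<in> {1..D}" for l
    proof -
      have "\<bar>real (num (sv st) l) / sn st - va (ys t) l\<bar> \<le> e / 2" using st that by (auto simp: near_def)
      moreover have "\<bar>va (ys t) l - va Y l\<bar> < e / 2" using t(1) that by blast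
      ultimately show ?thesis by linarith
    qed
    show "\<bar>real (num (sc st) j) / sn st - ch X j\<bar> \<le> e" if "j \<in> {2..D}" for j
    proof -
      have "\<bar>real (num (sc st) j) / sn st - ch (eps * poly lam (ys t)) j\<bar> \<le> e / 2" using st that by (auto simp: near_def)
      moreover have "\<bar>ch (eps * poly lam (ys t)) j - ch X j\<bar> < e / 2" using t(2) that by blast
      ultimately show ?thesis by linarith
    qed
  qed (use st in \<open>auto simp: near_def\<close>)
  then have ev: "eventually (\<lambda>st. \<bar>lent (sv st) (sc st) / sn st - P\<bar> < d)
      (nearF (=) D {2..D} (va (ys t)) (ch (eps * poly lam (ys t))))"
    unfolding eventually_nearF using e by (intro exI[of _ "e/2"]) auto
  have "close (nearF (=) D {2..D} (va (ys t)) (ch (eps * poly lam (ys t)))) lent P d"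
    unfolding close_def by (intro allI impI, rule eventually_mono[OF ev]) auto
  then show ?thesis using d by (intro close_initial[OF Y0 X0]) auto
qed


section \<open>The residual pair and the special values of \<open>Psi\<close>\<close>

definition "trial = trial_entropy (nodep lam) (nodep rho) eps X Y"

abbreviation "Le \<equiv> Lam_eps lam rho eps"
abbreviation "Ge \<equiv> Gam_eps lam rho eps"

lemma coeff_Lam_eps: "coeff Le l = va Y l"
  by (simp add: Lam_eps_def Let_def X_def[symmetric] Y_def[symmetric] coeff_pcompose_linear va_def)

lemma Gam_eps_eq: "Ge = nodep rho \<circ>\<^sub>p [:1 - X, X:] - [:poly (nodep rho) (1 - X):]
    - [:0, X * poly (pderiv (nodep rho)) (1 - X):]"
  by (simp add: Gam_eps_def Let_def X_def)

lemma coeff_Gam_eps: "2 \<le> j \<Longrightarrow> L1 / G1 * coeff Ge j = ch X j"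
  by (auto simp: Gam_eps_eq ch_def coeff_pCons split: nat.splits)

lemma coeff_Gam_eps_0: "coeff Ge 0 = 0"
  by (simp add: Gam_eps_eq poly_0_coeff_0[symmetric] poly_pcompose)

lemma coeff_Gam_eps_1: "coeff Ge 1 = 0"
proof -
  have "ch X 1 = L1 / G1 * coeff (nodep rho \<circ>\<^sub>p [:1 - X, X:]) 1" by (simp add: ch_def)
  then have "coeff (nodep rho \<circ>\<^sub>p [:1 - X, X:]) 1 = X * (G1 * poly rho (1 - X))"
    using ch_1[of X] pos by (simp add: field_simps)
  then show ?thesis using Gam(6) by (simp add: Gam_eps_eq G1_def)
qed

lemma degree_eps: "degree Le \<le> D" "degree Ge \<le> D"
proof -
  show "degree Le \<le> D"
    using D(1) by (intro degree_le) (auto simp: coeff_Lam_eps va_def coeff_eq_0)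
  show "degree Ge \<le> D"
  proof (intro degree_le allI impI)
    fix i assume i: "D < i"
    then have "coeff (nodep rho \<circ>\<^sub>p [:1 - X, X:]) i = 0" using degree_thin[of X] by (intro coeff_eq_0) simp
    then have "ch X i = 0" by (simp add: ch_def)
    then show "coeff Ge i = 0" using coeff_Gam_eps[of i] i D(3) pos by auto
  qed
qed

lemma edges_Y: "(\<Sum>l=1..D. va Y l * real l) = L1 * X * Y"
  unfolding edges_va using fixpoint(2) by simp

lemma edges_X: "(\<Sum>j=2..D. ch X j * real j) = L1 * X * Y"
  unfolding edges_ch2 Y_def ..

lemma dderiv1_Lam_eps: "dderiv1 Le = L1 * X * Y"
  using dderiv1_eq_sum[OF degree_eps(1)] edges_Y by (simp add: coeff_Lam_eps)

lemma dderiv1_Gam_eps: "dderiv1 Ge = G1 * X * Y"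
proof -
  have "L1 / G1 * dderiv1 Ge = (\<Sum>l=1..D. L1 / G1 * coeff Ge l * real l)"
    unfolding dderiv1_eq_sum[OF degree_eps(2)] by (simp add: sum_distrib_left mult_ac)
  also have "\<dots> = (\<Sum>l=2..D. ch X l * real l)"
    unfolding split1 using coeff_Gam_eps_1 coeff_Gam_eps by simp
  finally show ?thesis unfolding edges_X using pos by (simp add: field_simps)
qed

lemma trial_eq: "trial = (\<Sum>l=1..D. va Y l) - (\<Sum>j=2..D. ch X j)"
proof -
  have "poly (nodep lam) Y = (\<Sum>l\<le>D. coeff (nodep lam) l * Y ^ l)"
    unfolding poly_altdef using D(1) by (intro sum.mono_neutral_left) (auto simp: coeff_eq_0)
  also have "\<dots> = (\<Sum>l=1..D. coeff (nodep lam) l * Y ^ l)"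
    using Lam(2) by (intro sum.mono_neutral_right) (auto simp: not_less_eq_eq)
  finally have v: "(\<Sum>l=1..D. va Y l) = eps * poly (nodep lam) Y"
    by (simp add: va_def sum_distrib_left mult_ac)
  have "(\<Sum>i\<le>D. coeff (nodep rho \<circ>\<^sub>p [:1 - X, X:]) i) = 1"
    using poly_eq_sum_coeff[OF degree_thin[of X]] Gam(4) by (simp add: poly_pcompose)
  then have "(\<Sum>i\<le>D. ch X i) = L1 / G1" unfolding ch_def sum_distrib_left[symmetric] by simp
  moreover have "(\<Sum>i\<le>D. ch X i) = ch X 0 + (\<Sum>i=1..D. ch X i)"
  proof -
    have "{..D} = insert 0 {1..D}" by auto
    then show ?thesis by simp
  qed
  moreover have "ch X 0 = L1 / G1 * poly (nodep rho) (1 - X)"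
    by (simp add: ch_def poly_0_coeff_0[symmetric] poly_pcompose)
  moreover have "ch X 1 = L1 * X * (1 - Y)" using ch_1[of X] by (simp add: Y_def)
  ultimately have "(\<Sum>j=2..D. ch X j) = L1 / G1 * (1 - poly (nodep rho) (1 - X)) - L1 * X * (1 - Y)"
    unfolding split1 by (simp add: algebra_simps)
  then show ?thesis unfolding v by (simp add: trial_def trial_entropy_def L1_def G1_def)
qed

text \<open>At \<open>X = 0\<close> also \<open>Y = 0\<close>, the residual variable polynomial
  vanishes and \<open>Psi\<close> is identically zero, which contradicts the negative second
  derivative.\<close>

lemma X_pos:
  assumes "deriv (deriv (Psi Le Ge)) 1 < 0"
  shows "0 < X"
proof (rule ccontr)
  assume "\<not> 0 < X"
  then have "X = 0" using fixpoint(3) by simp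
  then have "Y = 0" using one by (simp add: Y_def)
  then have "coeff Le l = 0" for l
    using Lam(2) by (cases l) (auto simp: coeff_Lam_eps va_def)
  then have "Le = 0" by (intro poly_eqI) simp
  then have "Psi Le Ge = (\<lambda>u. 0)" by (simp add: Psi_zero fun_eq_iff)
  then show False using assms by simp
qed

lemma Y_pos: "0 < X \<Longrightarrow> 0 < Y"
  using fixpoint(2,5) c0(1) by (cases "Y = 0") (auto simp: poly_0_coeff_0)

lemma Psi_eps:
  assumes X: "0 < X" and u: "0 \<le> u"
  shows "Psi Le Ge u =
     L1 * X * Y * gain u (vfun D (va Y) u) + (\<Sum>l=1..D. va Y l * var_loss u l)
       + (\<Sum>r=2..D. ch X r * chk_loss (vfun D (va Y) u) r) - trial"
proof -
  have Y: "0 < Y" using Y_pos[OF X] .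
  have co: "coeff Le = va Y" by (simp add: fun_eq_iff coeff_Lam_eps)
  have va0: "0 \<le> va Y l" for l using Lam(1) eps Y by (simp add: va_def)
  have ratio: "L1 * X * Y / (G1 * X * Y) = L1 / G1" using X Y by simp
  have "Psi Le Ge u =
     L1 * X * Y * gain u (vfun D (va Y) u) + (\<Sum>l=1..D. va Y l * (var_loss u l - 1))
       + (\<Sum>r=2..D. L1 / G1 * coeff Ge r * (chk_loss (vfun D (va Y) u) r + 1))"
    using Psi_eq[OF degree_eps, of u] va0 X Y pos Lam(2) u coeff_Gam_eps_0 coeff_Gam_eps_1
    unfolding co dderiv1_Lam_eps dderiv1_Gam_eps ratio by (simp add: va_def)
  also have "(\<Sum>r=2..D. L1 / G1 * coeff Ge r * (chk_loss (vfun D (va Y) u) r + 1)) =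
     (\<Sum>r=2..D. ch X r * (chk_loss (vfun D (va Y) u) r + 1))"
    using coeff_Gam_eps by (intro sum.cong) auto
  finally show ?thesis unfolding trial_eq
    by (simp add: algebra_simps sum.distrib sum_subtractf)
qed

text \<open>Here \<open>v = 1\<close>, and the part of the variable losses proportional to the
  degree cancels the edge gain. What is left is one bit per variable minus one bit per check, which
  is \<open>trial\<close>.\<close>

lemma Psi_eps_1:
  assumes X: "0 < X"
  shows "Psi Le Ge 1 = 0"
proof -
  have Y: "0 < Y" using Y_pos[OF X] .
  have E0: "0 < L1 * X * Y" using X Y pos by simp
  have v: "vfun D (va Y) 1 = 1"
  proof -
    have "(\<Sum>l=1..D. va Y l * real l / (1 + 1 ^ l)) = L1 * X * Y / 2"
      using edges_Y by (simp add: sum_divide_distrib[symmetric])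
    then show ?thesis using E0 by (simp add: vfun_def)
  qed
  have g: "gain 1 1 = 1" by (simp add: gain_def)
  have vl: "var_loss 1 l = 1 - real l" for l by (simp add: var_loss_def log_divide log_nat_power)
  have cl: "chk_loss 1 r = - 1" if "2 \<le> r" for r
    using that by (simp add: chk_loss_def power_0_left log_divide)
  have "(\<Sum>r=2..D. ch X r * chk_loss 1 r) = - (\<Sum>r=2..D. ch X r)"
    using cl by (simp add: sum_negf)
  moreover have "(\<Sum>l=1..D. va Y l * var_loss 1 l) = (\<Sum>l=1..D. va Y l) - L1 * X * Y"
    using edges_Y by (simp add: vl right_diff_distrib sum_subtractf)
  ultimately show ?thesis using Psi_eps[OF X, of 1] v g trial_eq by simp
qed

text \<open>This point corresponds to the zero word, whose exponent is 0 before \<open>trial\<close>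
  is subtracted. Compared with the maximum 0 at \<open>u = 1\<close> it makes \<open>trial\<close>
  nonnegative. There are no variables of degree one, so \<open>v = 0\<close>.\<close>

lemma Psi_eps_0:
  assumes X: "0 < X"
  shows "Psi Le Ge 0 = - trial"
proof -
  have va1: "va Y (Suc 0) = 0" using Lam(3) by (simp add: va_def)
  have "(\<Sum>l=1..D. va Y l * real l * 0 ^ (l - 1) / (1 + 0 ^ l)) = 0"
  proof (intro sum.neutral ballI)
    fix l assume "l \<in> {1..D}"
    show "va Y l * real l * 0 ^ (l - 1) / (1 + 0 ^ l) = 0"
      using va1 \<open>l \<in> {1..D}\<close> by (cases "l = 1") (auto simp: power_0_left)
  qed
  then have v: "vfun D (va Y) 0 = 0" by (simp add: vfun_def)
  have "gain 0 0 = 0" by (simp add: gain_def)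
  moreover have "(\<Sum>l=1..D. va Y l * var_loss 0 l) = 0" by (intro sum.neutral) (auto simp: var_loss_def power_0_left)
  moreover have "(\<Sum>r=2..D. ch X r * chk_loss 0 r) = 0" by (intro sum.neutral) (auto simp: chk_loss_def)
  ultimately show ?thesis using Psi_eps[OF X, of 0] v by simp
qed

lemma close_at_fixpoint:
  assumes X: "0 < X"
    and max: "\<And>u. 0 \<le> u \<Longrightarrow> Psi Le Ge u
        \<le> Psi Le Ge 1"
  shows "close (nearF (=) D {2..D} (va Y) (ch X)) lent trial 0"
proof (rule close_fixpoint)
  have Y: "0 < Y" using Y_pos[OF X] .
  note one0 = Psi_eps_1[OF X]
  show "0 \<le> va Y l" for l using Lam(1) eps Y by (simp add: va_def)
  show "0 \<le> ch X j" for j using ch_nonneg fixpoint(3,4) by blast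
  show "L1 * X * Y = (\<Sum>l=1..D. va Y l * real l)" "L1 * X * Y = (\<Sum>j=2..D. ch X j * real j)"
    using edges_X edges_Y by simp_all
  show "0 < L1 * X * Y" using X Y pos by simp
  show "trial = (\<Sum>l=1..D. va Y l) - (\<Sum>j=2..D. ch X j)" by (rule trial_eq)
  show "0 \<le> trial" using max[of 0] Psi_eps_0[OF X] one0 by simp
  fix u :: real assume "0 < u"
  then show "L1 * X * Y * gain u (vfun D (va Y) u) + (\<Sum>l=1..D. va Y l * var_loss u l)
        + (\<Sum>r=2..D. ch X r * chk_loss (vfun D (va Y) u) r) \<le> trial"
    using max[of u] Psi_eps[OF X, of u] one0 by simp
qed

end

theorem theorem10:
  fixes lam rho :: "real poly" and eps :: real
  assumes "ddp lam rho"
    and "0 \<le> eps" and "eps \<le> 1"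
    and "non_exceptional lam rho eps"
    and "\<forall>u\<ge>0. Psi (Lam_eps lam rho eps) (Gam_eps lam rho eps) u
                \<le> Psi (Lam_eps lam rho eps) (Gam_eps lam rho eps) 1"
    and "deriv (deriv (Psi (Lam_eps lam rho eps) (Gam_eps lam rho eps))) 1 < 0"
  shows "((\<lambda>n. ldpc_avg_entropy (nodep lam) (nodep rho) eps n / real n) \<longlongrightarrow>
            trial_entropy (nodep lam) (nodep rho) eps (bp_fix lam rho eps)
              (1 - poly rho (1 - bp_fix lam rho eps)))
         (inf sequentially (principal {n. ldpc_adm (nodep lam) (nodep rho) n}))"
proof (rule tendstoI)
  fix e :: real assume e: "0 < e"
  define D where "D = max 1 (max (degree (nodep lam)) (degree (nodep rho)))"
  interpret density_evolution lam rho eps D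
    by unfold_locales (use assms(1-3) in \<open>auto simp: D_def\<close>)
  have X0: "0 < X" using X_pos[OF assms(6)] .
  \<comment> \<open>Stopping after finitely many rounds costs \<open>e / 2\<close>; the remaining
    slack up to \<open>e\<close> absorbs the average over the erasures.\<close>
  have "close (nearF (=) D {2..D} (va 1) (ch eps)) lent trial (e / 2)"
    using e assms(5) by (intro close_from_fixpoint Y_pos X0 close_at_fixpoint) auto
  then have "close (nearF (\<le>) D {1..D} (\<lambda>l. eps * coeff (nodep lam) l)
      (\<lambda>j. L1 / G1 * coeff (nodep rho) j)) ment trial (e / 2)"
    using e by (intro close_erasure) auto
  moreover have "(\<Sum>l=1..D. coeff (nodep lam) l) = 1"
  proof -
    have "(\<Sum>l=1..D. coeff (nodep lam) l) = (\<Sum>l\<le>D. coeff (nodep lam) l)"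
      using Lam(2) by (intro sum.mono_neutral_left) (auto simp: not_less_eq_eq)
    then show ?thesis using poly_eq_sum_coeff[OF D(1)] Lam(4) by simp
  qed
  ultimately have "eventually (\<lambda>n. ldpc_adm (nodep lam) (nodep rho) n \<longrightarrow>
      \<bar>ldpc_avg_entropy (nodep lam) (nodep rho) eps n / real n - trial\<bar> < e) sequentially"
    using Lam(2) Gam(5) D eps e unfolding L1_def G1_def
    by (intro ldpc_avg_entropy_near[where d = "e / 2"]) auto
  then show "eventually (\<lambda>n. dist (ldpc_avg_entropy (nodep lam) (nodep rho) eps n / real n)
      (trial_entropy (nodep lam) (nodep rho) eps (bp_fix lam rho eps) (1 - poly rho (1 - bp_fix lam rho eps))) < e)
     (inf sequentially (principal {n. ldpc_adm (nodep lam) (nodep rho) n}))"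
    by (simp add: eventually_inf_principal dist_real_def trial_def X_def Y_def)
qed

end
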